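(* Let $d\ge 2$, let $\Omega=B_1$ be the unit ball of $\mathbb{R}^d$, and let $F:\mathbb{R}\to\mathbb{R}$ be nonnegative of the form $F(s)=b_1|s|^{p_1}+b_2|s|^{p_2}+\dots+b_k|s|^{p_k}$ with $k\ge 1$ an integer, $2<p_1<p_2<\dots<p_k$, $b_1,\dots,b_k\in\mathbb{R}$, and $F(s)\ge b_0|s|^{p_1}$ for all $s\in\mathbb{R}$ for some $b_0>0$. Let $f=F'$. Then there is a sequence of pairs $\{(u_n,\lambda_n)\}_{n\ge 1}\subseteq V\times\mathbb{R}$, each solving $$-\Delta u_n+f(u_n)=\lambda_n u_n\ \text{ in } B_1,\qquad u_n=0\ \text{ on }\partial B_1,$$ such that $\lim_{n\to\infty}\lambda_n=+\infty$ and, for every $\tau\in(0,1)$, $$\lim_{n\to\infty}\frac{E_\tau(u_n)}{E_1(u_n)}=0.$$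
   Context: For $\tau\in(0,1]$, $B_\tau$ is the ball of radius $\tau$ centered at the origin in $\mathbb{R}^d$, and $E_\tau(u)=\int_{B_\tau}\left(\frac12|\nabla u|^2+F(u)\right)dx$. The quotient is understood to be well defined, i.e. $E_1(u_n)\neq 0$ (equivalently $u_n\not\equiv 0$). The space $V$ is: $V=H_0^1(\Omega)$ if $d=2$, or if $d\ge3$ and $p_k\le\frac{2d}{d-2}$; and $V=H_0^1(\Omega)\cap L^q(\Omega)$ with $q=\frac{d(p_k-2)}{2}$ if $d\ge 3$ and $p_k>\frac{2d}{d-2}$. Solutions are weak solutions: $u\in V$ solves the problem with parameter $\lambda$ if $\int_\Omega \nabla u\cdot\nabla v+f(u)v\,dx=\lambda\int_\Omega uv\,dx$ for all $v\in H_0^1(\Omega)$. *)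

theory Defs
  imports "HOL-Analysis.Analysis"
begin

text \<open>Functions of class \<open>C\<^sup>k\<close> on the whole space: all iterated partial derivatives of order up
  to \<open>k\<close> exist and are continuous.\<close>

primrec C_k :: "nat \<Rightarrow> ('a::euclidean_space \<Rightarrow> real) \<Rightarrow> bool" where
  "C_k 0 f \<longleftrightarrow> continuous_on UNIV f"
| "C_k (Suc k) f \<longleftrightarrow> (\<forall>x. f differentiable (at x)) \<and>
     (\<forall>i\<in>Basis. C_k k (\<lambda>x. frechet_derivative f (at x) i))"

text \<open>\<open>C\<^sub>c\<^sup>\<infinity>(\<Omega>)\<close>, with the functions extended by zero to the whole space.\<close>

definition test_functions :: "'a::euclidean_space set \<Rightarrow> ('a \<Rightarrow> real) set" where
  "test_functions \<Omega> = {\<phi>. (\<forall>k. C_k k \<phi>) \<and> compact (closure {x. \<phi> x \<noteq> 0}) \<and>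
     closure {x. \<phi> x \<noteq> 0} \<subseteq> \<Omega>}"

text \<open>Elements of the function spaces below are everywhere defined representatives on the ambient
  space; only their values on \<open>\<Omega>\<close> matter, and functions are not identified when they agree almost
  everywhere.\<close>

definition Lp_space :: "real \<Rightarrow> 'a::euclidean_space set \<Rightarrow> ('a \<Rightarrow> 'b::euclidean_space) set" where
  "Lp_space q \<Omega> = {u \<in> borel_measurable (lebesgue_on \<Omega>).
     integrable (lebesgue_on \<Omega>) (\<lambda>x. norm (u x) powr q)}"

definition has_weak_gradient ::
    "('a::euclidean_space \<Rightarrow> real) \<Rightarrow> ('a \<Rightarrow> 'a) \<Rightarrow> 'a set \<Rightarrow> bool" where
  "has_weak_gradient u g \<Omega> \<longleftrightarrow>
     (\<forall>K. compact K \<and> K \<subseteq> \<Omega> \<longrightarrow> integrable (lebesgue_on K) u \<and> integrable (lebesgue_on K) g) \<and>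
     (\<forall>\<phi>\<in>test_functions \<Omega>. \<forall>i\<in>Basis.
        (LINT x|lebesgue_on \<Omega>. u x * frechet_derivative \<phi> (at x) i) =
        - (LINT x|lebesgue_on \<Omega>. (g x \<bullet> i) * \<phi> x))"

text \<open>A weak gradient on an open set is unique up to null sets, so the choice is immaterial under
  integrals over (subsets of) \<open>\<Omega>\<close>. The value is unspecified if no weak gradient exists.\<close>

definition weak_grad :: "'a::euclidean_space set \<Rightarrow> ('a \<Rightarrow> real) \<Rightarrow> 'a \<Rightarrow> 'a" where
  "weak_grad \<Omega> u = (SOME g. has_weak_gradient u g \<Omega>)"

definition H1 :: "'a::euclidean_space set \<Rightarrow> ('a \<Rightarrow> real) set" where
  "H1 \<Omega> = {u \<in> Lp_space 2 \<Omega>. \<exists>g \<in> Lp_space 2 \<Omega>. has_weak_gradient u g \<Omega>}"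

definition H1_norm :: "'a::euclidean_space set \<Rightarrow> ('a \<Rightarrow> real) \<Rightarrow> real" where
  "H1_norm \<Omega> u = sqrt ((LINT x|lebesgue_on \<Omega>. (u x)\<^sup>2) +
     (LINT x|lebesgue_on \<Omega>. (norm (weak_grad \<Omega> u x))\<^sup>2))"

text \<open>The closure of \<open>C\<^sub>c\<^sup>\<infinity>(\<Omega>)\<close> in \<open>H\<^sup>1(\<Omega>)\<close>.\<close>

definition H10 :: "'a::euclidean_space set \<Rightarrow> ('a \<Rightarrow> real) set" where
  "H10 \<Omega> = {u \<in> H1 \<Omega>. \<exists>\<phi>. (\<forall>n::nat. \<phi> n \<in> test_functions \<Omega>) \<and>
     (\<lambda>n. H1_norm \<Omega> (\<lambda>x. \<phi> n x - u x)) \<longlonglongrightarrow> 0}"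

text \<open>The space \<open>V\<close>, where \<open>p\<close> is the largest exponent occurring in the potential \<open>F\<close>. The case
  \<open>d = 2\<close> is listed separately because there \<open>2 d / (d - 2)\<close> is the junk value \<open>0\<close>.\<close>

definition V_space :: "real \<Rightarrow> 'a::euclidean_space set \<Rightarrow> ('a \<Rightarrow> real) set" where
  "V_space p \<Omega> =
     (let d = real DIM('a) in
      if d = 2 \<or> p \<le> 2 * d / (d - 2) then H10 \<Omega>
      else H10 \<Omega> \<inter> Lp_space (d * (p - 2) / 2) \<Omega>)"

text \<open>Weak solutions in \<open>V\<close> of \<open>- \<Delta>u + f(u) = \<lambda> u\<close> with zero boundary values. Integrability is
  part of the definition, since the Bochner integral of a non-integrable function is \<open>0\<close>.\<close>

definition weak_solution ::
    "(real \<Rightarrow> real) \<Rightarrow> real \<Rightarrow> 'a::euclidean_space set \<Rightarrow> real \<Rightarrow> ('a \<Rightarrow> real) \<Rightarrow> bool" where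
  "weak_solution f p \<Omega> lam u \<longleftrightarrow> u \<in> V_space p \<Omega> \<and>
     (\<forall>v\<in>H10 \<Omega>.
        integrable (lebesgue_on \<Omega>) (\<lambda>x. weak_grad \<Omega> u x \<bullet> weak_grad \<Omega> v x + f (u x) * v x) \<and>
        integrable (lebesgue_on \<Omega>) (\<lambda>x. u x * v x) \<and>
        (LINT x|lebesgue_on \<Omega>. weak_grad \<Omega> u x \<bullet> weak_grad \<Omega> v x + f (u x) * v x) =
        lam * (LINT x|lebesgue_on \<Omega>. u x * v x))"

text \<open>The energy \<open>E\<^sub>\<tau>\<close> on the ball of radius \<open>\<tau> \<le> 1\<close>; the gradient is that on the unit ball.\<close>

definition energy :: "(real \<Rightarrow> real) \<Rightarrow> real \<Rightarrow> ('a::euclidean_space \<Rightarrow> real) \<Rightarrow> real" where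
  "energy F \<tau> u =
     (LINT x|lebesgue_on (ball 0 \<tau>). (norm (weak_grad (ball 0 1) u x))\<^sup>2 / 2 + F (u x))"

end

theory Submission
  imports Defs "HOL-Complex_Analysis.Great_Picard" "HOL-Library.Diagonal_Subsequence"
begin

text \<open>
  The solutions are nonlinear whispering gallery modes. Fix a plane through the origin and an even
  number \<open>n\<close>, and consider functions that change sign under the rotation by \<open>pi / n\<close> in that plane. On
  every orbit of the rotations such a function is antiperiodic, so Wirtinger's inequality gives
  \<open>n\<^sup>2 \<integral>u\<^sup>2 \<le> \<integral>\<bar>x\<bar>\<^sup>2 \<bar>\<nabla>u\<bar>\<^sup>2\<close> over every rotation invariant set (\<open>angular_Poincare\<close>). In the ball of radius \<open>\<tau>\<close>
  the Dirichlet integral therefore costs at least \<open>n\<^sup>2 / \<tau>\<^sup>2\<close> per unit of \<open>\<integral>u\<^sup>2\<close>, and outside of it at least \<open>n\<^sup>2\<close>.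
  This price is nearly attained: waves with \<open>n\<close> periods, cut off to a neighbourhood of the circle
  in which the plane meets the unit sphere, have Rayleigh quotient below \<open>(1 + \<epsilon>) n\<^sup>2\<close> when \<open>n\<close> is large (\<open>exists_low_Rayleigh\<close>).

  Put \<open>\<lambda> = (1 + \<epsilon>) n\<^sup>2\<close> and minimise \<open>I(u) = \<integral>\<bar>\<nabla>u\<bar>\<^sup>2 / 2 + F(u) - \<lambda> u\<^sup>2 / 2\<close> in the symmetry class. Small multiples of a
  cut off wave have negative energy, because \<open>F\<close> is superquadratic at \<open>0\<close>. So the minimum is negative:
  \<open>\<integral>\<bar>\<nabla>u\<bar>\<^sup>2 / 2 + F(u) < \<lambda> / 2 \<integral>u\<^sup>2\<close>. Compared with the two lower bounds, and with \<open>F \<ge> 0\<close>, this leaves at most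
  the fraction \<open>\<epsilon> / (1 - \<tau>\<^sup>2)\<close> of the energy in the ball of radius \<open>\<tau>\<close> (\<open>energy_ratio_le\<close>). Letting \<open>\<epsilon>\<close> tend to \<open>0\<close> and \<open>n\<close>
  to infinity proves the theorem.

  It remains to see that a minimiser exists and is a weak solution, for arbitrarily large exponents. Some
  \<open>B\<close> satisfies \<open>f B > \<lambda> B\<close>, and the derivative of \<open>F(s) - \<lambda> s\<^sup>2 / 2\<close> is frozen outside \<open>[-B, B]\<close> (\<open>truncation\<close>). The truncated energy is
  harmless: its lower order part is Lipschitz for convergence in mean, Rellich's theorem provides a minimising
  sequence that converges in mean, and the parallelogram identity makes the gradients converge
  (\<open>exists_minimiser\<close>). The minimiser satisfies the Euler--Lagrange equation first for symmetric test functions, then,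
  averaging over the finite group of rotations, for all of them (\<open>Euler_Lagrange\<close>). Testing with a
  function of \<open>u\<close> that vanishes exactly on \<open>[-B, B]\<close> shows \<open>\<bar>u\<bar> \<le> B\<close> almost everywhere (\<open>minimiser_bounded\<close>). Hence the truncation
  is not felt, \<open>u\<close> lies in every \<open>L\<^sup>q\<close>, and \<open>f(u)\<close> is bounded.

  The preparatory sections provide smooth cutoffs, completeness of \<open>L\<^sup>2\<close>, Rellich's theorem for test functions,
  uniqueness of weak gradients, and the description of \<open>H10\<close> by approximating sequences (\<open>H10_approx\<close>).
\<close>

section \<open>Smooth functions\<close>

definition smooth :: "('a::euclidean_space \<Rightarrow> real) \<Rightarrow> bool" where
  "smooth f \<longleftrightarrow> (\<forall>k. C_k k f)"

definition grad :: "('a::euclidean_space \<Rightarrow> real) \<Rightarrow> 'a \<Rightarrow> 'a" where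
  "grad f x = (\<Sum>i\<in>Basis. frechet_derivative f (at x) i *\<^sub>R i)"

lemma frechet_derivative_eqI:
  "(f has_derivative f') (at x) \<Longrightarrow> frechet_derivative f (at x) i = f' i"
  using frechet_derivative_at by force

lemma C_k_Suc_I:
  assumes "\<And>x. (f has_derivative f' x) (at x)" "\<And>i. i \<in> Basis \<Longrightarrow> C_k k (\<lambda>x. f' x i)"
  shows "C_k (Suc k) f"
proof -
  have "frechet_derivative f (at x) i = f' x i" for x i
    by (rule frechet_derivative_eqI[OF assms(1)])
  then show ?thesis using assms by (auto simp: differentiable_def)
qed

lemma C_k_SucD: "C_k (Suc k) f \<Longrightarrow> C_k k f"
proof (induction k arbitrary: f)
  case 0
  then show ?case
    by (auto simp: continuous_on_eq_continuous_at intro: differentiable_imp_continuous_within)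
next
  case (Suc k)
  then show ?case by (metis C_k.simps(2))
qed

lemma C_k_Suc_E:
  assumes "C_k (Suc k) f"
  shows "(f has_derivative frechet_derivative f (at x)) (at x)"
    and "i \<in> Basis \<Longrightarrow> C_k k (\<lambda>x. frechet_derivative f (at x) i)"
  using assms frechet_derivative_works by auto

lemma C_k_const: "C_k k (\<lambda>x. c)"
proof (induction k arbitrary: c)
  case (Suc k)
  show ?case by (rule C_k_Suc_I[where f' = "\<lambda>_ _. 0"]) (auto intro: Suc)
qed auto

lemma C_k_add: "C_k k f \<Longrightarrow> C_k k g \<Longrightarrow> C_k k (\<lambda>x. f x + g x)"
proof (induction k arbitrary: f g)
  case (Suc k)
  show ?case
    by (rule C_k_Suc_I[OF has_derivative_add[OF C_k_Suc_E(1)[OF Suc.prems(1)] C_k_Suc_E(1)[OF Suc.prems(2)]]])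
      (intro Suc.IH C_k_Suc_E(2)[OF Suc.prems(1)] C_k_Suc_E(2)[OF Suc.prems(2)])
qed (auto intro: continuous_intros)

lemma C_k_sum: "(\<And>i. i \<in> A \<Longrightarrow> C_k k (f i)) \<Longrightarrow> C_k k (\<lambda>x. \<Sum>i\<in>A. f i x)"
  by (induction A rule: infinite_finite_induct) (auto intro: C_k_const C_k_add)

lemma C_k_mult: "C_k k f \<Longrightarrow> C_k k g \<Longrightarrow> C_k k (\<lambda>x. f x * g x)"
proof (induction k arbitrary: f g)
  case (Suc k)
  show ?case
    by (rule C_k_Suc_I[OF has_derivative_mult[OF C_k_Suc_E(1)[OF Suc.prems(1)] C_k_Suc_E(1)[OF Suc.prems(2)]]])
      (intro C_k_add Suc.IH C_k_Suc_E(2)[OF Suc.prems(1)] C_k_Suc_E(2)[OF Suc.prems(2)]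
        C_k_SucD[OF Suc.prems(1)] C_k_SucD[OF Suc.prems(2)])
qed (auto intro: continuous_intros)

lemma C_k_prod: "(\<And>i. i \<in> A \<Longrightarrow> C_k k (f i)) \<Longrightarrow> C_k k (\<lambda>x. \<Prod>i\<in>A. f i x)"
  by (induction A rule: infinite_finite_induct) (auto intro: C_k_const C_k_mult)

lemma C_k_inner: "C_k k (\<lambda>x. x \<bullet> a)"
proof (cases k)
  case (Suc k)
  have "C_k (Suc k) (\<lambda>x. x \<bullet> a)"
    by (rule C_k_Suc_I[where f' = "\<lambda>_ h. h \<bullet> a"]) (auto intro!: derivative_eq_intros C_k_const)
  with Suc show ?thesis by simp
qed (auto intro: continuous_intros)

lemma C_k_linear_compose:
  assumes "linear L"
  shows "C_k k f \<Longrightarrow> C_k k (\<lambda>x. f (L x))"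
proof (induction k arbitrary: f)
  case 0
  have "continuous_on UNIV L" using assms by (simp add: linear_continuous_on linear_linear)
  with 0 show ?case by (auto intro: continuous_on_compose2)
next
  case (Suc k)
  have L: "(L has_derivative L) (at x)" for x
    using assms by (simp add: bounded_linear_imp_has_derivative linear_linear)
  have "((\<lambda>x. f (L x)) has_derivative (\<lambda>h. frechet_derivative f (at (L x)) (L h))) (at x)" for x
    using has_derivative_compose[OF L C_k_Suc_E(1)[OF Suc.prems]] by simp
  moreover have "C_k k (\<lambda>x. frechet_derivative f (at (L x)) (L i))" for i
  proof -
    have "frechet_derivative f (at y) (L i) =
        (\<Sum>j\<in>Basis. (L i \<bullet> j) * frechet_derivative f (at y) j)" for y
    proof -
      interpret D: bounded_linear "frechet_derivative f (at y)"
        using C_k_Suc_E(1)[OF Suc.prems] by (rule has_derivative_bounded_linear)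
      have "frechet_derivative f (at y) (\<Sum>j\<in>Basis. (L i \<bullet> j) *\<^sub>R j) =
        (\<Sum>j\<in>Basis. (L i \<bullet> j) * frechet_derivative f (at y) j)"
        by (simp add: D.sum D.scaleR)
      then show ?thesis by (simp add: euclidean_representation)
    qed
    then show ?thesis
      by (simp, intro C_k_sum C_k_mult C_k_const) (use Suc.IH C_k_Suc_E(2)[OF Suc.prems] in auto)
  qed
  ultimately show ?case by (rule C_k_Suc_I)
qed

text \<open>The sequence \<open>D\<close> lists a function of one real variable and all its derivatives. The induction needs
  the claim for every entry of the list, because the chain rule replaces \<open>D n\<close> by \<open>D (Suc n)\<close>.\<close>

lemma C_k_real_compose:
  assumes "\<And>n s. (D n has_real_derivative D (Suc n) s) (at s)"
  shows "C_k k f \<Longrightarrow> C_k k (\<lambda>x. D n (f x))"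
proof (induction k arbitrary: n)
  case 0
  have "continuous_on UNIV (D n)"
    using assms by (auto intro: DERIV_continuous_on)
  with 0 show ?case by (auto intro: continuous_on_compose2)
next
  case (Suc k)
  have "((\<lambda>x. D n (f x)) has_derivative
      (\<lambda>h. D (Suc n) (f x) * frechet_derivative f (at x) h)) (at x)" for x
    using has_derivative_compose[OF C_k_Suc_E(1)[OF Suc.prems] has_field_derivative_imp_has_derivative[OF assms]] by simp
  moreover have "C_k k (\<lambda>x. D (Suc n) (f x) * frechet_derivative f (at x) i)" if "i \<in> Basis" for i
    by (intro C_k_mult Suc.IH C_k_SucD[OF Suc.prems] C_k_Suc_E(2)[OF Suc.prems] that)
  ultimately show ?case by (rule C_k_Suc_I)
qed

lemma C_k_inverse:
  assumes "\<And>x. f x \<noteq> 0"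
  shows "C_k k f \<Longrightarrow> C_k k (\<lambda>x. inverse (f x))"
proof (induction k)
  case 0
  then show ?case using assms by (auto intro: continuous_intros)
next
  case (Suc k)
  have "((\<lambda>x. inverse (f x)) has_derivative
      (\<lambda>h. - (inverse (f x) * frechet_derivative f (at x) h * inverse (f x)))) (at x)" for x
    by (intro Deriv.has_derivative_inverse assms C_k_Suc_E(1)[OF Suc.prems])
  moreover have "C_k k (\<lambda>x. - (inverse (f x) * frechet_derivative f (at x) i * inverse (f x)))"
    if "i \<in> Basis" for i
  proof -
    have "C_k k (\<lambda>x. (-1) * (inverse (f x) * frechet_derivative f (at x) i * inverse (f x)))"
      by (intro C_k_mult C_k_const Suc.IH[OF C_k_SucD[OF Suc.prems]] C_k_Suc_E(2)[OF Suc.prems] that)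
    then show ?thesis by simp
  qed
  ultimately show ?case by (rule C_k_Suc_I)
qed

lemma smooth_const: "smooth (\<lambda>x. c)"
  and smooth_inner: "smooth (\<lambda>x. x \<bullet> a)"
  and smooth_add: "smooth f \<Longrightarrow> smooth g \<Longrightarrow> smooth (\<lambda>x. f x + g x)"
  and smooth_mult: "smooth f \<Longrightarrow> smooth g \<Longrightarrow> smooth (\<lambda>x. f x * g x)"
  and smooth_inverse: "smooth f \<Longrightarrow> (\<And>x. f x \<noteq> 0) \<Longrightarrow> smooth (\<lambda>x. inverse (f x))"
  and smooth_linear_compose: "linear L \<Longrightarrow> smooth h \<Longrightarrow> smooth (\<lambda>x. h (L x))"
  by (auto simp: smooth_def intro: C_k_const C_k_inner C_k_add C_k_mult C_k_inverse
      C_k_linear_compose)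

lemma smooth_sum: "(\<And>i. i \<in> A \<Longrightarrow> smooth (f i)) \<Longrightarrow> smooth (\<lambda>x. \<Sum>i\<in>A. f i x)"
  and smooth_prod: "(\<And>i. i \<in> A \<Longrightarrow> smooth (f i)) \<Longrightarrow> smooth (\<lambda>x. \<Prod>i\<in>A. f i x)"
  by (auto simp: smooth_def intro: C_k_sum C_k_prod)

lemma smooth_diff: "smooth f \<Longrightarrow> smooth g \<Longrightarrow> smooth (\<lambda>x. f x - g x)"
  using smooth_add[OF _ smooth_mult[OF smooth_const[of "-1"]], of f g] by simp

lemma smooth_power: "smooth f \<Longrightarrow> smooth (\<lambda>x. f x ^ n)"
  by (induction n) (auto intro: smooth_const smooth_mult)

lemma smooth_real_compose:
  assumes "\<And>n s. (D n has_real_derivative D (Suc n) s) (at s)" "smooth f"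
  shows "smooth (\<lambda>x. D n (f x))"
  using assms C_k_real_compose by (metis smooth_def)

lemma smooth_norm_sq: "smooth (\<lambda>x. (norm x)\<^sup>2)"
proof -
  have "(norm x)\<^sup>2 = (\<Sum>i\<in>Basis. (x \<bullet> i) * (x \<bullet> i))" for x :: 'a
    by (simp add: euclidean_inner[symmetric] power2_norm_eq_inner)
  then show ?thesis by (simp, intro smooth_sum smooth_mult smooth_inner)
qed

subsection \<open>Gradients\<close>

lemma smooth_grad:
  assumes "smooth f"
  shows "(f has_derivative (\<lambda>h. grad f x \<bullet> h)) (at x)"
proof -
  have 1: "(f has_derivative frechet_derivative f (at x)) (at x)"
    using assms C_k_Suc_E(1)[of 0 f] unfolding smooth_def by blast
  then interpret D: bounded_linear "frechet_derivative f (at x)"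
    by (rule has_derivative_bounded_linear)
  have "frechet_derivative f (at x) h = grad f x \<bullet> h" for h
  proof -
    have "frechet_derivative f (at x) (\<Sum>j\<in>Basis. (h \<bullet> j) *\<^sub>R j) = grad f x \<bullet> h"
      unfolding grad_def by (simp add: D.sum D.scaleR inner_sum_right mult.commute inner_commute[of _ h])
    then show ?thesis by (simp add: euclidean_representation)
  qed
  then have "frechet_derivative f (at x) = (\<lambda>h. grad f x \<bullet> h)" by blast
  with 1 show ?thesis by simp
qed

lemma frechet_eq_grad:
  assumes "smooth f" shows "frechet_derivative f (at x) h = grad f x \<bullet> h"
  by (rule frechet_derivative_eqI[OF smooth_grad[OF assms]])

lemma grad_eqI:
  assumes "(f has_derivative f') (at x)" "\<And>h. f' h = v \<bullet> h"
  shows "grad f x = v"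
  unfolding grad_def frechet_derivative_eqI[OF assms(1)] assms(2)
  by (simp add: euclidean_representation)

lemma continuous_smooth: "smooth f \<Longrightarrow> continuous_on UNIV f"
  by (metis C_k.simps(1) smooth_def)

lemma smooth_partial: "smooth f \<Longrightarrow> i \<in> Basis \<Longrightarrow> smooth (\<lambda>x. grad f x \<bullet> i)"
proof -
  assume f: "smooth f" and i: "i \<in> Basis"
  have "C_k k (\<lambda>x. frechet_derivative f (at x) i)" for k
    using f i C_k_Suc_E(2)[of k f] by (auto simp: smooth_def)
  then show "smooth (\<lambda>x. grad f x \<bullet> i)"
    by (simp add: frechet_eq_grad[OF f] smooth_def)
qed

lemma continuous_grad: "smooth f \<Longrightarrow> continuous_on UNIV (grad f)"
  by (subst continuous_on_componentwise) (auto intro: continuous_smooth smooth_partial)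

lemma grad_add: "smooth f \<Longrightarrow> smooth g \<Longrightarrow> grad (\<lambda>x. f x + g x) x = grad f x + grad g x"
  by (rule grad_eqI[OF has_derivative_add[OF smooth_grad smooth_grad]]) (auto simp: inner_left_distrib)

lemma grad_diff: "smooth f \<Longrightarrow> smooth g \<Longrightarrow> grad (\<lambda>x. f x - g x) x = grad f x - grad g x"
  by (rule grad_eqI[OF has_derivative_diff[OF smooth_grad smooth_grad]]) (auto simp: inner_diff_left)

lemma grad_mult:
  "smooth f \<Longrightarrow> smooth g \<Longrightarrow> grad (\<lambda>x. f x * g x) x = f x *\<^sub>R grad g x + g x *\<^sub>R grad f x"
  by (rule grad_eqI[OF has_derivative_mult[OF smooth_grad smooth_grad]])
    (auto simp: inner_left_distrib)

lemma grad_cmult: "smooth f \<Longrightarrow> grad (\<lambda>x. c * f x) x = c *\<^sub>R grad f x"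
  by (rule grad_eqI[OF has_derivative_mult_right[OF smooth_grad]]) auto

lemma grad_real_compose:
  assumes "(h has_real_derivative h') (at (f x))" "smooth f"
  shows "grad (\<lambda>x. h (f x)) x = h' *\<^sub>R grad f x"
  by (rule grad_eqI[OF has_derivative_compose[OF smooth_grad[OF assms(2)]
        has_field_derivative_imp_has_derivative[OF assms(1)]]]) auto

text \<open>For orthogonal \<open>T\<close>, the transpose of \<open>T\<close> is its inverse, whence \<open>T (\<nabla>(f \<circ> T)) = (\<nabla>f) \<circ> T\<close>.\<close>

lemma grad_orthogonal:
  fixes T :: "'a::euclidean_space \<Rightarrow> 'a"
  assumes "orthogonal_transformation T" "smooth f"
  shows "T (grad (\<lambda>x. f (T x)) x) = grad f (T x)"
proof -
  have lin: "linear T" and inn: "T v \<bullet> T w = v \<bullet> w" for v w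
    using assms(1) by (auto simp: orthogonal_transformation_def)
  have "(T has_derivative T) (at x)"
    using lin by (simp add: bounded_linear_imp_has_derivative linear_linear)
  from has_derivative_compose[OF this smooth_grad[OF assms(2)]]
  have d: "((\<lambda>x. f (T x)) has_derivative (\<lambda>h. grad f (T x) \<bullet> T h)) (at x)" .
  have g: "grad (\<lambda>x. f (T x)) x \<bullet> h = grad f (T x) \<bullet> T h" for h
    using frechet_derivative_eqI[OF d, of h] smooth_linear_compose[OF lin assms(2)]
    by (simp add: frechet_eq_grad)
  obtain w where w: "T w = grad f (T x)"
    using orthogonal_transformation_inv[OF assms(1)] assms(1)
    by (metis bij_inv_eq_iff orthogonal_transformation_bij)
  have "grad (\<lambda>x. f (T x)) x \<bullet> h = w \<bullet> h" for h
    using g[of h] inn[of w h] by (simp add: w)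
  then have "grad (\<lambda>x. f (T x)) x = w" by (metis vector_eq_rdot)
  with w show ?thesis by simp
qed

subsection \<open>Flat functions\<close>

text \<open>With \<open>p = 1\<close> this is the classical smooth function \<open>exp (- 1 / s)\<close> that is flat at \<open>0\<close>;
  the polynomial makes the family closed under differentiation.\<close>

definition flat :: "real poly \<Rightarrow> real \<Rightarrow> real" where
  "flat p s = (if s \<le> 0 then 0 else exp (- (1 / s)) * poly p (1 / s))"

definition flat_deriv :: "real poly \<Rightarrow> real poly" where
  "flat_deriv p = [:0, 0, 1:] * (p - pderiv p)"

lemma flat_tendsto_0: "((\<lambda>s. exp (- (1 / s)) * poly p (1 / s)) \<longlongrightarrow> 0) (at_right (0::real))"
proof -
  have pow: "((\<lambda>y::real. exp (- y) * y ^ n) \<longlongrightarrow> 0) at_top" for n :: nat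
    using tendsto_power_div_exp_0[of n] by (simp add: exp_minus divide_inverse mult.commute)
  have "((\<lambda>y. exp (- y) * poly p y) \<longlongrightarrow> 0) at_top"
  proof -
    have "((\<lambda>y. \<Sum>i\<le>degree p. coeff p i * (exp (- y) * y ^ i)) \<longlongrightarrow> (\<Sum>i\<le>degree p. coeff p i * 0)) at_top"
      by (intro tendsto_intros pow)
    then show ?thesis by (simp add: poly_altdef sum_distrib_left algebra_simps)
  qed
  moreover have "filterlim (\<lambda>s. 1 / s) at_top (at_right (0::real))"
    using filterlim_inverse_at_top_right by (simp add: inverse_eq_divide)
  ultimately show ?thesis using filterlim_compose by blast
qed

text \<open>Only \<open>s = 0\<close> needs an argument: from the right, exponential decay beats the polynomial in \<open>1 / s\<close>,
  so that the difference quotients tend to \<open>0\<close>.\<close>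

lemma flat_has_derivative: "(flat p has_real_derivative flat (flat_deriv p) s) (at s)"
proof -
  consider "s < 0" | "s = 0" | "s > 0" by linarith
  then show ?thesis
  proof cases
    case 1
    have "((\<lambda>s. 0) has_real_derivative 0) (at s)" by simp
    moreover have "\<forall>\<^sub>F x in nhds s. flat p x = 0"
      using eventually_nhds_in_open[of "{..<0}" s] 1 by (auto simp: flat_def elim!: eventually_mono)
    ultimately show ?thesis
      using 1 DERIV_cong_ev[OF refl, of "flat p" "\<lambda>s. 0" s 0 0] by (simp add: flat_def)
  next
    case 2
    have "((\<lambda>h. (flat p h - flat p 0) / h) \<longlongrightarrow> 0) (at_left 0)"
      by (rule tendsto_eventually) (auto simp: flat_def eventually_at_left_field intro: exI[of _ "-1"])
    moreover have "((\<lambda>h. (flat p h - flat p 0) / h) \<longlongrightarrow> 0) (at_right 0)"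
      using flat_tendsto_0[of "[:0,1:] * p"]
      by (rule Lim_transform_eventually) (auto simp: flat_def eventually_at_right_field intro!: exI[of _ 1])
    ultimately have "((\<lambda>h. (flat p h - flat p 0) / h) \<longlongrightarrow> 0) (at 0)"
      by (simp add: filterlim_split_at)
    then show ?thesis using 2 by (simp add: DERIV_def flat_def)
  next
    case 3
    have "((\<lambda>s. exp (- (1 / s)) * poly p (1 / s)) has_real_derivative
        exp (- (1 / s)) * poly (flat_deriv p) (1 / s)) (at s)"
      using 3 by (auto intro!: derivative_eq_intros simp: flat_deriv_def field_simps power2_eq_square)
    moreover have "\<forall>\<^sub>F x in nhds s. flat p x = exp (- (1 / x)) * poly p (1 / x)"
      using eventually_nhds_in_open[of "{0<..}" s] 3 by (auto simp: flat_def elim!: eventually_mono)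
    ultimately show ?thesis
      using 3 DERIV_cong_ev[OF refl, of "flat p" "\<lambda>x. exp (- (1 / x)) * poly p (1 / x)" s] by (simp add: flat_def)
  qed
qed

abbreviation bump :: "real \<Rightarrow> real" where "bump \<equiv> flat 1"

lemma bump_eq: "bump s = (if s \<le> 0 then 0 else exp (- (1 / s)))"
  by (simp add: flat_def)

lemma bump_nonneg: "0 \<le> bump s" and bump_le_1: "bump s \<le> 1" and bump_pos_iff: "0 < bump s \<longleftrightarrow> 0 < s"
  and bump_zero_iff: "bump s = 0 \<longleftrightarrow> s \<le> 0"
  by (auto simp: bump_eq)

lemma smooth_flat: "smooth f \<Longrightarrow> smooth (\<lambda>x. flat p (f x))"
  using smooth_real_compose[of "\<lambda>n. flat ((flat_deriv ^^ n) p)" f 0] flat_has_derivative by simp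

text \<open>The bound \<open>2\<close> comes from \<open>y\<^sup>2 / 2 \<le> exp y\<close> with \<open>y = 1 / s\<close>.\<close>

lemma bump_deriv:
  "(bump has_real_derivative flat [:0, 0, 1:] s) (at s)" "0 \<le> flat [:0, 0, 1:] s" "flat [:0, 0, 1:] s \<le> 2"
proof -
  show "(bump has_real_derivative flat [:0, 0, 1:] s) (at s)"
    using flat_has_derivative[of 1 s] by (simp add: flat_deriv_def)
  show "0 \<le> flat [:0, 0, 1:] s" by (auto simp: flat_def)
  show "flat [:0, 0, 1:] s \<le> 2"
  proof (cases "s > 0")
    case True
    define y where "y = 1 / s"
    have y: "y > 0" using True by (simp add: y_def)
    have "y\<^sup>2 / 2 \<le> exp y"
      using exp_lower_Taylor_quadratic[of y] y by simp
    then have "exp (- y) * y\<^sup>2 \<le> 2" by (simp add: exp_minus field_simps)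
    with True show ?thesis by (simp add: flat_def y_def power2_eq_square)
  qed (simp add: flat_def)
qed

section \<open>Square integrable functions\<close>

definition L2 :: "'a measure \<Rightarrow> ('a \<Rightarrow> 'b::euclidean_space) \<Rightarrow> bool" where
  "L2 M u \<longleftrightarrow> u \<in> borel_measurable M \<and> integrable M (\<lambda>x. (norm (u x))\<^sup>2)"

definition L2norm :: "'a measure \<Rightarrow> ('a \<Rightarrow> 'b::euclidean_space) \<Rightarrow> real" where
  "L2norm M u = sqrt (LINT x|M. (norm (u x))\<^sup>2)"

definition L2lim :: "'a measure \<Rightarrow> (nat \<Rightarrow> 'a \<Rightarrow> 'b::euclidean_space) \<Rightarrow> ('a \<Rightarrow> 'b) \<Rightarrow> bool" where
  "L2lim M u w \<longleftrightarrow> (\<forall>k. L2 M (u k)) \<and> L2 M w \<and> (\<lambda>k. L2norm M (\<lambda>x. u k x - w x)) \<longlonglongrightarrow> 0"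

lemma L2norm_nonneg [simp]: "0 \<le> L2norm M u"
  by (simp add: L2norm_def)

lemma L2norm_sq: "(L2norm M u)\<^sup>2 = (LINT x|M. (norm (u x))\<^sup>2)"
  by (simp add: L2norm_def)

lemma L2_measurable: "L2 M u \<Longrightarrow> u \<in> borel_measurable M"
  by (simp add: L2_def)

lemma mult_le_sum_squares: "a * b \<le> a\<^sup>2 + (b::real)\<^sup>2"
proof -
  have "2 * (a * b) \<le> a\<^sup>2 + b\<^sup>2" using sum_squares_bound[of a b] by (simp add: algebra_simps)
  moreover have "0 \<le> a\<^sup>2 + b\<^sup>2" by simp
  ultimately show ?thesis by linarith
qed

lemma L2_bound:
  assumes "w \<in> borel_measurable M" "integrable M g" "AE x in M. (norm (w x))\<^sup>2 \<le> g x"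
  shows "L2 M w"
  unfolding L2_def
  using assms by (auto intro!: Bochner_Integration.integrable_bound[OF assms(2)] elim!: eventually_mono)

lemma L2_inner_integrable:
  assumes "L2 M u" "L2 M v"
  shows "integrable M (\<lambda>x. u x \<bullet> v x)"
proof (rule Bochner_Integration.integrable_bound)
  show "integrable M (\<lambda>x. (norm (u x))\<^sup>2 + (norm (v x))\<^sup>2)"
    using assms by (auto simp: L2_def)
  show "(\<lambda>x. u x \<bullet> v x) \<in> borel_measurable M" using assms by (auto simp: L2_def)
  have "\<bar>u x \<bullet> v x\<bar> \<le> (norm (u x))\<^sup>2 + (norm (v x))\<^sup>2" for x
    using Cauchy_Schwarz_ineq2[of "u x" "v x"] mult_le_sum_squares[of "norm (u x)" "norm (v x)"] by linarith
  then show "AE x in M. norm (u x \<bullet> v x) \<le> norm ((norm (u x))\<^sup>2 + (norm (v x))\<^sup>2)"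
    by (intro AE_I2) simp
qed

lemma L2_scaleR: "L2 M u \<Longrightarrow> L2 M (\<lambda>x. c *\<^sub>R u x)"
  by (auto simp: L2_def power_mult_distrib)

lemma L2_add:
  assumes "L2 M u" "L2 M v"
  shows "L2 M (\<lambda>x. u x + v x)"
proof (rule L2_bound)
  show "integrable M (\<lambda>x. 2 * (norm (u x))\<^sup>2 + 2 * (norm (v x))\<^sup>2)"
    using assms by (auto simp: L2_def)
  have "(norm (a + b))\<^sup>2 \<le> 2 * (norm a)\<^sup>2 + 2 * (norm b)\<^sup>2" for a b :: 'b
  proof -
    have "(norm (a + b))\<^sup>2 \<le> (norm a + norm b)\<^sup>2"
      by (intro power_mono norm_triangle_ineq) auto
    also have "\<dots> \<le> 2 * (norm a)\<^sup>2 + 2 * (norm b)\<^sup>2"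
      using sum_squares_bound[of "norm a" "norm b"] by (simp add: power2_sum)
    finally show ?thesis .
  qed
  then show "AE x in M. (norm (u x + v x))\<^sup>2 \<le> 2 * (norm (u x))\<^sup>2 + 2 * (norm (v x))\<^sup>2" by simp
qed (use assms in \<open>auto simp: L2_def\<close>)

lemma L2_minus: "L2 M u \<Longrightarrow> L2 M (\<lambda>x. - u x)"
  by (auto simp: L2_def)

lemma L2_diff: "L2 M u \<Longrightarrow> L2 M v \<Longrightarrow> L2 M (\<lambda>x. u x - v x)"
  using L2_add[OF _ L2_minus, of M u v] by simp

lemma L2norm_quadratic:
  assumes "L2 M u" "L2 M v"
  shows "(LINT x|M. (norm (u x + t *\<^sub>R v x))\<^sup>2) =
    (L2norm M u)\<^sup>2 + 2 * t * (LINT x|M. u x \<bullet> v x) + t\<^sup>2 * (L2norm M v)\<^sup>2"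
proof -
  have "(norm (u x + t *\<^sub>R v x))\<^sup>2 = (norm (u x))\<^sup>2 + 2 * t * (u x \<bullet> v x) + t\<^sup>2 * (norm (v x))\<^sup>2" for x
    unfolding power2_norm_eq_inner
    by (simp add: inner_add_left inner_add_right inner_commute[of "v x" "u x"] power2_eq_square algebra_simps)
  then show ?thesis
    using assms L2_inner_integrable[OF assms] by (simp add: L2norm_sq L2_def)
qed

text \<open>The quadratic polynomial \<open>t \<mapsto> \<parallel>u + t v\<parallel>\<^sup>2\<close> is nonnegative, hence its discriminant is not positive.\<close>

lemma L2_Cauchy_Schwarz:
  assumes "L2 M u" "L2 M v"
  shows "\<bar>LINT x|M. u x \<bullet> v x\<bar> \<le> L2norm M u * L2norm M v"
proof -
  define a where "a = (L2norm M u)\<^sup>2"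
  define b where "b = (LINT x|M. u x \<bullet> v x)"
  define c where "c = (L2norm M v)\<^sup>2"
  have q: "0 \<le> a + 2 * t * b + t\<^sup>2 * c" for t
    unfolding a_def b_def c_def L2norm_quadratic[OF assms, symmetric] by simp
  have c: "0 \<le> c" by (simp add: c_def)
  have "b\<^sup>2 \<le> a * c"
  proof (cases "c = 0")
    case True
    have "b = 0"
    proof (rule ccontr)
      assume b: "b \<noteq> 0"
      have "2 * (- (a + 1) / (2 * b)) * b = - (a + 1)" using b by simp
      then show False using q[of "- (a + 1) / (2 * b)"] True by simp
    qed
    then show ?thesis using True by simp
  next
    case False
    with c have c': "c > 0" by simp
    have "2 * (- b / c) * b = - 2 * (b\<^sup>2 / c)" "(- b / c)\<^sup>2 * c = b\<^sup>2 / c"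
      using c' by (auto simp: power2_eq_square)
    then have "b\<^sup>2 / c \<le> a" using q[of "- b / c"] by linarith
    then show ?thesis using c' by (simp add: pos_divide_le_eq)
  qed
  then have "b\<^sup>2 \<le> (L2norm M u * L2norm M v)\<^sup>2" by (simp add: a_def c_def power_mult_distrib)
  then show ?thesis unfolding b_def abs_le_square_iff[symmetric] by (simp add: abs_mult)
qed

lemma L2norm_triangle:
  assumes "L2 M u" "L2 M v"
  shows "L2norm M (\<lambda>x. u x + v x) \<le> L2norm M u + L2norm M v"
proof (rule power2_le_imp_le)
  have "(L2norm M (\<lambda>x. u x + v x))\<^sup>2 =
      (L2norm M u)\<^sup>2 + 2 * (LINT x|M. u x \<bullet> v x) + (L2norm M v)\<^sup>2"
    using L2norm_quadratic[OF assms, of 1] by (simp add: L2norm_sq)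
  also have "\<dots> \<le> (L2norm M u + L2norm M v)\<^sup>2"
    using L2_Cauchy_Schwarz[OF assms] by (simp add: power2_sum)
  finally show "(L2norm M (\<lambda>x. u x + v x))\<^sup>2 \<le> (L2norm M u + L2norm M v)\<^sup>2" .
qed auto

lemma L2norm_scaleR: "L2norm M (\<lambda>x. c *\<^sub>R u x) = \<bar>c\<bar> * L2norm M u"
  by (simp add: L2norm_def power_mult_distrib real_sqrt_mult)

lemma L2norm_minus_commute: "L2norm M (\<lambda>x. u x - v x) = L2norm M (\<lambda>x. v x - u x)"
  by (simp add: L2norm_def norm_minus_commute)

lemma L2norm_triangle_diff:
  assumes "L2 M u" "L2 M v" "L2 M w"
  shows "L2norm M (\<lambda>x. u x - w x) \<le> L2norm M (\<lambda>x. u x - v x) + L2norm M (\<lambda>x. v x - w x)"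
  using L2norm_triangle[OF L2_diff[OF assms(1,2)] L2_diff[OF assms(2,3)]] by simp

lemma L2norm_diff_bound:
  assumes "L2 M u" "L2 M v"
  shows "\<bar>L2norm M u - L2norm M v\<bar> \<le> L2norm M (\<lambda>x. u x - v x)"
  using L2norm_triangle[OF L2_diff[OF assms] assms(2)]
    L2norm_triangle[OF L2_diff[OF assms(2,1)] assms(1)] L2norm_minus_commute[of M u v]
  by simp

lemma L2norm_mono:
  assumes "u \<in> borel_measurable M" "L2 M v" "AE x in M. norm (u x) \<le> norm (v x)"
  shows "L2 M u" "L2norm M u \<le> L2norm M v"
proof -
  have ae: "AE x in M. (norm (u x))\<^sup>2 \<le> (norm (v x))\<^sup>2"
    using assms(3) by eventually_elim (simp add: power_mono)
  show u: "L2 M u" by (rule L2_bound[OF assms(1) _ ae]) (use assms in \<open>auto simp: L2_def\<close>)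
  show "L2norm M u \<le> L2norm M v"
    unfolding L2norm_def real_sqrt_le_iff
    by (rule integral_mono_AE) (use u assms ae in \<open>auto simp: L2_def\<close>)
qed

lemma L2norm_eq_0:
  assumes "L2 M u" "L2norm M u = 0"
  shows "AE x in M. u x = 0"
proof -
  have "(LINT x|M. (norm (u x))\<^sup>2) = 0" using assms(2) by (simp add: L2norm_def)
  then have "AE x in M. (norm (u x))\<^sup>2 = 0"
    using assms(1) by (subst (asm) integral_nonneg_eq_0_iff_AE) (auto simp: L2_def)
  then show ?thesis by simp
qed

lemma L2_bounded:
  assumes "finite_measure M" "u \<in> borel_measurable M" "AE x in M. norm (u x) \<le> C"
  shows "L2 M u"
proof (rule L2_bound[OF assms(2)])
  show "integrable M (\<lambda>x. C\<^sup>2)" using assms(1) by (simp add: finite_measure.integrable_const)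
  show "AE x in M. (norm (u x))\<^sup>2 \<le> C\<^sup>2" using assms(3) by eventually_elim (simp add: power_mono)
qed

lemma L2_integrable:
  assumes "finite_measure M" "L2 M u"
  shows "integrable M u"
proof (rule Bochner_Integration.integrable_bound)
  show "integrable M (\<lambda>x. 1 + (norm (u x))\<^sup>2)"
    using assms by (auto simp: L2_def finite_measure.integrable_const)
  have "a \<le> 1 + a\<^sup>2" for a :: real using mult_le_sum_squares[of a 1] by simp
  then show "AE x in M. norm (u x) \<le> norm (1 + (norm (u x))\<^sup>2)" by simp
qed (use assms in \<open>simp add: L2_def\<close>)

subsection \<open>Convergence and completeness\<close>

lemma L2limD:
  assumes "L2lim M u w"
  shows "L2 M (u k)" "L2 M w" "(\<lambda>k. L2norm M (\<lambda>x. u k x - w x)) \<longlonglongrightarrow> 0"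
  using assms by (auto simp: L2lim_def)

lemma L2lim_subseq: "L2lim M u w \<Longrightarrow> strict_mono r \<Longrightarrow> L2lim M (\<lambda>k. u (r k)) w"
  unfolding L2lim_def using LIMSEQ_subseq_LIMSEQ[of "\<lambda>k. L2norm M (\<lambda>x. u k x - w x)" 0 r]
  by (auto simp: o_def)

lemma L2lim_const: "L2 M v \<Longrightarrow> L2lim M (\<lambda>_. v) v"
  by (simp add: L2lim_def L2norm_def)

lemma L2lim_norm:
  assumes "L2lim M u w"
  shows "(\<lambda>k. L2norm M (u k)) \<longlonglongrightarrow> L2norm M w"
proof (rule LIM_zero_cancel, rule Lim_null_comparison)
  show "(\<lambda>k. L2norm M (\<lambda>x. u k x - w x)) \<longlonglongrightarrow> 0" using assms by (simp add: L2lim_def)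
  show "\<forall>\<^sub>F k in sequentially. norm (L2norm M (u k) - L2norm M w) \<le> L2norm M (\<lambda>x. u k x - w x)"
    using L2norm_diff_bound[OF L2limD(1)[OF assms] L2limD(2)[OF assms]] by simp
qed

lemma L2lim_inner:
  assumes "L2lim M u w" "L2 M v"
  shows "(\<lambda>k. LINT x|M. u k x \<bullet> v x) \<longlonglongrightarrow> (LINT x|M. w x \<bullet> v x)"
proof (rule LIM_zero_cancel, rule Lim_null_comparison)
  show "(\<lambda>k. L2norm M (\<lambda>x. u k x - w x) * L2norm M v) \<longlonglongrightarrow> 0"
    using tendsto_mult_left_zero[OF L2limD(3)[OF assms(1)]] by simp
  have "norm ((LINT x|M. u k x \<bullet> v x) - (LINT x|M. w x \<bullet> v x))
      \<le> L2norm M (\<lambda>x. u k x - w x) * L2norm M v" for k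
  proof -
    have "(LINT x|M. u k x \<bullet> v x) - (LINT x|M. w x \<bullet> v x) = (LINT x|M. (u k x - w x) \<bullet> v x)"
      using L2limD[OF assms(1)] assms(2) by (simp add: L2_inner_integrable inner_diff_left)
    then show ?thesis
      using L2_Cauchy_Schwarz[of M "\<lambda>x. u k x - w x" v] L2limD[OF assms(1)] assms(2)
      by (simp add: L2_diff)
  qed
  then show "\<forall>\<^sub>F k in sequentially. norm ((LINT x|M. u k x \<bullet> v x) - (LINT x|M. w x \<bullet> v x))
      \<le> L2norm M (\<lambda>x. u k x - w x) * L2norm M v" by simp
qed

text \<open>This transfers convergence in mean through Lipschitz functions, multiplication by indicators and
  addition of a fixed function.\<close>

lemma L2lim_contraction:
  assumes "L2lim M u w" "\<And>k. L2 M (u' k)" "L2 M w'"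
    "\<And>k. AE x in M. norm (u' k x - w' x) \<le> C * norm (u k x - w x)"
  shows "L2lim M u' w'"
  unfolding L2lim_def
proof (intro conjI allI assms(2,3), rule Lim_null_comparison[rotated])
  show "(\<lambda>k. \<bar>C\<bar> * L2norm M (\<lambda>x. u k x - w x)) \<longlonglongrightarrow> 0"
    using tendsto_mult_right_zero[OF L2limD(3)[OF assms(1)]] by simp
  have "L2norm M (\<lambda>x. u' k x - w' x) \<le> L2norm M (\<lambda>x. C *\<^sub>R (u k x - w x))" for k
  proof (rule L2norm_mono)
    show "L2 M (\<lambda>x. C *\<^sub>R (u k x - w x))" by (intro L2_scaleR L2_diff L2limD[OF assms(1)])
    show "AE x in M. norm (u' k x - w' x) \<le> norm (C *\<^sub>R (u k x - w x))"
      using assms(4)[of k]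
    proof eventually_elim
      case (elim x)
      also have "C * norm (u k x - w x) \<le> \<bar>C\<bar> * norm (u k x - w x)"
        by (intro mult_right_mono) auto
      finally show ?case by simp
    qed
  qed (intro L2_measurable L2_diff assms)
  then have "L2norm M (\<lambda>x. u' k x - w' x) \<le> \<bar>C\<bar> * L2norm M (\<lambda>x. u k x - w x)" for k
    by (simp add: L2norm_scaleR)
  then show "\<forall>\<^sub>F k in sequentially. norm (L2norm M (\<lambda>x. u' k x - w' x))
      \<le> \<bar>C\<bar> * L2norm M (\<lambda>x. u k x - w x)"
    by simp
qed

lemma L2lim_Lipschitz_integral:
  fixes h :: "real \<Rightarrow> real"
  assumes "finite_measure M" "L2lim M u w" "\<And>a b. \<bar>h a - h b\<bar> \<le> C * \<bar>a - b\<bar>"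
  shows "(\<lambda>k. LINT x|M. h (u k x)) \<longlonglongrightarrow> (LINT x|M. h (w x))"
    and "L2 M (\<lambda>x. h (w x))"
proof -
  have C0: "0 \<le> C" using assms(3)[of 1 0] by simp
  have "continuous_on UNIV h"
    by (rule lipschitz_on_continuous_on[of C])
      (use assms(3) C0 in \<open>auto intro!: lipschitz_onI simp: dist_real_def\<close>)
  then have mh: "h \<in> borel_measurable borel" by (simp add: borel_measurable_continuous_onI)
  have L2h: "L2 M (\<lambda>x. h (v x))" if v: "L2 M v" for v
  proof -
    have one: "L2 M (\<lambda>x. 1::real)" by (rule L2_bounded[OF assms(1)]) auto
    have "L2 M (\<lambda>x. h (v x) - h 0)"
    proof (rule L2norm_mono(1))
      show "(\<lambda>x. h (v x) - h 0) \<in> borel_measurable M"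
        using measurable_compose[OF L2_measurable[OF v] mh] by simp
      show "L2 M (\<lambda>x. C *\<^sub>R v x)" by (rule L2_scaleR[OF v])
      show "AE x in M. norm (h (v x) - h 0) \<le> norm (C *\<^sub>R v x)"
        using assms(3)[of _ 0] C0 by (simp add: abs_mult)
    qed
    from L2_add[OF this L2_scaleR[OF one, of "h 0"]] show ?thesis by simp
  qed
  show "L2 M (\<lambda>x. h (w x))" by (rule L2h[OF L2limD(2)[OF assms(2)]])
  have "L2lim M (\<lambda>k x. h (u k x)) (\<lambda>x. h (w x))"
    by (rule L2lim_contraction[OF assms(2), of _ _ C])
      (use L2h L2limD[OF assms(2)] assms(3) in simp_all)
  moreover have "L2 M (\<lambda>x. 1::real)" by (rule L2_bounded[OF assms(1)]) auto
  ultimately show "(\<lambda>k. LINT x|M. h (u k x)) \<longlonglongrightarrow> (LINT x|M. h (w x))"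
    using L2lim_inner by fastforce
qed

text \<open>If \<open>d k\<close> denotes the size of the \<open>k\<close>-th increment, the weighted series \<open>\<Sum>k. 2 ^ k * (d k)\<^sup>2\<close> has a finite
  integral, and \<open>2 * d k \<le> 2 ^ k * (d k)\<^sup>2 + (1/2) ^ k\<close> makes \<open>d\<close> summable wherever that series converges.\<close>

lemma L2_fast_subsequence_converges:
  fixes u :: "nat \<Rightarrow> 'a \<Rightarrow> 'b::euclidean_space"
  assumes L: "\<And>k. L2 M (u k)" and fast: "\<And>k. L2norm M (\<lambda>x. u (Suc k) x - u k x) \<le> (1/2) ^ k"
  shows "AE x in M. convergent (\<lambda>k. u k x)"
proof -
  define d where "d k x = norm (u (Suc k) x - u k x)" for k x
  have dm [measurable]: "d k \<in> borel_measurable M" for k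
    unfolding d_def using L2_diff[OF L[of "Suc k"] L[of k]] by (auto simp: L2_def)
  have di: "(\<integral>\<^sup>+x. ennreal (2 ^ k * (d k x)\<^sup>2) \<partial>M) \<le> ennreal ((1/2) ^ k)" for k
  proof -
    have L': "L2 M (\<lambda>x. u (Suc k) x - u k x)" by (intro L2_diff L)
    have i: "integrable M (\<lambda>x. (d k x)\<^sup>2)" using L' unfolding d_def L2_def by simp
    have "(LINT x|M. (d k x)\<^sup>2) = (L2norm M (\<lambda>x. u (Suc k) x - u k x))\<^sup>2"
      by (simp add: L2norm_sq d_def)
    also have "\<dots> \<le> ((1/2) ^ k)\<^sup>2" by (intro power_mono fast) auto
    also have "\<dots> = (1/2) ^ k * (1/2) ^ k" by (simp add: power2_eq_square)
    finally have "2 ^ k * (LINT x|M. (d k x)\<^sup>2) \<le> 2 ^ k * ((1/2) ^ k * (1/2) ^ k)"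
      by simp
    also have "\<dots> = (1/2) ^ k" by (simp add: power_divide)
    finally have "(LINT x|M. 2 ^ k * (d k x)\<^sup>2) \<le> (1/2) ^ k" by simp
    then show ?thesis
      by (subst nn_integral_eq_integral) (use i in \<open>auto intro: ennreal_leI\<close>)
  qed
  have "(\<integral>\<^sup>+x. (\<Sum>k. ennreal (2 ^ k * (d k x)\<^sup>2)) \<partial>M) = (\<Sum>k. \<integral>\<^sup>+x. ennreal (2 ^ k * (d k x)\<^sup>2) \<partial>M)"
    by (rule nn_integral_suminf) measurable
  also have "\<dots> \<le> (\<Sum>k. ennreal ((1/2) ^ k))"
    by (intro suminf_le di) auto
  also have "\<dots> = ennreal (\<Sum>k. (1/2) ^ k)"
    by (rule suminf_ennreal2) auto
  also have "\<dots> < \<infinity>" by simp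
  finally have "(\<integral>\<^sup>+x. (\<Sum>k. ennreal (2 ^ k * (d k x)\<^sup>2)) \<partial>M) \<noteq> \<infinity>" by simp
  then have "AE x in M. (\<Sum>k. ennreal (2 ^ k * (d k x)\<^sup>2)) \<noteq> \<infinity>"
    by (intro nn_integral_PInf_AE) measurable
  then show ?thesis
  proof eventually_elim
    case (elim x)
    have s: "summable (\<lambda>k. 2 ^ k * (d k x)\<^sup>2)"
      using elim by (intro summable_suminf_not_top) auto
    have "summable (\<lambda>k. d k x)"
    proof (rule summable_comparison_test')
      show "summable (\<lambda>k. 2 ^ k * (d k x)\<^sup>2 + (1/2) ^ k)" by (intro summable_add s) simp
      fix k
      have "0 \<le> (2 ^ k * d k x - 1)\<^sup>2" by simp
      then have "2 * (2 ^ k * d k x) \<le> 2 ^ k * (2 ^ k * (d k x)\<^sup>2 + (1/2) ^ k)"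
        by (simp add: power2_eq_square algebra_simps power_divide)
      then have "2 ^ k * (2 * d k x) \<le> 2 ^ k * (2 ^ k * (d k x)\<^sup>2 + (1/2) ^ k)"
        by (simp only: mult.left_commute[of 2])
      then have "2 * d k x \<le> 2 ^ k * (d k x)\<^sup>2 + (1/2) ^ k"
        by (rule mult_le_cancel_left_pos[THEN iffD1, rotated]) simp
      then show "norm (d k x) \<le> 2 ^ k * (d k x)\<^sup>2 + (1/2) ^ k"
        using norm_ge_zero[of "u (Suc k) x - u k x"] by (simp only: real_norm_def d_def abs_norm_cancel)
    qed
    then have "summable (\<lambda>k. u (Suc k) x - u k x)"
      unfolding d_def by (rule summable_norm_cancel)
    then have "convergent (\<lambda>n. \<Sum>k<n. u (Suc k) x - u k x)" by (simp add: summable_iff_convergent)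
    then have "convergent (\<lambda>n. u n x - u 0 x)" 
      using sum_lessThan_telescope[of "\<lambda>k. u k x"] by simp
    then have "convergent (\<lambda>n. (u n x - u 0 x) + u 0 x)" by (intro convergent_add convergent_const)
    then show ?case by simp
  qed
qed

text \<open>Riesz--Fischer. A rapidly convergent subsequence converges almost everywhere, and Fatou's
  lemma turns its pointwise limit into the limit in mean.\<close>

theorem L2_complete:
  fixes u :: "nat \<Rightarrow> 'a \<Rightarrow> 'b::euclidean_space"
  assumes L: "\<And>k. L2 M (u k)"
    and Cau: "\<And>e. e > 0 \<Longrightarrow> \<exists>N. \<forall>k\<ge>N. \<forall>l\<ge>N. L2norm M (\<lambda>x. u k x - u l x) < e"
  obtains w r where "L2lim M u w" "strict_mono (r :: nat \<Rightarrow> nat)"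
    "AE x in M. (\<lambda>k. u (r k) x) \<longlonglongrightarrow> w x"
proof -
  have "\<exists>N. \<forall>k\<ge>N. \<forall>l\<ge>N. L2norm M (\<lambda>x. u k x - u l x) < (1/2) ^ j" for j :: nat
    by (rule Cau) simp
  then obtain N where N: "\<And>j k l. k \<ge> N j \<Longrightarrow> l \<ge> N j \<Longrightarrow> L2norm M (\<lambda>x. u k x - u l x) < (1/2) ^ j"
    by metis
  define r where "r = rec_nat (N 0) (\<lambda>j m. max (Suc m) (N (Suc j)))"
  have r0: "r 0 = N 0" and rS: "r (Suc j) = max (Suc (r j)) (N (Suc j))" for j
    by (auto simp: r_def)
  have mono: "strict_mono r" by (rule strict_monoI_Suc) (simp add: rS)
  have rN: "N j \<le> r j" for j by (cases j) (auto simp: r0 rS)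
  have "L2norm M (\<lambda>x. u (r (Suc k)) x - u (r k) x) \<le> (1/2) ^ k" for k
    using N[of k "r (Suc k)" "r k"] rN[of k] strict_monoD[OF mono, of k "Suc k"] by simp
  then have conv: "AE x in M. convergent (\<lambda>k. u (r k) x)"
    by (intro L2_fast_subsequence_converges[where u = "\<lambda>k. u (r k)"] L)
  define w where "w x = lim (\<lambda>k. u (r k) x)" for x
  have wm [measurable]: "w \<in> borel_measurable M"
    unfolding w_def using L by (intro borel_measurable_lim_metric) (auto simp: L2_def)
  have um [measurable]: "u k \<in> borel_measurable M" for k using L by (simp add: L2_def)
  have lim: "AE x in M. (\<lambda>k. u (r k) x) \<longlonglongrightarrow> w x"
    using conv by eventually_elim (simp add: w_def convergent_LIMSEQ_iff)
  have Fatou: "(\<integral>\<^sup>+x. ennreal ((norm (u k x - w x))\<^sup>2) \<partial>M) \<le> ennreal (e\<^sup>2)"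
    if k: "\<And>l. l \<ge> K \<Longrightarrow> L2norm M (\<lambda>x. u k x - u l x) \<le> e" for k K e
  proof -
    have e: "0 \<le> e" using k[of K] L2norm_nonneg[of M] by (meson order_refl order_trans)
    have "(\<integral>\<^sup>+x. ennreal ((norm (u k x - w x))\<^sup>2) \<partial>M) =
      (\<integral>\<^sup>+x. liminf (\<lambda>l. ennreal ((norm (u k x - u (r l) x))\<^sup>2)) \<partial>M)"
    proof (rule nn_integral_cong_AE)
      show "AE x in M. ennreal ((norm (u k x - w x))\<^sup>2) =
          liminf (\<lambda>l. ennreal ((norm (u k x - u (r l) x))\<^sup>2))"
        using lim
      proof eventually_elim
        case (elim x)
        have "(\<lambda>l. ennreal ((norm (u k x - u (r l) x))\<^sup>2)) \<longlonglongrightarrow> ennreal ((norm (u k x - w x))\<^sup>2)"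
          by (intro tendsto_intros elim)
        then show ?case by (intro lim_imp_Liminf[symmetric]) auto
      qed
    qed
    also have "\<dots> \<le> liminf (\<lambda>l. \<integral>\<^sup>+x. ennreal ((norm (u k x - u (r l) x))\<^sup>2) \<partial>M)"
      by (rule nn_integral_liminf) measurable
    also have "\<dots> \<le> liminf (\<lambda>l. ennreal (e\<^sup>2))"
    proof (rule Liminf_mono)
      have "(\<integral>\<^sup>+x. ennreal ((norm (u k x - u (r l) x))\<^sup>2) \<partial>M) \<le> ennreal (e\<^sup>2)" if "l \<ge> K" for l
      proof -
        have "r l \<ge> K" using that seq_suble[OF mono, of l] by simp
        then have "(L2norm M (\<lambda>x. u k x - u (r l) x))\<^sup>2 \<le> e\<^sup>2" by (intro power_mono k) auto
        moreover have "integrable M (\<lambda>x. (norm (u k x - u (r l) x))\<^sup>2)"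
          using L2_diff[OF L L] by (simp add: L2_def)
        ultimately show ?thesis
          by (subst nn_integral_eq_integral) (auto simp: L2norm_sq intro: ennreal_leI)
      qed
      then show "\<forall>\<^sub>F l in sequentially. (\<integral>\<^sup>+x. ennreal ((norm (u k x - u (r l) x))\<^sup>2) \<partial>M) \<le> ennreal (e\<^sup>2)"
        by (rule eventually_sequentiallyI)
    qed
    also have "\<dots> = ennreal (e\<^sup>2)" by (simp add: Liminf_const)
    finally show ?thesis .
  qed
  have close: "L2 M (\<lambda>x. u k x - w x)" "L2norm M (\<lambda>x. u k x - w x) \<le> e"
    if k: "\<And>l. l \<ge> K \<Longrightarrow> L2norm M (\<lambda>x. u k x - u l x) \<le> e" for k K e
  proof -
    have e: "0 \<le> e" using k[of K] L2norm_nonneg[of M] by (meson order_refl order_trans)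
    have F: "(\<integral>\<^sup>+x. ennreal ((norm (u k x - w x))\<^sup>2) \<partial>M) \<le> ennreal (e\<^sup>2)" using Fatou[OF k] .
    then have "integrable M (\<lambda>x. (norm (u k x - w x))\<^sup>2)"
      by (intro integrableI_bounded) (auto simp: order_le_less_trans[OF _ ennreal_less_top])
    then show L': "L2 M (\<lambda>x. u k x - w x)" by (simp add: L2_def)
    have "ennreal (LINT x|M. (norm (u k x - w x))\<^sup>2) \<le> ennreal (e\<^sup>2)"
      using F by (subst (asm) nn_integral_eq_integral) (use L' in \<open>auto simp: L2_def\<close>)
    then have "(L2norm M (\<lambda>x. u k x - w x))\<^sup>2 \<le> e\<^sup>2"
      by (simp add: L2norm_sq)
    then show "L2norm M (\<lambda>x. u k x - w x) \<le> e" using e power2_le_imp_le by blast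
  qed
  have Lw: "L2 M w"
  proof -
    have "L2 M (\<lambda>x. u (N 0) x - w x)" by (rule close(1)[of "N 0" "N 0" 1]) (use N[of 0 "N 0"] in force)
    from L2_diff[OF L[of "N 0"] this] show ?thesis by simp
  qed
  have "(\<lambda>k. L2norm M (\<lambda>x. u k x - w x)) \<longlonglongrightarrow> 0"
  proof (rule LIMSEQ_I)
    fix e :: real assume e: "e > 0"
    obtain K where K: "\<forall>k\<ge>K. \<forall>l\<ge>K. L2norm M (\<lambda>x. u k x - u l x) < e / 2"
      using Cau[of "e / 2"] e by auto
    have "norm (L2norm M (\<lambda>x. u k x - w x) - 0) < e" if "k \<ge> K" for k
      using close(2)[of K k "e / 2"] K that e by (simp add: less_imp_le)
    then show "\<exists>K. \<forall>k\<ge>K. norm (L2norm M (\<lambda>x. u k x - w x) - 0) < e" by blast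
  qed
  then have "L2lim M u w" using L Lw by (simp add: L2lim_def)
  with mono lim show ?thesis using that by blast
qed

section \<open>Test functions\<close>

lemma test_functionsI:
  assumes "smooth \<phi>" "compact K" "K \<subseteq> \<Omega>" "\<And>x. x \<notin> K \<Longrightarrow> \<phi> x = 0"
  shows "\<phi> \<in> test_functions \<Omega>"
proof -
  have "closure {x. \<phi> x \<noteq> 0} \<subseteq> K"
    using assms(2,4) by (intro closure_minimal) (auto simp: compact_imp_closed)
  moreover from this have "compact (closure {x. \<phi> x \<noteq> 0})"
    using compact_Int_closed[OF assms(2) closed_closure, of "{x. \<phi> x \<noteq> 0}"] by (simp add: inf_absorb2)
  ultimately show ?thesis using assms(1,3) by (auto simp: test_functions_def smooth_def)
qed

lemma test_functionsE:
  assumes "\<phi> \<in> test_functions \<Omega>"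
  obtains K where "smooth \<phi>" "compact K" "K \<subseteq> \<Omega>" "\<And>x. x \<notin> K \<Longrightarrow> \<phi> x = 0"
    "\<And>x. x \<notin> K \<Longrightarrow> grad \<phi> x = 0"
proof -
  define K where "K = closure {x. \<phi> x \<noteq> 0}"
  have K: "compact K" "K \<subseteq> \<Omega>" "smooth \<phi>"
    using assms by (auto simp: test_functions_def K_def smooth_def)
  have 0: "\<phi> x = 0" if "x \<notin> K" for x
    using that closure_subset[of "{x. \<phi> x \<noteq> 0}"] by (auto simp: K_def)
  have "grad \<phi> x = 0" if "x \<notin> K" for x
  proof (rule grad_eqI)
    show "(\<phi> has_derivative (\<lambda>h. 0)) (at x)"
      by (rule has_derivative_transform_within_open[of "\<lambda>_. 0" _ _ _ "- K"])
        (use that 0 K(1) in \<open>auto simp: open_Compl compact_imp_closed\<close>)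
  qed simp
  with K 0 show ?thesis using that by blast
qed

lemma test_functions_smooth: "\<phi> \<in> test_functions \<Omega> \<Longrightarrow> smooth \<phi>"
  by (simp add: test_functions_def smooth_def)

lemma test_functions_outside:
  assumes "\<phi> \<in> test_functions \<Omega>" "x \<notin> \<Omega>"
  shows "\<phi> x = 0" "grad \<phi> x = 0"
  using assms by (auto elim!: test_functionsE)

lemma test_functions_0: "(\<lambda>x. 0) \<in> test_functions \<Omega>"
  by (rule test_functionsI[of _ "{}"]) (auto intro: smooth_const)

lemma test_functions_add:
  assumes "\<phi> \<in> test_functions \<Omega>" "\<psi> \<in> test_functions \<Omega>"
  shows "(\<lambda>x. \<phi> x + \<psi> x) \<in> test_functions \<Omega>"
proof -
  obtain K L where "compact K" "K \<subseteq> \<Omega>" "\<And>x. x \<notin> K \<Longrightarrow> \<phi> x = 0"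
    "compact L" "L \<subseteq> \<Omega>" "\<And>x. x \<notin> L \<Longrightarrow> \<psi> x = 0"
    using assms by (metis test_functionsE)
  then show ?thesis
    using assms by (intro test_functionsI[of _ "K \<union> L"]) (auto intro: smooth_add test_functions_smooth)
qed

lemma test_functions_mult_smooth:
  assumes "\<phi> \<in> test_functions \<Omega>" "smooth h"
  shows "(\<lambda>x. h x * \<phi> x) \<in> test_functions \<Omega>"
  by (rule test_functionsE[OF assms(1)]) (auto intro!: test_functionsI smooth_mult assms(2))

lemma test_functions_cmult: "\<phi> \<in> test_functions \<Omega> \<Longrightarrow> (\<lambda>x. c * \<phi> x) \<in> test_functions \<Omega>"
  by (rule test_functions_mult_smooth[OF _ smooth_const])

lemma test_functions_sum:
  "(\<And>i. i \<in> A \<Longrightarrow> f i \<in> test_functions \<Omega>) \<Longrightarrow> (\<lambda>x. \<Sum>i\<in>A. f i x) \<in> test_functions \<Omega>"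
  by (induction A rule: infinite_finite_induct) (auto intro: test_functions_add test_functions_0)

lemma continuous_compact_support_bounded:
  fixes f :: "'a::euclidean_space \<Rightarrow> 'b::real_normed_vector"
  assumes "continuous_on UNIV f" "compact K" "\<And>x. x \<notin> K \<Longrightarrow> f x = 0"
  obtains C where "0 \<le> C" "\<And>x. norm (f x) \<le> C"
proof -
  have "compact (f ` K)" using assms by (intro compact_continuous_image) (auto intro: continuous_on_subset)
  then obtain C where C: "\<And>y. y \<in> f ` K \<Longrightarrow> norm y \<le> C" using compact_imp_bounded by (metis bounded_iff)
  have "norm (f x) \<le> max C 0" for x
    by (cases "x \<in> K") (use C assms(3)[of x] in force)+
  then show ?thesis using that[of "max C 0"] by simp
qed

lemma test_functions_bounded:
  assumes "\<phi> \<in> test_functions \<Omega>"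
  obtains C where "0 \<le> C" "\<And>x. \<bar>\<phi> x\<bar> \<le> C" "\<And>x. norm (grad \<phi> x) \<le> C"
proof -
  obtain K where K: "smooth \<phi>" "compact K" "\<And>x. x \<notin> K \<Longrightarrow> \<phi> x = 0"
    "\<And>x. x \<notin> K \<Longrightarrow> grad \<phi> x = 0" by (rule test_functionsE[OF assms]) (rule that)
  obtain C1 where C1: "0 \<le> C1" "\<And>x. norm (\<phi> x) \<le> C1"
    using continuous_compact_support_bounded[OF continuous_smooth[OF K(1)] K(2,3)] by blast
  obtain C2 where C2: "0 \<le> C2" "\<And>x. norm (grad \<phi> x) \<le> C2"
    using continuous_compact_support_bounded[OF continuous_grad[OF K(1)] K(2,4)] by blast
  have "\<bar>\<phi> x\<bar> \<le> C1 + C2" "norm (grad \<phi> x) \<le> C1 + C2" for x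
    using C1(2)[of x] C2(2)[of x] C1(1) C2(1) by auto
  then show ?thesis using that[of "C1 + C2"] C1(1) C2(1) by simp
qed

section \<open>Integration of functions supported in a domain\<close>

lemma continuous_measurable_lebesgue_on:
  fixes h :: "'a::euclidean_space \<Rightarrow> 'b::euclidean_space"
  shows "continuous_on UNIV h \<Longrightarrow> h \<in> borel_measurable (lebesgue_on \<Omega>)"
  by (simp add: borel_measurable_continuous_onI measurable_completion measurable_restrict_space1)

lemma
  fixes h :: "'a::euclidean_space \<Rightarrow> 'b::euclidean_space"
  assumes "\<Omega> \<in> sets borel" "h \<in> borel_measurable borel" "\<And>x. x \<notin> \<Omega> \<Longrightarrow> h x = 0"
  shows integrable_lebesgue_on_eq: "integrable (lebesgue_on \<Omega>) h \<longleftrightarrow> integrable lborel h"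
    and integral_lebesgue_on_eq: "(LINT x|lebesgue_on \<Omega>. h x) = (LINT x|lborel. h x)"
proof -
  have eq: "(\<lambda>x. indicator \<Omega> x *\<^sub>R h x) = h" using assms(3) by (auto simp: indicator_def)
  have h: "h \<in> borel_measurable lborel" using assms(2) by simp
  show "integrable (lebesgue_on \<Omega>) h \<longleftrightarrow> integrable lborel h"
    using assms(1) h by (subst integrable_restrict_space) (auto simp: eq integrable_completion)
  show "(LINT x|lebesgue_on \<Omega>. h x) = (LINT x|lborel. h x)"
    using assms(1) h by (subst integral_restrict_space) (auto simp: eq integral_completion)
qed

lemma nn_integral_lebesgue_on_eq:
  assumes "\<Omega> \<in> sets borel" "\<And>x. x \<notin> \<Omega> \<Longrightarrow> h x = 0"
  shows "(\<integral>\<^sup>+x. h x \<partial>lebesgue_on \<Omega>) = (\<integral>\<^sup>+x. h x \<partial>lborel)"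
proof -
  have eq: "(\<lambda>x. h x * indicator \<Omega> x) = h" using assms(2) by (auto simp: indicator_def)
  show ?thesis using assms(1) by (subst nn_integral_restrict_space) (auto simp: eq nn_integral_completion)
qed

lemma finite_measure_lebesgue_on_bounded:
  "\<Omega> \<in> sets borel \<Longrightarrow> bounded \<Omega> \<Longrightarrow> finite_measure (lebesgue_on \<Omega>)"
  by (metis bounded_set_imp_lmeasurable finite_measure_lebesgue_on sets_completionI_sets sets_lborel)

lemma finite_measure_ball [simp]: "finite_measure (lebesgue_on (ball c r))"
  by (rule finite_measure_lebesgue_on_bounded) auto

lemma integrable_lborel_compact_support:
  fixes h :: "'a::euclidean_space \<Rightarrow> 'b::euclidean_space"
  assumes "continuous_on UNIV h" "compact K" "\<And>x. x \<notin> K \<Longrightarrow> h x = 0"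
  shows "integrable lborel h"
proof -
  have "integrable lborel (\<lambda>x. indicator K x *\<^sub>R h x)"
    using assms by (intro borel_integrable_compact) (auto intro: continuous_on_subset)
  moreover have "(\<lambda>x. indicator K x *\<^sub>R h x) = h" using assms(3) by (auto simp: indicator_def)
  ultimately show ?thesis by simp
qed

lemma L2_continuous_on_ball:
  fixes h :: "'a::euclidean_space \<Rightarrow> 'b::euclidean_space"
  assumes "continuous_on UNIV h"
  shows "L2 (lebesgue_on (ball c r)) h"
proof -
  have "bounded (h ` cball c r)"
    using assms by (intro compact_imp_bounded compact_continuous_image) (auto intro: continuous_on_subset)
  then obtain B where B: "\<And>y. y \<in> ball c r \<Longrightarrow> norm (h y) \<le> B"
    by (metis bounded_iff imageI ball_subset_cball subsetD)
  show ?thesis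
    by (rule L2_bounded[where C = B], simp, rule continuous_measurable_lebesgue_on[OF assms],
        rule AE_I2, rule B, simp add: space_restrict_space)
qed

lemma L2_test:
  assumes "\<phi> \<in> test_functions (ball c r)"
  shows "L2 (lebesgue_on (ball c r)) \<phi>" "L2 (lebesgue_on (ball c r)) (grad \<phi>)"
  using test_functions_smooth[OF assms]
  by (auto intro: L2_continuous_on_ball continuous_smooth continuous_grad)

lemma integral_translation:
  fixes h :: "'a::euclidean_space \<Rightarrow> 'b::euclidean_space"
  assumes "h \<in> borel_measurable borel"
  shows "(LINT x|lborel. h (c + x)) = (LINT x|lborel. h x)"
proof -
  have "(LINT x|distr lborel borel ((+) c). h x) = (LINT x|lborel. h (c + x))"
    using assms by (intro integral_distr) auto
  then show ?thesis by (simp add: lborel_distr_plus)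
qed

lemma nn_integral_translation:
  assumes "h \<in> borel_measurable borel"
  shows "(\<integral>\<^sup>+x. h (c + x) \<partial>lborel) = (\<integral>\<^sup>+x. h x \<partial>lborel)"
proof -
  have "(\<integral>\<^sup>+x. h x \<partial>distr lborel borel ((+) c)) = (\<integral>\<^sup>+x. h (c + x) \<partial>lborel)"
    using assms by (intro nn_integral_distr) auto
  then show ?thesis by (simp add: lborel_distr_plus)
qed

lemma smooth_line_derivative:
  assumes "smooth h"
  shows "((\<lambda>t. h (x + t *\<^sub>R v)) has_real_derivative (grad h (x + t *\<^sub>R v) \<bullet> v)) (at t)"
proof -
  have l: "((\<lambda>t. x + t *\<^sub>R v) has_derivative (\<lambda>s. s *\<^sub>R v)) (at t)"
    by (auto intro!: derivative_eq_intros)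
  have "(\<lambda>s. grad h (x + t *\<^sub>R v) \<bullet> (s *\<^sub>R v)) = (*) (grad h (x + t *\<^sub>R v) \<bullet> v)"
    by (auto simp: mult.commute)
  with has_derivative_compose[OF l smooth_grad[OF assms]] show ?thesis
    by (simp only: has_field_derivative_def)
qed

lemma smooth_Lipschitz:
  assumes "smooth h" "\<And>x. norm (grad h x) \<le> C"
  shows "\<bar>h x - h y\<bar> \<le> C * norm (x - y)"
proof -
  have "norm (h x - h y) \<le> C * norm (x - y)"
  proof (rule differentiable_bound[of UNIV h "\<lambda>x h'. grad h x \<bullet> h'"])
    show "onorm (\<lambda>h'. grad h x \<bullet> h') \<le> C" for x
    proof (rule onorm_le)
      fix v
      have "norm (grad h x \<bullet> v) \<le> norm (grad h x) * norm v" by (simp add: Cauchy_Schwarz_ineq2)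
      also have "\<dots> \<le> C * norm v" by (intro mult_right_mono assms) auto
      finally show "norm (grad h x \<bullet> v) \<le> C * norm v" .
    qed
  qed (auto intro: has_derivative_at_withinI smooth_grad assms)
  then show ?thesis by simp
qed

text \<open>Translation invariance makes the integral of every difference quotient vanish; the difference
  quotients are dominated, so the integral of the partial derivative vanishes too.\<close>

lemma integral_partial_0:
  assumes h: "h \<in> test_functions \<Omega>" and i: "i \<in> Basis"
  shows "(LINT x|lborel. grad h x \<bullet> i) = 0"
proof -
  obtain K where K: "smooth h" "compact K" "\<And>x. x \<notin> K \<Longrightarrow> h x = 0" by (rule test_functionsE[OF h]) (rule that)
  obtain C where C: "0 \<le> C" "\<And>x. norm (grad h x) \<le> C" by (rule test_functions_bounded[OF h]) (rule that)
  obtain R where R: "\<And>x. x \<in> K \<Longrightarrow> norm x \<le> R" using compact_imp_bounded[OF K(2)] by (auto simp: bounded_iff)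
  have hm: "h \<in> borel_measurable borel" using continuous_smooth[OF K(1)] by (rule borel_measurable_continuous_onI)
  have hi: "integrable lborel h" by (rule integrable_lborel_compact_support[OF continuous_smooth[OF K(1)] K(2,3)])
  define s where "s n x = real (Suc n) * (h ((1 / real (Suc n)) *\<^sub>R i + x) - h x)" for n x
  define g where "g x = C * indicator (cball 0 (R + 1)) x" for x :: 'a
  have "(\<lambda>n. LINT x|lborel. s n x) \<longlonglongrightarrow> (LINT x|lborel. grad h x \<bullet> i)"
  proof (rule integral_dominated_convergence[where w = g])
    show "(\<lambda>x. grad h x \<bullet> i) \<in> borel_measurable lborel"
      using continuous_smooth[OF smooth_partial[OF K(1) i]] by (simp add: borel_measurable_continuous_onI)
    show "s n \<in> borel_measurable lborel" for n unfolding s_def using hm by measurable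
    show "integrable lborel g" unfolding g_def
      by (intro integrable_mult_right integrable_real_indicator) (auto intro: emeasure_bounded_finite[unfolded infinity_ennreal_def])
    show "AE x in lborel. (\<lambda>n. s n x) \<longlonglongrightarrow> grad h x \<bullet> i"
    proof (rule AE_I2)
      fix x :: 'a
      have "((\<lambda>t. (h (x + t *\<^sub>R i) - h x) / t) \<longlongrightarrow> grad h x \<bullet> i) (at 0)"
        using smooth_line_derivative[OF K(1), of x i 0] by (simp add: DERIV_def)
      moreover have "filterlim (\<lambda>n. 1 / real (Suc n)) (at 0) sequentially"
        unfolding filterlim_at using LIMSEQ_inverse_real_of_nat by (auto simp: inverse_eq_divide)
      ultimately have "(\<lambda>n. (h (x + (1 / real (Suc n)) *\<^sub>R i) - h x) / (1 / real (Suc n))) \<longlonglongrightarrow> grad h x \<bullet> i"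
        by (rule filterlim_compose)
      then show "(\<lambda>n. s n x) \<longlonglongrightarrow> grad h x \<bullet> i" by (simp add: s_def add.commute mult.commute)
    qed
    show "AE x in lborel. norm (s n x) \<le> g x" for n
    proof (rule AE_I2)
      fix x :: 'a
      show "norm (s n x) \<le> g x"
      proof (cases "x \<in> cball 0 (R + 1)")
        case True
        have "\<bar>h ((1 / real (Suc n)) *\<^sub>R i + x) - h x\<bar> \<le> C * norm (((1 / real (Suc n)) *\<^sub>R i + x) - x)"
          by (rule smooth_Lipschitz[OF K(1) C(2)])
        also have "\<dots> = C / real (Suc n)" using i by simp
        finally have "real (Suc n) * \<bar>h ((1 / real (Suc n)) *\<^sub>R i + x) - h x\<bar> \<le> real (Suc n) * (C / real (Suc n))"
          by (intro mult_left_mono) auto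
        then have "\<bar>s n x\<bar> \<le> C" by (simp add: s_def abs_mult)
        then show ?thesis using True by (simp add: g_def)
      next
        case False
        then have x: "norm x > R + 1" by simp
        have "norm x \<le> norm ((1 / real (Suc n)) *\<^sub>R i + x) + norm ((1 / real (Suc n)) *\<^sub>R i)"
          using norm_triangle_ineq4[of "(1 / real (Suc n)) *\<^sub>R i + x" "(1 / real (Suc n)) *\<^sub>R i"] by simp
        also have "norm ((1 / real (Suc n)) *\<^sub>R i) \<le> 1" using i by simp
        finally have "(1 / real (Suc n)) *\<^sub>R i + x \<notin> K" "x \<notin> K" using x R by force+
        then show ?thesis using K(3) C(1) by (simp add: s_def g_def)
      qed
    qed
  qed
  moreover have "(LINT x|lborel. s n x) = 0" for n
  proof -
    have "integrable lborel (\<lambda>x. h (c + x))" for c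
      using hi integrable_distr_eq[of "(+) c" lborel borel h] hm by (simp add: lborel_distr_plus)
    then show ?thesis unfolding s_def using hi integral_translation[OF hm] by simp
  qed
  ultimately show ?thesis by (simp add: LIMSEQ_const_iff)
qed

lemma integration_by_parts_test:
  assumes \<phi>: "\<phi> \<in> test_functions \<Omega>" and \<psi>: "\<psi> \<in> test_functions \<Omega>" and i: "i \<in> Basis" and \<Omega>: "\<Omega> \<in> sets borel"
  shows "(LINT x|lebesgue_on \<Omega>. \<phi> x * (grad \<psi> x \<bullet> i)) = - (LINT x|lebesgue_on \<Omega>. (grad \<phi> x \<bullet> i) * \<psi> x)"
proof -
  obtain K where K: "smooth \<phi>" "compact K" "\<And>x. x \<notin> K \<Longrightarrow> \<phi> x = 0" "\<And>x. x \<notin> K \<Longrightarrow> grad \<phi> x = 0"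
    by (rule test_functionsE[OF \<phi>]) (rule that)
  have s: "smooth \<psi>" using \<psi> by (rule test_functions_smooth)
  have c: "continuous_on UNIV (\<lambda>x. \<phi> x * (grad \<psi> x \<bullet> i))" "continuous_on UNIV (\<lambda>x. (grad \<phi> x \<bullet> i) * \<psi> x)"
    using K(1) s by (auto intro!: continuous_smooth smooth_mult smooth_partial i)
  have I: "integrable lborel (\<lambda>x. \<phi> x * (grad \<psi> x \<bullet> i))" "integrable lborel (\<lambda>x. (grad \<phi> x \<bullet> i) * \<psi> x)"
    using K by (auto intro!: integrable_lborel_compact_support c)
  have "0 = (LINT x|lborel. grad (\<lambda>x. \<phi> x * \<psi> x) x \<bullet> i)"
    using integral_partial_0[OF test_functions_mult_smooth[OF \<psi> K(1)] i] by simp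
  also have "\<dots> = (LINT x|lborel. \<phi> x * (grad \<psi> x \<bullet> i)) + (LINT x|lborel. (grad \<phi> x \<bullet> i) * \<psi> x)"
    using I by (simp add: grad_mult[OF K(1) s] inner_left_distrib mult.commute)
  finally show ?thesis
    using test_functions_outside[OF \<phi>] test_functions_outside[OF \<psi>] c \<Omega>
    by (subst (1 2) integral_lebesgue_on_eq) (auto simp: borel_measurable_continuous_onI)
qed

section \<open>Rellich's compactness theorem\<close>

lemma continuous_nn_integral_Icc:
  fixes f :: "real \<Rightarrow> real"
  assumes "continuous_on {a..b} f" "\<And>t. t \<in> {a..b} \<Longrightarrow> 0 \<le> f t"
  shows "(\<integral>\<^sup>+t. ennreal (indicator {a..b} t * f t) \<partial>lborel) = ennreal (integral {a..b} f)"
  by (rule nn_integral_has_integral_lebesgue)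
    (use assms integrable_continuous_real in \<open>auto simp: has_integral_integral[symmetric]\<close>)

text \<open>Jensen's inequality: with \<open>c = w 1 - w 0\<close>, the integral of \<open>(w' - c)\<^sup>2\<close> equals that of \<open>(w')\<^sup>2\<close> minus \<open>c\<^sup>2\<close>.\<close>

lemma square_increment_le:
  assumes "\<And>t. (w has_real_derivative w' t) (at t)" "continuous_on UNIV w'"
  shows "ennreal ((w 1 - w 0)\<^sup>2) \<le> (\<integral>\<^sup>+t. ennreal (indicator {0..1} t * (w' t)\<^sup>2) \<partial>lborel)"
proof -
  define c where "c = w 1 - w 0"
  have "(w' has_integral (w 1 - w 0)) {0..1}"
    by (rule fundamental_theorem_of_calculus)
      (auto simp: has_real_derivative_iff_has_vector_derivative[symmetric]
        intro: has_field_derivative_at_within assms)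
  then have I: "(w' has_integral c) {0..1}" by (simp add: c_def)
  have cont: "continuous_on {0..1} (\<lambda>t. (w' t)\<^sup>2)" "continuous_on {0..1} w'"
    using assms(2) by (auto intro!: continuous_intros intro: continuous_on_subset)
  have Q: "((\<lambda>t. (w' t)\<^sup>2) has_integral integral {0..1} (\<lambda>t. (w' t)\<^sup>2)) {0..1}"
    using integrable_continuous_real[OF cont(1)] by (simp add: has_integral_integral[symmetric])
  have R: "((\<lambda>t. (w' t)\<^sup>2 - 2 * c * w' t + c\<^sup>2) has_integral
      (integral {0..1} (\<lambda>t. (w' t)\<^sup>2) - 2 * c * c + c\<^sup>2)) {0..1}"
    using has_integral_const_real[of "c\<^sup>2" 0 1]
    by (intro has_integral_add has_integral_diff has_integral_mult_right Q I) auto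
  have "(w' t)\<^sup>2 - 2 * c * w' t + c\<^sup>2 = (w' t - c)\<^sup>2" for t
    by (simp add: power2_diff)
  then have "0 \<le> integral {0..1} (\<lambda>t. (w' t)\<^sup>2) - 2 * c * c + c\<^sup>2"
    by (intro has_integral_nonneg[OF R]) simp
  then have "c\<^sup>2 \<le> integral {0..1} (\<lambda>t. (w' t)\<^sup>2)" by (simp add: power2_eq_square)
  then show ?thesis
    using continuous_nn_integral_Icc[OF cont(1)] by (simp add: c_def ennreal_leI)
qed

lemma smooth_measurable: "smooth h \<Longrightarrow> h \<in> borel_measurable borel"
  by (intro borel_measurable_continuous_onI continuous_smooth)

lemma grad_measurable: "smooth h \<Longrightarrow> grad h \<in> borel_measurable borel"
  by (intro borel_measurable_continuous_onI continuous_grad)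

text \<open>The increment along the segment from \<open>x\<close> to \<open>x + v\<close> is controlled by the gradient on that segment;
  integrating over \<open>x\<close> first, every point of the segment contributes the same by translation invariance.\<close>

lemma translation_estimate:
  fixes h :: "'a::euclidean_space \<Rightarrow> real"
  assumes h: "smooth h"
  shows "(\<integral>\<^sup>+x. ennreal ((h (x + v) - h x)\<^sup>2) \<partial>lborel)
    \<le> ennreal ((norm v)\<^sup>2) * (\<integral>\<^sup>+x. ennreal ((norm (grad h x))\<^sup>2) \<partial>lborel)"
proof -
  define D where "D = (\<integral>\<^sup>+x. ennreal ((norm (grad h x))\<^sup>2) \<partial>lborel)"
  have cg: "continuous_on UNIV (\<lambda>z. grad h (f z))" if "continuous_on UNIV f" for f :: "'b::topological_space \<Rightarrow> 'a"
    using continuous_on_compose2[OF continuous_grad[OF h] that] by auto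
  have "(\<integral>\<^sup>+x. ennreal ((h (x + v) - h x)\<^sup>2) \<partial>lborel) \<le>
     (\<integral>\<^sup>+x. (\<integral>\<^sup>+t. ennreal (indicator {0..1} t * (grad h (x + t *\<^sub>R v) \<bullet> v)\<^sup>2) \<partial>lborel) \<partial>lborel)"
  proof (rule nn_integral_mono)
    fix x
    show "ennreal ((h (x + v) - h x)\<^sup>2) \<le>
        (\<integral>\<^sup>+t. ennreal (indicator {0..1} t * (grad h (x + t *\<^sub>R v) \<bullet> v)\<^sup>2) \<partial>lborel)"
      using square_increment_le[of "\<lambda>t. h (x + t *\<^sub>R v)", OF smooth_line_derivative[OF h]]
      by (simp add: cg continuous_intros)
  qed
  also have "\<dots> = (\<integral>\<^sup>+t. (\<integral>\<^sup>+x. ennreal (indicator {0..1} t * (grad h (x + t *\<^sub>R v) \<bullet> v)\<^sup>2) \<partial>lborel) \<partial>lborel)"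
  proof (rule lborel_pair.Fubini'[symmetric])
    have "(\<lambda>z::'a \<times> real. (grad h (fst z + snd z *\<^sub>R v) \<bullet> v)\<^sup>2) \<in> borel_measurable borel"
      by (intro borel_measurable_continuous_onI continuous_intros cg)
    then have "(\<lambda>z::'a \<times> real. ennreal (indicator {0..1} (snd z) * (grad h (fst z + snd z *\<^sub>R v) \<bullet> v)\<^sup>2))
        \<in> borel_measurable (borel \<Otimes>\<^sub>M borel)"
      unfolding borel_prod[symmetric] by measurable
    then show "(\<lambda>(x, t). ennreal (indicator {0..1} t * (grad h (x + t *\<^sub>R v) \<bullet> v)\<^sup>2))
        \<in> borel_measurable (lborel \<Otimes>\<^sub>M lborel)"
      by (simp add: case_prod_beta' cong: measurable_cong_sets sets_pair_measure_cong)
  qed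
  also have "\<dots> \<le> (\<integral>\<^sup>+t. ennreal ((norm v)\<^sup>2) * D * indicator {0..1::real} t \<partial>lborel)"
  proof (rule nn_integral_mono)
    fix t :: real
    have "(\<integral>\<^sup>+x. ennreal ((grad h (x + t *\<^sub>R v) \<bullet> v)\<^sup>2) \<partial>lborel) = (\<integral>\<^sup>+x. ennreal ((grad h x \<bullet> v)\<^sup>2) \<partial>lborel)"
      using nn_integral_translation[of "\<lambda>x. ennreal ((grad h x \<bullet> v)\<^sup>2)" "t *\<^sub>R v"] grad_measurable[OF h]
      by (simp add: add.commute)
    also have "\<dots> \<le> (\<integral>\<^sup>+x. ennreal ((norm v)\<^sup>2) * ennreal ((norm (grad h x))\<^sup>2) \<partial>lborel)"
    proof (rule nn_integral_mono)
      fix x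
      have "(grad h x \<bullet> v)\<^sup>2 \<le> (norm (grad h x) * norm v)\<^sup>2"
        using Cauchy_Schwarz_ineq2[of "grad h x" v] by (simp add: abs_le_square_iff[symmetric] abs_mult)
      then show "ennreal ((grad h x \<bullet> v)\<^sup>2) \<le> ennreal ((norm v)\<^sup>2) * ennreal ((norm (grad h x))\<^sup>2)"
        by (simp add: ennreal_mult'[symmetric] power_mult_distrib mult.commute ennreal_leI)
    qed
    also have "\<dots> = ennreal ((norm v)\<^sup>2) * D"
      unfolding D_def using grad_measurable[OF h] by (intro nn_integral_cmult) simp
    finally show "(\<integral>\<^sup>+x. ennreal (indicator {0..1} t * (grad h (x + t *\<^sub>R v) \<bullet> v)\<^sup>2) \<partial>lborel)
        \<le> ennreal ((norm v)\<^sup>2) * D * indicator {0..1} t"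
      by (auto simp: indicator_def)
  qed
  also have "\<dots> = ennreal ((norm v)\<^sup>2) * D"
    by (subst nn_integral_cmult_indicator) auto
  finally show ?thesis by (simp add: D_def)
qed

definition ball_mean :: "real \<Rightarrow> ('a::euclidean_space \<Rightarrow> real) \<Rightarrow> 'a \<Rightarrow> real" where
  "ball_mean r h x = (LINT y|lebesgue_on (ball 0 r). h (x + y)) / measure lebesgue (ball (0::'a) r)"

lemma mean_square_le:
  fixes h :: "'a::euclidean_space \<Rightarrow> real"
  assumes "continuous_on UNIV h" "r > 0"
  shows "ennreal (((LINT y|lebesgue_on (ball 0 r). h y) / measure lebesgue (ball (0::'a) r))\<^sup>2)
     \<le> ennreal (1 / measure lebesgue (ball (0::'a) r)) * (\<integral>\<^sup>+y. indicator (ball 0 r) y * ennreal ((h y)\<^sup>2) \<partial>lborel)"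
proof -
  let ?M = "lebesgue_on (ball (0::'a) r)"
  define c where "c = measure lebesgue (ball (0::'a) r)"
  have c: "c > 0" using content_ball_pos[OF assms(2), of "0::'a"] by (simp add: c_def)
  have hL: "L2 ?M h" by (rule L2_continuous_on_ball[OF assms(1)])
  have 1: "L2 ?M (\<lambda>_. 1::real)" by (rule L2_bounded[where C = 1]) auto
  have n1: "(L2norm ?M (\<lambda>_. 1::real))\<^sup>2 = c"
    by (simp add: L2norm_sq c_def measure_restrict_space)
  have "\<bar>LINT y|?M. h y\<bar> \<le> L2norm ?M h * L2norm ?M (\<lambda>_. 1::real)"
    using L2_Cauchy_Schwarz[OF hL 1] by simp
  then have "(LINT y|?M. h y)\<^sup>2 \<le> (L2norm ?M h * L2norm ?M (\<lambda>_. 1::real))\<^sup>2"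
    by (simp add: abs_le_square_iff[symmetric] abs_mult)
  also have "\<dots> = c * (LINT y|?M. (h y)\<^sup>2)"
    by (simp only: power_mult_distrib n1) (simp add: L2norm_sq)
  finally have "(LINT y|?M. h y)\<^sup>2 / c\<^sup>2 \<le> c * (LINT y|?M. (h y)\<^sup>2) / c\<^sup>2"
    by (rule divide_right_mono) simp
  then have "((LINT y|?M. h y) / c)\<^sup>2 \<le> (1 / c) * (LINT y|?M. (h y)\<^sup>2)"
    using c by (simp add: power_divide) (simp add: power2_eq_square)
  then have "ennreal (((LINT y|?M. h y) / c)\<^sup>2) \<le> ennreal ((1 / c) * (LINT y|?M. (h y)\<^sup>2))"
    by (rule ennreal_leI)
  also have "\<dots> = ennreal (1 / c) * ennreal (LINT y|?M. (h y)\<^sup>2)"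
    using c by (intro ennreal_mult) auto
  also have "ennreal (LINT y|?M. (h y)\<^sup>2) = (\<integral>\<^sup>+y. ennreal ((h y)\<^sup>2) \<partial>?M)"
    using hL by (subst nn_integral_eq_integral) (auto simp: L2_def)
  also have "\<dots> = (\<integral>\<^sup>+y. indicator (ball 0 r) y * ennreal ((h y)\<^sup>2) \<partial>lborel)"
    by (subst nn_integral_restrict_space) (auto simp: nn_integral_completion mult.commute)
  finally show ?thesis by (simp add: c_def)
qed

lemma integrable_on_ball_continuous:
  fixes h :: "'a::euclidean_space \<Rightarrow> real"
  shows "continuous_on UNIV h \<Longrightarrow> integrable (lebesgue_on (ball c r)) h"
  by (rule L2_integrable[OF finite_measure_ball L2_continuous_on_ball])

lemma continuous_smooth_shift:
  assumes "smooth h" shows "continuous_on UNIV (\<lambda>y. h (x + y))"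
proof -
  have "continuous_on UNIV (\<lambda>y. x + y)" by (intro continuous_intros)
  from continuous_on_compose2[OF continuous_smooth[OF assms] this] show ?thesis by simp
qed

text \<open>The Lipschitz constant of a mean over balls of fixed radius depends on the function only through its
  Dirichlet integral. This is the equicontinuity needed for the theorem of Arzela and Ascoli.\<close>

lemma ball_mean_Lipschitz:
  fixes h :: "'a::euclidean_space \<Rightarrow> real"
  assumes h: "smooth h" and r: "r > 0"
  shows "ennreal ((ball_mean r h x - ball_mean r h x')\<^sup>2) \<le>
    ennreal ((norm (x - x'))\<^sup>2 / measure lebesgue (ball (0::'a) r)) * (\<integral>\<^sup>+x. ennreal ((norm (grad h x))\<^sup>2) \<partial>lborel)"
proof -
  let ?vol = "measure lebesgue (ball (0::'a) r)"
  have vol: "?vol > 0" using content_ball_pos[OF r, of "0::'a"] by simp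
  have "ball_mean r h x - ball_mean r h x' =
      (LINT y|lebesgue_on (ball 0 r). h (x + y) - h (x' + y)) / ?vol"
    by (simp add: ball_mean_def integrable_on_ball_continuous continuous_smooth_shift[OF h] diff_divide_distrib)
  then have "ennreal ((ball_mean r h x - ball_mean r h x')\<^sup>2) \<le> ennreal (1 / ?vol) *
      (\<integral>\<^sup>+y. indicator (ball 0 r) y * ennreal ((h (x + y) - h (x' + y))\<^sup>2) \<partial>lborel)"
    using mean_square_le[of "\<lambda>y. h (x + y) - h (x' + y)" r] r by (simp add: continuous_on_diff continuous_smooth_shift[OF h])
  also have "\<dots> \<le> ennreal (1 / ?vol) * (\<integral>\<^sup>+y. ennreal ((h (x + y) - h (x' + y))\<^sup>2) \<partial>lborel)"
    by (intro mult_left_mono nn_integral_mono) (auto simp: indicator_def)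
  also have "(\<integral>\<^sup>+y. ennreal ((h (x + y) - h (x' + y))\<^sup>2) \<partial>lborel) =
      (\<integral>\<^sup>+y. ennreal ((h (y + (x - x')) - h y)\<^sup>2) \<partial>lborel)"
    using nn_integral_translation[of "\<lambda>y. ennreal ((h (y + (x - x')) - h y)\<^sup>2)" x'] smooth_measurable[OF h]
    by (simp add: algebra_simps)
  also have "\<dots> \<le> ennreal ((norm (x - x'))\<^sup>2) * (\<integral>\<^sup>+x. ennreal ((norm (grad h x))\<^sup>2) \<partial>lborel)"
    by (rule translation_estimate[OF h])
  finally show ?thesis
    using vol by (simp add: mult_left_mono mult.assoc[symmetric] ennreal_mult'[symmetric])
qed

text \<open>Averaging the translation estimate over the ball shows that, uniformly on bounded sets of the Sobolev
  space, means over small balls are close to the function itself.\<close>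

lemma ball_mean_close:
  fixes h :: "'a::euclidean_space \<Rightarrow> real"
  assumes h: "smooth h" and r: "r > 0"
  shows "(\<integral>\<^sup>+x. ennreal ((ball_mean r h x - h x)\<^sup>2) \<partial>lborel) \<le>
    ennreal (r\<^sup>2) * (\<integral>\<^sup>+x. ennreal ((norm (grad h x))\<^sup>2) \<partial>lborel)"
proof -
  let ?vol = "measure lebesgue (ball (0::'a) r)"
  have vol: "?vol > 0" using content_ball_pos[OF r, of "0::'a"] by simp
  define D where "D = (\<integral>\<^sup>+x. ennreal ((norm (grad h x))\<^sup>2) \<partial>lborel)"
  have meas: "(\<lambda>(x, y). indicator (ball 0 r) y * ennreal ((h (x + y) - h x)\<^sup>2))
      \<in> borel_measurable (lborel \<Otimes>\<^sub>M lborel)"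
  proof -
    have B [measurable]: "ball (0::'a) r \<in> sets borel" by simp
    have "continuous_on UNIV (\<lambda>z::'a \<times> 'a. (h (fst z + snd z) - h (fst z))\<^sup>2)"
      by (intro continuous_intros continuous_on_compose2[OF continuous_smooth[OF h] _ subset_UNIV])
    then have "(\<lambda>z::'a \<times> 'a. (h (fst z + snd z) - h (fst z))\<^sup>2) \<in> borel_measurable borel"
      by (rule borel_measurable_continuous_onI)
    then have "(\<lambda>z::'a \<times> 'a. indicator (ball 0 r) (snd z) * ennreal ((h (fst z + snd z) - h (fst z))\<^sup>2))
        \<in> borel_measurable (borel \<Otimes>\<^sub>M borel)"
      unfolding borel_prod[symmetric] by measurable
    then show ?thesis
      by (simp add: case_prod_beta' cong: measurable_cong_sets sets_pair_measure_cong)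
  qed
  have "(\<integral>\<^sup>+x. ennreal ((ball_mean r h x - h x)\<^sup>2) \<partial>lborel) \<le> (\<integral>\<^sup>+x. ennreal (1 / ?vol) *
      (\<integral>\<^sup>+y. indicator (ball 0 r) y * ennreal ((h (x + y) - h x)\<^sup>2) \<partial>lborel) \<partial>lborel)"
  proof (rule nn_integral_mono)
    fix x
    have "(LINT y|lebesgue_on (ball (0::'a) r). h x) = ?vol * h x"
      by (simp add: measure_restrict_space)
    moreover have "(LINT y|lebesgue_on (ball 0 r). h (x + y) - h x) =
        (LINT y|lebesgue_on (ball 0 r). h (x + y)) - (LINT y|lebesgue_on (ball (0::'a) r). h x)"
      by (intro Bochner_Integration.integral_diff integrable_on_ball_continuous
          continuous_smooth_shift[OF h] continuous_on_const)
    ultimately have "ball_mean r h x - h x = (LINT y|lebesgue_on (ball 0 r). h (x + y) - h x) / ?vol"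
      using vol unfolding ball_mean_def by (simp only: diff_divide_distrib) simp
    then show "ennreal ((ball_mean r h x - h x)\<^sup>2) \<le> ennreal (1 / ?vol) *
      (\<integral>\<^sup>+y. indicator (ball 0 r) y * ennreal ((h (x + y) - h x)\<^sup>2) \<partial>lborel)"
      using mean_square_le[of "\<lambda>y. h (x + y) - h x" r] r by (simp add: continuous_on_diff continuous_smooth_shift[OF h])
  qed
  also have "\<dots> = ennreal (1 / ?vol) * (\<integral>\<^sup>+x.
      (\<integral>\<^sup>+y. indicator (ball 0 r) y * ennreal ((h (x + y) - h x)\<^sup>2) \<partial>lborel) \<partial>lborel)"
    using lborel.borel_measurable_nn_integral[OF meas] by (intro nn_integral_cmult) simp
  also have "(\<integral>\<^sup>+x. (\<integral>\<^sup>+y. indicator (ball 0 r) y * ennreal ((h (x + y) - h x)\<^sup>2) \<partial>lborel) \<partial>lborel) =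
     (\<integral>\<^sup>+y. (\<integral>\<^sup>+x. indicator (ball 0 r) y * ennreal ((h (x + y) - h x)\<^sup>2) \<partial>lborel) \<partial>lborel)"
    by (rule lborel_pair.Fubini'[OF meas, symmetric])
  also have "\<dots> \<le> (\<integral>\<^sup>+y. ennreal (r\<^sup>2) * D * indicator (ball (0::'a) r) y \<partial>lborel)"
  proof (rule nn_integral_mono)
    fix y :: 'a
    show "(\<integral>\<^sup>+x. indicator (ball 0 r) y * ennreal ((h (x + y) - h x)\<^sup>2) \<partial>lborel)
        \<le> ennreal (r\<^sup>2) * D * indicator (ball 0 r) y"
    proof (cases "y \<in> ball 0 r")
      case True
      have "(\<integral>\<^sup>+x. ennreal ((h (x + y) - h x)\<^sup>2) \<partial>lborel) \<le> ennreal ((norm y)\<^sup>2) * D"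
        unfolding D_def by (rule translation_estimate[OF h])
      also have "\<dots> \<le> ennreal (r\<^sup>2) * D"
        using True by (intro mult_right_mono ennreal_leI power_mono) auto
      finally show ?thesis using True by simp
    qed simp
  qed
  also have "\<dots> = ennreal (r\<^sup>2) * D * ennreal ?vol"
  proof -
    have "emeasure lborel (ball (0::'a) r) \<noteq> top"
      using emeasure_lborel_ball_finite[of "0::'a" r] by simp
    from emeasure_eq_ennreal_measure[OF this] show ?thesis
      by (subst nn_integral_cmult_indicator) (auto simp: measure_completion)
  qed
  finally have "(\<integral>\<^sup>+x. ennreal ((ball_mean r h x - h x)\<^sup>2) \<partial>lborel) \<le>
      ennreal (1 / ?vol) * (ennreal (r\<^sup>2) * D * ennreal ?vol)"
    by (simp add: mult_left_mono)
  also have "\<dots> = (ennreal (1 / ?vol) * ennreal ?vol) * (ennreal (r\<^sup>2) * D)" by (simp add: ac_simps)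
  also have "ennreal (1 / ?vol) * ennreal ?vol = 1" using vol by (simp add: ennreal_mult'[symmetric])
  finally show ?thesis by (simp add: D_def)
qed

lemma ball_mean_bound:
  fixes h :: "'a::euclidean_space \<Rightarrow> real"
  assumes h: "smooth h" and r: "r > 0"
  shows "ennreal ((ball_mean r h x)\<^sup>2) \<le> ennreal (1 / measure lebesgue (ball (0::'a) r)) * (\<integral>\<^sup>+x. ennreal ((h x)\<^sup>2) \<partial>lborel)"
proof -
  let ?vol = "measure lebesgue (ball (0::'a) r)"
  have vol: "?vol > 0" using content_ball_pos[OF r, of "0::'a"] by simp
  have "ennreal ((ball_mean r h x)\<^sup>2) \<le> ennreal (1 / ?vol) *
      (\<integral>\<^sup>+y. indicator (ball 0 r) y * ennreal ((h (x + y))\<^sup>2) \<partial>lborel)"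
    unfolding ball_mean_def by (intro mean_square_le continuous_smooth_shift[OF h] r)
  also have "\<dots> \<le> ennreal (1 / ?vol) * (\<integral>\<^sup>+y. ennreal ((h (x + y))\<^sup>2) \<partial>lborel)"
    by (intro mult_left_mono nn_integral_mono) (auto simp: indicator_def)
  also have "(\<integral>\<^sup>+y. ennreal ((h (x + y))\<^sup>2) \<partial>lborel) = (\<integral>\<^sup>+y. ennreal ((h y)\<^sup>2) \<partial>lborel)"
    using nn_integral_translation[of "\<lambda>y. ennreal ((h y)\<^sup>2)" x] smooth_measurable[OF h] by simp
  finally show ?thesis .
qed

lemma test_nn_integral:
  assumes "\<phi> \<in> test_functions (ball c r)"
  shows "(\<integral>\<^sup>+x. ennreal ((\<phi> x)\<^sup>2) \<partial>lborel) = ennreal ((L2norm (lebesgue_on (ball c r)) \<phi>)\<^sup>2)"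
    and "(\<integral>\<^sup>+x. ennreal ((norm (grad \<phi> x))\<^sup>2) \<partial>lborel) = ennreal ((L2norm (lebesgue_on (ball c r)) (grad \<phi>))\<^sup>2)"
proof -
  let ?M = "lebesgue_on (ball c r)"
  have "(\<integral>\<^sup>+x. ennreal ((\<phi> x)\<^sup>2) \<partial>lborel) = (\<integral>\<^sup>+x. ennreal ((\<phi> x)\<^sup>2) \<partial>?M)"
    using test_functions_outside[OF assms] by (subst nn_integral_lebesgue_on_eq) auto
  also have "\<dots> = ennreal ((L2norm ?M \<phi>)\<^sup>2)"
    using L2_test[OF assms] by (subst nn_integral_eq_integral) (auto simp: L2_def L2norm_sq)
  finally show "(\<integral>\<^sup>+x. ennreal ((\<phi> x)\<^sup>2) \<partial>lborel) = ennreal ((L2norm ?M \<phi>)\<^sup>2)" .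
  have "(\<integral>\<^sup>+x. ennreal ((norm (grad \<phi> x))\<^sup>2) \<partial>lborel) = (\<integral>\<^sup>+x. ennreal ((norm (grad \<phi> x))\<^sup>2) \<partial>?M)"
    using test_functions_outside[OF assms] by (subst nn_integral_lebesgue_on_eq) auto
  also have "\<dots> = ennreal ((L2norm ?M (grad \<phi>))\<^sup>2)"
    using L2_test[OF assms] by (subst nn_integral_eq_integral) (auto simp: L2_def L2norm_sq)
  finally show "(\<integral>\<^sup>+x. ennreal ((norm (grad \<phi> x))\<^sup>2) \<partial>lborel) = ennreal ((L2norm ?M (grad \<phi>))\<^sup>2)" .
qed

text \<open>For small radius the functions are close to their means, and by Arzela--Ascoli a subsequence of the
  means converges uniformly.\<close>

lemma small_oscillation_subsequence:
  fixes \<phi> :: "nat \<Rightarrow> 'a::euclidean_space \<Rightarrow> real"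
  assumes \<phi>: "\<And>k. \<phi> k \<in> test_functions (ball 0 1)"
    and C: "\<And>k. L2norm (lebesgue_on (ball 0 1)) (\<phi> k) \<le> C"
      "\<And>k. L2norm (lebesgue_on (ball 0 1)) (grad (\<phi> k)) \<le> C"
    and e: "e > 0"
  obtains r N where "strict_mono (r :: nat \<Rightarrow> nat)"
    "\<And>k l. k \<ge> N \<Longrightarrow> l \<ge> N \<Longrightarrow> L2norm (lebesgue_on (ball 0 1)) (\<lambda>x. \<phi> (r k) x - \<phi> (r l) x) < e"
proof -
  let ?M = "lebesgue_on (ball (0::'a) 1)"
  have C0: "0 \<le> C" using C(1)[of 0] L2norm_nonneg[of ?M "\<phi> 0"] by linarith
  \<comment> \<open>The radius is chosen so that functions and means differ by less than \<open>e / 4\<close> in mean.\<close>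
  define h where "h = e / (4 * (C + 1))"
  have h: "h > 0" "h * C < e / 4" using e C0 by (auto simp: h_def field_simps)
  let ?A = "\<lambda>k. ball_mean h (\<phi> k)"
  define V where "V = measure lebesgue (ball (0::'a) h)"
  have V: "V > 0" using content_ball_pos[OF h(1), of "0::'a"] by (simp add: V_def)
  have s: "smooth (\<phi> k)" for k using \<phi> by (rule test_functions_smooth)
  have sq: "(L2norm ?M (\<phi> k))\<^sup>2 \<le> C\<^sup>2" "(L2norm ?M (grad (\<phi> k)))\<^sup>2 \<le> C\<^sup>2" for k
    using C[of k] by (auto intro!: power_mono)
  have nn: "(\<integral>\<^sup>+x. ennreal ((\<phi> k x)\<^sup>2) \<partial>lborel) \<le> ennreal (C\<^sup>2)"
    "(\<integral>\<^sup>+x. ennreal ((norm (grad (\<phi> k) x))\<^sup>2) \<partial>lborel) \<le> ennreal (C\<^sup>2)" for k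
    unfolding test_nn_integral[OF \<phi>] by (intro ennreal_leI sq)+
  have Lip: "\<bar>?A k x - ?A k y\<bar> \<le> C / sqrt V * norm (x - y)" for k x y
  proof -
    have "ennreal ((?A k x - ?A k y)\<^sup>2) \<le> ennreal ((norm (x - y))\<^sup>2 / V) * ennreal (C\<^sup>2)"
      using order_trans[OF ball_mean_Lipschitz[OF s h(1), of k x y] mult_left_mono[OF nn(2)[of k]]]
      by (simp add: V_def)
    then have "(?A k x - ?A k y)\<^sup>2 \<le> (norm (x - y))\<^sup>2 / V * C\<^sup>2"
      using V by (simp add: ennreal_mult'[symmetric])
    also have "\<dots> = (C / sqrt V * norm (x - y))\<^sup>2"
      using V by (simp add: power_mult_distrib power_divide)
    finally show ?thesis
      using C0 V by (simp add: abs_le_square_iff[symmetric] abs_mult)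
  qed
  have bd: "\<bar>?A k x\<bar> \<le> C / sqrt V" for k x
  proof -
    have "ennreal ((?A k x)\<^sup>2) \<le> ennreal (1 / V) * ennreal (C\<^sup>2)"
      using order_trans[OF ball_mean_bound[OF s h(1), of k x] mult_left_mono[OF nn(1)[of k]]]
      by (simp add: V_def)
    then have "(?A k x)\<^sup>2 \<le> 1 / V * C\<^sup>2"
      using V by (simp add: ennreal_mult'[symmetric])
    also have "\<dots> = (C / sqrt V)\<^sup>2" using V by (simp add: power_divide)
    finally show ?thesis using C0 V by (simp add: abs_le_square_iff[symmetric])
  qed
  have Ac: "continuous_on UNIV (?A k)" for k
    by (rule lipschitz_on_continuous_on[of "C / sqrt V"])
      (use Lip C0 V in \<open>auto intro!: lipschitz_onI simp: dist_norm\<close>)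
  have AL: "L2 ?M (?A k)" for k
    by (rule L2_bounded[of _ _ "C / sqrt V"]) (auto intro!: continuous_measurable_lebesgue_on Ac bd)
  have close: "L2norm ?M (\<lambda>x. ?A k x - \<phi> k x) \<le> h * C" for k
  proof -
    have L: "L2 ?M (\<lambda>x. ?A k x - \<phi> k x)" by (intro L2_diff AL L2_test \<phi>)
    have "ennreal ((L2norm ?M (\<lambda>x. ?A k x - \<phi> k x))\<^sup>2) = (\<integral>\<^sup>+x. ennreal ((?A k x - \<phi> k x)\<^sup>2) \<partial>?M)"
      using L by (subst nn_integral_eq_integral) (auto simp: L2_def L2norm_sq)
    also have "\<dots> = (\<integral>\<^sup>+x. ennreal ((?A k x - \<phi> k x)\<^sup>2) * indicator (ball 0 1) x \<partial>lborel)"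
      by (subst nn_integral_restrict_space) (auto simp: nn_integral_completion)
    also have "\<dots> \<le> (\<integral>\<^sup>+x. ennreal ((?A k x - \<phi> k x)\<^sup>2) \<partial>lborel)"
      by (intro nn_integral_mono) (auto simp: indicator_def)
    also have "\<dots> \<le> ennreal (h\<^sup>2) * ennreal (C\<^sup>2)"
      using order_trans[OF ball_mean_close[OF s h(1), of k]
          mult_left_mono[OF nn(2)[of k]]] by simp
    also have "\<dots> = ennreal ((h * C)\<^sup>2)" by (simp add: ennreal_mult'[symmetric] power_mult_distrib)
    finally have "(L2norm ?M (\<lambda>x. ?A k x - \<phi> k x))\<^sup>2 \<le> (h * C)\<^sup>2" by simp
    then show ?thesis using h(1) C0 by (simp add: abs_le_square_iff[symmetric] abs_mult)
  qed
  have equi: "\<exists>c>0. \<forall>n y. y \<in> cball 0 1 \<and> norm (x - y) < c \<longrightarrow> norm (?A n x - ?A n y) < d"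
    if "d > 0" for x d
  proof -
    have p: "C / sqrt V + 1 > 0" "C / sqrt V \<ge> 0" using C0 V by (auto simp: add_nonneg_pos)
    have "norm (?A n x - ?A n y) < d" if "norm (x - y) < d / (C / sqrt V + 1)" for n y
    proof -
      have "norm (?A n x - ?A n y) \<le> C / sqrt V * norm (x - y)" using Lip by simp
      also have "\<dots> \<le> (C / sqrt V + 1) * norm (x - y)" by (intro mult_right_mono) auto
      also have "\<dots> < d" using that p(1) by (simp add: pos_less_divide_eq mult.commute)
      finally show ?thesis .
    qed
    moreover have "d / (C / sqrt V + 1) > 0" using p(1) \<open>d > 0\<close> by simp
    ultimately show ?thesis by blast
  qed
  define \<F> where "\<F> k = ?A k" for k
  have bd': "norm (\<F> k x) \<le> C / sqrt V" if "x \<in> cball 0 1" for k x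
    using bd by (simp add: \<F>_def)
  have equi': "\<exists>c. 0 < c \<and> (\<forall>n y. y \<in> cball 0 1 \<and> norm (x - y) < c \<longrightarrow> norm (\<F> n x - \<F> n y) < d)"
    if "x \<in> cball 0 1" "0 < d" for x d
    using equi[OF that(2), of x] unfolding \<F>_def .
  have "\<exists>g r. strict_mono (r :: nat \<Rightarrow> nat) \<and>
      (\<forall>e>0. \<exists>N. \<forall>n x. n \<ge> N \<and> x \<in> cball 0 1 \<longrightarrow> norm (\<F> (r n) x - g x) < e)"
  proof (rule Arzela_Ascoli[OF compact_cball bd' equi'], goal_cases)
    case (4 g k)
    have "strict_mono k \<and>
      (\<forall>e>0. \<exists>N. \<forall>n x. n \<ge> N \<and> x \<in> cball 0 1 \<longrightarrow> norm (\<F> (k n) x - g x) < e)"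
      using 4(2,3) by simp
    then have "\<exists>r. strict_mono (r :: nat \<Rightarrow> nat) \<and>
      (\<forall>e>0. \<exists>N. \<forall>n x. n \<ge> N \<and> x \<in> cball 0 1 \<longrightarrow> norm (\<F> (r n) x - g x) < e)"
      by (rule exI[where x = k])
    then show ?case by (rule exI[where x = g])
  qed
  then obtain g r where r: "strict_mono (r :: nat \<Rightarrow> nat)"
    and conv: "\<forall>e>0. \<exists>N. \<forall>n x. n \<ge> N \<and> x \<in> cball 0 1 \<longrightarrow> norm (\<F> (r n) x - g x) < e"
    by blast
  define W where "W = measure lebesgue (ball (0::'a) 1)"
  have W: "W > 0" using content_ball_pos[of 1 "0::'a"] by (simp add: W_def)
  define d where "d = e / (8 * sqrt W)"
  have d: "d > 0" using e W by (simp add: d_def)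
  obtain N where N: "\<And>n x. n \<ge> N \<Longrightarrow> x \<in> cball 0 1 \<Longrightarrow> norm (?A (r n) x - g x) < d"
    using conv[rule_format, OF d] unfolding \<F>_def by blast
  have "L2norm ?M (\<lambda>x. \<phi> (r k) x - \<phi> (r l) x) < e" if "k \<ge> N" "l \<ge> N" for k l
  proof -
    have one: "L2norm ?M (\<lambda>x. (2 * d) *\<^sub>R (1::real)) = 2 * d * sqrt W"
      using d by (subst L2norm_scaleR) (simp add: L2norm_def W_def measure_restrict_space)
    have "L2norm ?M (\<lambda>x. ?A (r k) x - ?A (r l) x) \<le> L2norm ?M (\<lambda>x. (2 * d) *\<^sub>R (1::real))"
    proof (rule L2norm_mono(2))
      show "AE x in ?M. norm (?A (r k) x - ?A (r l) x) \<le> norm ((2 * d) *\<^sub>R (1::real))"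
      proof (rule AE_I2)
        fix x assume "x \<in> space ?M"
        then have x: "x \<in> cball 0 1" by (simp add: space_restrict_space)
        show "norm (?A (r k) x - ?A (r l) x) \<le> norm ((2 * d) *\<^sub>R (1::real))"
          using N[OF that(1) x] N[OF that(2) x] by (simp add: abs_if split: if_splits)
      qed
      show "(\<lambda>x. ?A (r k) x - ?A (r l) x) \<in> borel_measurable ?M"
        by (rule L2_measurable[OF L2_diff[OF AL AL]])
      show "L2 ?M (\<lambda>x. (2 * d) *\<^sub>R (1::real))"
        by (rule L2_bounded[where C = "\<bar>2 * d\<bar>"]) auto
    qed
    also have "\<dots> = e / 4" unfolding one using W by (simp add: d_def)
    finally have 1: "L2norm ?M (\<lambda>x. ?A (r k) x - ?A (r l) x) \<le> e / 4" .
    have 2: "L2norm ?M (\<lambda>x. \<phi> (r k) x - \<phi> (r l) x) \<le>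
        L2norm ?M (\<lambda>x. \<phi> (r k) x - ?A (r k) x) + L2norm ?M (\<lambda>x. ?A (r k) x - \<phi> (r l) x)"
      by (intro L2norm_triangle_diff L2_test \<phi> AL)
    have 3: "L2norm ?M (\<lambda>x. ?A (r k) x - \<phi> (r l) x) \<le>
        L2norm ?M (\<lambda>x. ?A (r k) x - ?A (r l) x) + L2norm ?M (\<lambda>x. ?A (r l) x - \<phi> (r l) x)"
      by (intro L2norm_triangle_diff L2_test \<phi> AL)
    show ?thesis
      using e 1 2 3 close[of "r k"] close[of "r l"] h(2) L2norm_minus_commute[of ?M "\<phi> (r k)" "?A (r k)"] by linarith
  qed
  with r show ?thesis using that by blast
qed

text \<open>A diagonal sequence combines the subsequences belonging to smaller and smaller oscillations.\<close>

theorem Rellich: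
  fixes \<phi> :: "nat \<Rightarrow> 'a::euclidean_space \<Rightarrow> real"
  assumes \<phi>: "\<And>k. \<phi> k \<in> test_functions (ball 0 1)"
    and C: "\<And>k. L2norm (lebesgue_on (ball 0 1)) (\<phi> k) \<le> C"
      "\<And>k. L2norm (lebesgue_on (ball 0 1)) (grad (\<phi> k)) \<le> C"
  obtains r where "strict_mono (r :: nat \<Rightarrow> nat)"
    "\<And>e. e > 0 \<Longrightarrow> \<exists>N. \<forall>k\<ge>N. \<forall>l\<ge>N. L2norm (lebesgue_on (ball 0 1)) (\<lambda>x. \<phi> (r k) x - \<phi> (r l) x) < e"
proof -
  let ?M = "lebesgue_on (ball (0::'a) 1)"
  define P where "P n s \<longleftrightarrow> (\<exists>N. \<forall>k\<ge>N. \<forall>l\<ge>N. L2norm ?M (\<lambda>x. \<phi> (s k) x - \<phi> (s l) x) < 1 / real (Suc n))"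
    for n and s :: "nat \<Rightarrow> nat"
  interpret subseqs P
  proof
    fix n and s :: "nat \<Rightarrow> nat" assume "strict_mono s"
    obtain r N where "strict_mono (r :: nat \<Rightarrow> nat)"
      "\<And>k l. k \<ge> N \<Longrightarrow> l \<ge> N \<Longrightarrow> L2norm ?M (\<lambda>x. \<phi> (s (r k)) x - \<phi> (s (r l)) x) < 1 / real (Suc n)"
      by (rule small_oscillation_subsequence[of "\<lambda>k. \<phi> (s k)" C "1 / real (Suc n)"])
        (use \<phi> C in auto)
    then show "\<exists>r. strict_mono r \<and> P n (s \<circ> r)" unfolding P_def by (auto simp: o_def)
  qed
  have stable: "P n (s \<circ> r)" if r: "strict_mono r" and s: "P n s" for n and r s :: "nat \<Rightarrow> nat"
  proof -
    obtain N where N: "\<forall>k\<ge>N. \<forall>l\<ge>N. L2norm ?M (\<lambda>x. \<phi> (s k) x - \<phi> (s l) x) < 1 / real (Suc n)"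
      using s by (auto simp: P_def)
    have "r k \<ge> N" if "k \<ge> N" for k using that seq_suble[OF r, of k] by simp
    then show ?thesis using N unfolding P_def by (intro exI[of _ N]) auto
  qed
  show ?thesis
  proof (rule that[OF subseq_diagseq])
    fix e :: real assume "e > 0"
    then obtain n where n: "1 / real (Suc n) < e" using nat_approx_posE by blast
    obtain N where N: "\<forall>k\<ge>N. \<forall>l\<ge>N.
        L2norm ?M (\<lambda>x. \<phi> (diagseq (Suc n + k)) x - \<phi> (diagseq (Suc n + l)) x) < 1 / real (Suc n)"
      using diagseq_holds[of n, OF stable] by (auto simp: P_def)
    have "L2norm ?M (\<lambda>x. \<phi> (diagseq k) x - \<phi> (diagseq l) x) < e"
      if "k \<ge> Suc n + N" "l \<ge> Suc n + N" for k l
    proof -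
      have *: "N \<le> k - Suc n" "N \<le> l - Suc n" "Suc n + (k - Suc n) = k" "Suc n + (l - Suc n) = l"
        using that by auto
      show ?thesis using N[rule_format, OF *(1,2)] n unfolding *(3,4) by (rule less_trans)
    qed
    then show "\<exists>N. \<forall>k\<ge>N. \<forall>l\<ge>N. L2norm ?M (\<lambda>x. \<phi> (diagseq k) x - \<phi> (diagseq l) x) < e" by blast
  qed
qed

section \<open>Weak gradients on the unit ball\<close>

subsection \<open>Uniqueness\<close>

text \<open>Boxes generate the Borel sets and are stable under intersection, so the integral vanishes over every
  Borel set, in particular over \<open>{x. 0 < f x}\<close> and \<open>{x. f x < 0}\<close>.\<close>

lemma AE_zero_if_box_integrals_zero:
  fixes f :: "'a::euclidean_space \<Rightarrow> real"
  assumes f: "integrable lborel f" and box: "\<And>a b. (LINT x:box a b|lborel. f x) = 0"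
  shows "AE x in lborel. f x = 0"
proof -
  have fm [measurable]: "f \<in> borel_measurable borel" using f by auto
  have si: "set_integrable lborel A f" if "A \<in> sets borel" for A
    unfolding set_integrable_def using that f by (intro integrable_mult_indicator) auto
  have total: "(LINT x|lborel. f x) = 0"
  proof -
    have "(\<lambda>n. LINT x:box (- real n *\<^sub>R One) (real n *\<^sub>R One)|lborel. f x) \<longlonglongrightarrow> (LINT x|lborel. f x)"
      unfolding set_lebesgue_integral_def
    proof (rule integral_dominated_convergence[where w = "\<lambda>x. \<bar>f x\<bar>"])
      show "AE x in lborel. (\<lambda>n. indicator (box (- real n *\<^sub>R One) (real n *\<^sub>R One)) x *\<^sub>R f x) \<longlonglongrightarrow> f x"
      proof (rule AE_I2)
        fix x :: 'a
        obtain N where N: "norm x < real N" using reals_Archimedean2 by blast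
        have "x \<in> box (- real n *\<^sub>R One) (real n *\<^sub>R One)" if "n \<ge> N" for n
        proof -
          have "\<bar>x \<bullet> i\<bar> < real n" if "i \<in> Basis" for i
            using Basis_le_norm[OF that, of x] N \<open>n \<ge> N\<close> by linarith
          then show ?thesis by (force simp: mem_box inner_sum_left_Basis)
        qed
        then have "\<forall>\<^sub>F n in sequentially. indicator (box (- real n *\<^sub>R One) (real n *\<^sub>R One)) x *\<^sub>R f x = f x"
          by (intro eventually_sequentiallyI[of N]) simp
        then show "(\<lambda>n. indicator (box (- real n *\<^sub>R One) (real n *\<^sub>R One)) x *\<^sub>R f x) \<longlonglongrightarrow> f x"
          by (rule tendsto_eventually)
      qed
    qed (use f in \<open>auto simp: indicator_def\<close>)
    then show ?thesis using box by (simp add: LIMSEQ_const_iff)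
  qed
  have all: "(LINT x:A|lborel. f x) = 0" if "A \<in> sets borel" for A :: "'a set"
  proof -
    have "Int_stable (range (\<lambda>(a, b). box a b :: 'a set))"
      by (auto simp: Int_stable_def box_Int_box)
    moreover have "range (\<lambda>(a, b). box a b :: 'a set) \<subseteq> Pow UNIV" by simp
    moreover have "A \<in> sigma_sets UNIV (range (\<lambda>(a, b). box a b))"
      using that by (simp add: borel_eq_box)
    ultimately show ?thesis
    proof (induction rule: sigma_sets_induct_disjoint)
      case (basic A)
      then show ?case using box by auto
    next
      case empty
      show ?case by (simp add: set_lebesgue_integral_def)
    next
      case (compl A)
      then have A: "A \<in> sets borel" by (simp add: borel_eq_box)
      have "(LINT x:A \<union> (UNIV - A)|lborel. f x) = (LINT x:A|lborel. f x) + (LINT x:UNIV - A|lborel. f x)"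
        using A by (intro set_integral_Un si) auto
      then show ?case using total compl by (simp add: set_lebesgue_integral_def)
    next
      case (union F)
      then have F: "F i \<in> sets borel" for i by (auto simp: borel_eq_box)
      have "(LINT x:(\<Union>i. F i)|lborel. f x) = (\<Sum>i. LINT x:F i|lborel. f x)"
        using F union(1) by (intro lebesgue_integral_countable_add si) (auto simp: disjoint_family_on_def)
      then show ?case using union by simp
    qed
  qed
  have "AE x in lborel. f x \<le> 0"
  proof -
    have "(LINT x|lborel. indicator {x. 0 < f x} x *\<^sub>R f x) = 0"
      using all[of "{x. 0 < f x}"] by (simp add: set_lebesgue_integral_def)
    then have "AE x in lborel. indicator {x. 0 < f x} x *\<^sub>R f x = 0"
      using si[of "{x. 0 < f x}"]
      by (subst (asm) integral_nonneg_eq_0_iff_AE) (auto simp: set_integrable_def indicator_def)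
    then show ?thesis by eventually_elim (auto simp: indicator_def split: if_splits)
  qed
  moreover have "AE x in lborel. f x \<ge> 0"
  proof -
    have "(LINT x|lborel. indicator {x. f x < 0} x *\<^sub>R f x) = 0"
      using all[of "{x. f x < 0}"] by (simp add: set_lebesgue_integral_def)
    then have "(LINT x|lborel. - (indicator {x. f x < 0} x *\<^sub>R f x)) = 0" by simp
    then have "AE x in lborel. - (indicator {x. f x < 0} x *\<^sub>R f x) = 0"
      using si[of "{x. f x < 0}"]
      by (subst (asm) integral_nonneg_eq_0_iff_AE) (auto simp: set_integrable_def indicator_def)
    then show ?thesis by eventually_elim (auto simp: indicator_def split: if_splits)
  qed
  ultimately show ?thesis by eventually_elim simp
qed

text \<open>Products of the functions \<open>bump (m s)\<close>, which increase to the indicator of \<open>{s. 0 < s}\<close> as \<open>m\<close> grows.\<close>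

lemma smooth_box_approximation:
  fixes a b :: "'a::euclidean_space"
  obtains \<psi> :: "nat \<Rightarrow> 'a \<Rightarrow> real" where "\<And>m. smooth (\<psi> m)" "\<And>m x. \<bar>\<psi> m x\<bar> \<le> 1"
    "\<And>x. (\<lambda>m. \<psi> m x) \<longlonglongrightarrow> indicator (box a b) x"
proof
  define \<psi> where "\<psi> m x = (\<Prod>i\<in>Basis. bump (real m * (x \<bullet> i - a \<bullet> i)) * bump (real m * (b \<bullet> i - x \<bullet> i)))"
    for m :: nat and x
  show "smooth (\<psi> m)" for m
    unfolding \<psi>_def
    by (intro smooth_prod smooth_mult smooth_flat smooth_diff smooth_const smooth_inner)
  show "\<bar>\<psi> m x\<bar> \<le> 1" for m x
  proof -
    have "0 \<le> \<psi> m x" unfolding \<psi>_def by (intro prod_nonneg mult_nonneg_nonneg bump_nonneg ballI)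
    moreover have "\<psi> m x \<le> 1" unfolding \<psi>_def
      by (intro prod_le_1 conjI mult_le_one mult_nonneg_nonneg bump_nonneg bump_le_1)
    ultimately show ?thesis by simp
  qed
  have lim: "(\<lambda>m. bump (real m * s)) \<longlonglongrightarrow> (if s > 0 then 1 else 0)" for s
  proof (cases "s > 0")
    case True
    have "(\<lambda>m. exp (- (1 / s * inverse (real m)))) \<longlonglongrightarrow> exp (- (1 / s * 0))"
      by (intro tendsto_intros LIMSEQ_inverse_real_of_nat_add[where ?r = 0, simplified] lim_inverse_n)
    moreover have "\<forall>\<^sub>F m in sequentially. exp (- (1 / s * inverse (real m))) = bump (real m * s)"
    proof (rule eventually_sequentiallyI[of 1])
      fix m :: nat assume "1 \<le> m"
      then have "real m * s > 0" using True by simp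
      then show "exp (- (1 / s * inverse (real m))) = bump (real m * s)"
        by (simp add: bump_eq inverse_eq_divide mult.commute)
    qed
    ultimately show ?thesis using True by (simp add: Lim_transform_eventually)
  next
    case False
    then have "bump (real m * s) = 0" for m by (simp add: bump_zero_iff mult_nonneg_nonpos)
    then show ?thesis using False by simp
  qed
  show "(\<lambda>m. \<psi> m x) \<longlonglongrightarrow> indicator (box a b) x" for x
  proof -
    have "(\<lambda>m. \<psi> m x) \<longlonglongrightarrow> (\<Prod>i\<in>Basis. (if x \<bullet> i - a \<bullet> i > 0 then 1 else 0) * (if b \<bullet> i - x \<bullet> i > 0 then 1 else 0))"
      unfolding \<psi>_def by (intro tendsto_intros lim)
    moreover have "(\<Prod>i\<in>Basis. (if x \<bullet> i - a \<bullet> i > 0 then 1 else 0) * (if b \<bullet> i - x \<bullet> i > 0 then 1 else (0::real)))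
        = indicator (box a b) x"
    proof (cases "x \<in> box a b")
      case True
      then show ?thesis by (auto simp: mem_box intro!: prod.neutral)
    next
      case False
      then obtain i where "i \<in> Basis" "\<not> (a \<bullet> i < x \<bullet> i \<and> x \<bullet> i < b \<bullet> i)" by (auto simp: mem_box)
      then show ?thesis using False by (subst prod_zero) (auto intro!: bexI[of _ i])
    qed
    ultimately show ?thesis by simp
  qed
qed

lemma integrable_times_supported:
  fixes u :: "'a::euclidean_space \<Rightarrow> 'b::euclidean_space" and w :: "'a \<Rightarrow> real"
  assumes u: "integrable (lebesgue_on K) u" and K: "compact K" "K \<subseteq> \<Omega>" "\<Omega> \<in> sets borel"
    and w: "continuous_on UNIV w" "\<And>x. x \<notin> K \<Longrightarrow> w x = 0"
  shows "integrable (lebesgue_on \<Omega>) (\<lambda>x. w x *\<^sub>R u x)" "integrable lebesgue (\<lambda>x. w x *\<^sub>R u x)"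
    "(LINT x|lebesgue_on \<Omega>. w x *\<^sub>R u x) = (LINT x|lebesgue. w x *\<^sub>R u x)"
proof -
  have Ks: "K \<in> sets lebesgue" "\<Omega> \<in> sets lebesgue" using K by (auto simp: compact_imp_closed)
  obtain C where C: "\<And>x. norm (w x) \<le> C"
    using continuous_compact_support_bounded[OF w(1) K(1) w(2)] by blast
  define v where "v x = (if x \<in> K then u x else 0)" for x
  have v: "integrable lebesgue v" unfolding v_def using u by (simp add: Lebesgue_Measure.integrable_restrict_UNIV[OF Ks(1)])
  have wm: "w \<in> borel_measurable lebesgue"
    using w(1) by (simp add: borel_measurable_continuous_onI measurable_completion)
  have eq: "w x *\<^sub>R u x = w x *\<^sub>R v x" for x using w(2) by (simp add: v_def)
  show I: "integrable lebesgue (\<lambda>x. w x *\<^sub>R u x)"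
    unfolding eq
  proof (rule Bochner_Integration.integrable_bound)
    show "integrable lebesgue (\<lambda>x. C *\<^sub>R v x)" using v by simp
    show "(\<lambda>x. w x *\<^sub>R v x) \<in> borel_measurable lebesgue" using wm v by measurable
    show "AE x in lebesgue. norm (w x *\<^sub>R v x) \<le> norm (C *\<^sub>R v x)"
      using C by (intro AE_I2) (auto intro!: mult_right_mono intro: order_trans[OF _ abs_ge_self])
  qed
  have ind: "(\<lambda>x. indicator \<Omega> x *\<^sub>R (w x *\<^sub>R u x)) = (\<lambda>x. w x *\<^sub>R u x)"
    using w(2) K(2) by (auto simp: fun_eq_iff indicator_def)
  show "integrable (lebesgue_on \<Omega>) (\<lambda>x. w x *\<^sub>R u x)"
    using I Ks by (subst integrable_restrict_space) (auto simp: ind simp del: scaleR_scaleR)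
  show "(LINT x|lebesgue_on \<Omega>. w x *\<^sub>R u x) = (LINT x|lebesgue. w x *\<^sub>R u x)"
    using Ks by (subst integral_restrict_space) (auto simp: ind simp del: scaleR_scaleR)
qed

definition ball_cutoff :: "real \<Rightarrow> 'a::euclidean_space \<Rightarrow> real" where
  "ball_cutoff r x = bump (r\<^sup>2 - (norm x)\<^sup>2)"

lemma ball_cutoff:
  assumes "0 < r" "r < 1"
  shows "smooth (ball_cutoff r)" "x \<notin> cball 0 r \<Longrightarrow> ball_cutoff r x = 0" "x \<in> ball 0 r \<Longrightarrow> ball_cutoff r x > 0"
proof -
  show "smooth (ball_cutoff r)"
    unfolding ball_cutoff_def by (intro smooth_flat smooth_diff smooth_const smooth_norm_sq)
  show "ball_cutoff r x = 0" if "x \<notin> cball 0 r"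
    using that assms power_mono[of r "norm x" 2] by (simp add: ball_cutoff_def bump_zero_iff)
  show "ball_cutoff r x > 0" if "x \<in> ball 0 r"
    using that assms power_strict_mono[of "norm x" r 2] by (simp add: ball_cutoff_def bump_pos_iff)
qed

text \<open>The fundamental lemma of the calculus of variations. After multiplication by a cutoff, smooth
  functions approximating the indicator of any box become admissible.\<close>

lemma fundamental_lemma:
  fixes d :: "'a::euclidean_space \<Rightarrow> real"
  assumes d: "\<And>K. compact K \<Longrightarrow> K \<subseteq> ball 0 1 \<Longrightarrow> integrable (lebesgue_on K) d"
    and 0: "\<And>\<phi>. \<phi> \<in> test_functions (ball 0 1) \<Longrightarrow> (LINT x|lebesgue_on (ball 0 1). \<phi> x * d x) = 0"
  shows "AE x in lebesgue_on (ball 0 1). d x = 0"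
proof -
  have loc: "AE x in lebesgue. x \<in> ball 0 r \<longrightarrow> d x = 0" if r: "0 < r" "r < 1" for r
  proof -
    define e where "e x = ball_cutoff r x * d x" for x
    have sub: "cball 0 r \<subseteq> ball (0::'a) 1" using r by auto
    note \<chi> = ball_cutoff[OF r]
    have supp: "integrable lebesgue (\<lambda>x. w x * e x)"
        "(LINT x|lebesgue. w x * e x) = (LINT x|lebesgue_on (ball 0 1). (w x * ball_cutoff r x) * d x)"
      if "smooth w" for w
    proof -
      have c: "continuous_on UNIV (\<lambda>x. w x * ball_cutoff r x)"
        by (intro continuous_smooth smooth_mult that \<chi>)
      have z: "w x * ball_cutoff r x = 0" if "x \<notin> cball 0 r" for x using \<chi>(2)[OF that] by simp
      show "integrable lebesgue (\<lambda>x. w x * e x)"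
        "(LINT x|lebesgue. w x * e x) = (LINT x|lebesgue_on (ball 0 1). (w x * ball_cutoff r x) * d x)"
        using integrable_times_supported(2,3)[OF d[OF compact_cball sub] compact_cball sub _ c z]
        by (simp_all add: e_def mult.assoc)
    qed
    have ei: "integrable lebesgue e" using supp(1)[OF smooth_const[of 1]] by simp
    have zero: "(LINT x|lebesgue. w x * e x) = 0" if "smooth w" for w
    proof -
      have "(\<lambda>x. w x * ball_cutoff r x) \<in> test_functions (ball 0 1)"
        by (rule test_functionsI[of _ "cball 0 r"]) (use r \<chi> in \<open>auto intro!: smooth_mult that\<close>)
      then show ?thesis using 0 supp(2)[OF that] by simp
    qed
    obtain f where f: "f \<in> borel_measurable lborel" "AE x in lborel. e x = f x"
      using completion_ex_borel_measurable_real[of e lborel] ei by auto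
    have ae: "AE x in lebesgue. e x = f x" using f(2) by (rule AE_completion)
    have fm: "f \<in> borel_measurable lebesgue" using f(1) by (rule measurable_completion)
    have fi: "integrable lebesgue f" using ei fm ae by (rule integrable_cong_AE_imp)
    have "AE x in lborel. f x = 0"
    proof (rule AE_zero_if_box_integrals_zero)
      show "integrable lborel f" using fi f(1) by (simp add: integrable_completion)
      fix a b :: 'a
      obtain \<psi> :: "nat \<Rightarrow> 'a \<Rightarrow> real" where \<psi>: "\<And>m. smooth (\<psi> m)" "\<And>m x. \<bar>\<psi> m x\<bar> \<le> 1"
        "\<And>x. (\<lambda>m. \<psi> m x) \<longlonglongrightarrow> indicator (box a b) x" using smooth_box_approximation by blast
      have "(\<lambda>m. LINT x|lebesgue. \<psi> m x * e x) \<longlonglongrightarrow> (LINT x|lebesgue. indicator (box a b) x * e x)"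
      proof (rule integral_dominated_convergence[where w = "\<lambda>x. \<bar>e x\<bar>"])
        show "(\<lambda>x. indicator (box a b) x * e x) \<in> borel_measurable lebesgue"
          using ei by (intro borel_measurable_times borel_measurable_indicator) auto
        show "(\<lambda>x. \<psi> m x * e x) \<in> borel_measurable lebesgue" for m
          using supp(1)[OF \<psi>(1)] by auto
        show "AE x in lebesgue. (\<lambda>m. \<psi> m x * e x) \<longlonglongrightarrow> indicator (box a b) x * e x"
          by (intro AE_I2 tendsto_intros \<psi>)
        show "AE x in lebesgue. norm (\<psi> m x * e x) \<le> \<bar>e x\<bar>" for m
          using \<psi>(2) by (intro AE_I2) (simp add: abs_mult mult_left_le_one_le)
      qed (use ei in auto)
      then have "(LINT x|lebesgue. indicator (box a b) x * e x) = 0"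
        using zero[OF \<psi>(1)] by (simp add: LIMSEQ_const_iff)
      also have "(LINT x|lebesgue. indicator (box a b) x * e x) = (LINT x|lebesgue. indicator (box a b) x * f x)"
        using ae ei fm
        by (intro integral_cong_AE borel_measurable_times borel_measurable_indicator) auto
      also have "\<dots> = (LINT x|lborel. indicator (box a b) x * f x)"
        using f(1) by (intro integral_completion borel_measurable_times borel_measurable_indicator) auto
      finally show "(LINT x:box a b|lborel. f x) = 0" by (simp add: set_lebesgue_integral_def)
    qed
    from AE_completion[OF this] ae show ?thesis
      by eventually_elim (use \<chi>(3) in \<open>force simp: e_def\<close>)
  qed
  have "AE x in lebesgue. \<forall>n. x \<in> ball 0 (1 - 1 / real (n + 2)) \<longrightarrow> d x = 0"
    unfolding AE_all_countable by (intro allI loc) (auto simp: field_simps)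
  then have "AE x in lebesgue. x \<in> ball 0 1 \<longrightarrow> d x = 0"
  proof eventually_elim
    case (elim x)
    show ?case
    proof
      assume "x \<in> ball 0 1"
      then have "1 - norm x > 0" by simp
      then obtain n where "1 / real (Suc n) < 1 - norm x" using nat_approx_posE by blast
      moreover have "1 / real (n + 2) \<le> 1 / real (Suc n)" by (simp add: field_simps)
      ultimately have "x \<in> ball 0 (1 - 1 / real (n + 2))" by simp
      then show "d x = 0" using elim by blast
    qed
  qed
  then show ?thesis by (subst AE_restrict_space_iff) auto
qed

lemma has_weak_gradient_components:
  fixes u :: "'a::euclidean_space \<Rightarrow> real"
  assumes "has_weak_gradient u g (ball 0 1)" "\<phi> \<in> test_functions (ball 0 1)"
  shows "integrable (lebesgue_on (ball 0 1)) (\<lambda>x. u x * (grad \<phi> x \<bullet> i))"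
    "integrable (lebesgue_on (ball 0 1)) (\<lambda>x. (g x \<bullet> i) * \<phi> x)"
    "i \<in> Basis \<Longrightarrow> (LINT x|lebesgue_on (ball 0 1). u x * (grad \<phi> x \<bullet> i)) =
        - (LINT x|lebesgue_on (ball 0 1). (g x \<bullet> i) * \<phi> x)"
proof -
  obtain K where K: "smooth \<phi>" "compact K" "K \<subseteq> ball 0 1" "\<And>x. x \<notin> K \<Longrightarrow> \<phi> x = 0"
    "\<And>x. x \<notin> K \<Longrightarrow> grad \<phi> x = 0" by (rule test_functionsE[OF assms(2)]) (rule that)
  have I: "integrable (lebesgue_on K) u" "integrable (lebesgue_on K) g"
    using assms(1) K(2,3) by (auto simp: has_weak_gradient_def)
  have c: "continuous_on UNIV (\<lambda>x. grad \<phi> x \<bullet> i)" "continuous_on UNIV \<phi>"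
    by (intro continuous_on_inner continuous_grad continuous_smooth continuous_on_const K(1))+
  show "integrable (lebesgue_on (ball 0 1)) (\<lambda>x. u x * (grad \<phi> x \<bullet> i))"
    using integrable_times_supported(1)[OF I(1) K(2,3) _ c(1)] K(5) by (simp add: mult.commute)
  have "integrable (lebesgue_on (ball 0 1)) (\<lambda>x. \<phi> x *\<^sub>R g x)"
    using integrable_times_supported(1)[OF I(2) K(2,3) _ c(2)] K(4) by simp
  from integrable_inner_left[OF this, of i]
  show "integrable (lebesgue_on (ball 0 1)) (\<lambda>x. (g x \<bullet> i) * \<phi> x)" by (simp add: mult.commute)
  have "\<forall>\<phi>\<in>test_functions (ball 0 1). \<forall>i\<in>Basis.
      (LINT x|lebesgue_on (ball 0 1). u x * frechet_derivative \<phi> (at x) i) =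
      - (LINT x|lebesgue_on (ball 0 1). (g x \<bullet> i) * \<phi> x)"
    using assms(1) by (simp add: has_weak_gradient_def)
  from bspec[OF this assms(2)]
  show "i \<in> Basis \<Longrightarrow> (LINT x|lebesgue_on (ball 0 1). u x * (grad \<phi> x \<bullet> i)) =
        - (LINT x|lebesgue_on (ball 0 1). (g x \<bullet> i) * \<phi> x)"
    by (simp add: frechet_eq_grad[OF K(1)])
qed

lemma has_weak_gradient_unique:
  fixes u :: "'a::euclidean_space \<Rightarrow> real"
  assumes g: "has_weak_gradient u g (ball 0 1)" and h: "has_weak_gradient u h (ball 0 1)"
  shows "AE x in lebesgue_on (ball 0 1). g x = h x"
proof -
  have "AE x in lebesgue_on (ball 0 1). (g x - h x) \<bullet> i = 0" if i: "i \<in> Basis" for i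
  proof (rule fundamental_lemma)
    fix K :: "'a set" assume "compact K" "K \<subseteq> ball 0 1"
    then have "integrable (lebesgue_on K) g" "integrable (lebesgue_on K) h"
      using g h by (auto simp: has_weak_gradient_def)
    then show "integrable (lebesgue_on K) (\<lambda>x. (g x - h x) \<bullet> i)" by simp
  next
    fix \<phi> :: "'a \<Rightarrow> real" assume \<phi>: "\<phi> \<in> test_functions (ball 0 1)"
    have "(LINT x|lebesgue_on (ball 0 1). \<phi> x * ((g x - h x) \<bullet> i)) =
      (LINT x|lebesgue_on (ball 0 1). (g x \<bullet> i) * \<phi> x - (h x \<bullet> i) * \<phi> x)"
      by (intro Bochner_Integration.integral_cong) (auto simp: inner_diff_left algebra_simps)
    then show "(LINT x|lebesgue_on (ball 0 1). \<phi> x * ((g x - h x) \<bullet> i)) = 0"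
      using has_weak_gradient_components[OF g \<phi>, of i] has_weak_gradient_components[OF h \<phi>, of i] i
      by simp
  qed
  then have "AE x in lebesgue_on (ball 0 1). \<forall>i\<in>Basis. (g x - h x) \<bullet> i = 0"
    by (subst AE_finite_all) auto
  then show ?thesis
    by eventually_elim (metis (no_types) euclidean_all_zero_iff right_minus_eq)
qed

lemma has_weak_gradient_diff:
  assumes g: "has_weak_gradient u g (ball 0 1)" and h: "has_weak_gradient v h (ball 0 1)"
  shows "has_weak_gradient (\<lambda>x. u x - v x) (\<lambda>x. g x - h x) (ball 0 1)"
  unfolding has_weak_gradient_def
proof (intro conjI allI impI ballI)
  fix \<phi> :: "'a \<Rightarrow> real" and i :: 'a assume \<phi>: "\<phi> \<in> test_functions (ball 0 1)" and i: "i \<in> Basis"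
  show "(LINT x|lebesgue_on (ball 0 1). (u x - v x) * frechet_derivative \<phi> (at x) i) =
      - (LINT x|lebesgue_on (ball 0 1). (g x - h x) \<bullet> i * \<phi> x)"
    using has_weak_gradient_components[OF g \<phi>, of i] has_weak_gradient_components[OF h \<phi>, of i] i
    by (simp add: frechet_eq_grad[OF test_functions_smooth[OF \<phi>]] left_diff_distrib inner_diff_left)
qed (use g h in \<open>auto simp: has_weak_gradient_def\<close>)

text \<open>A weak gradient is only assumed integrable on compact sets; exhausting the ball by closed balls makes
  it measurable on the whole ball.\<close>

lemma has_weak_gradient_measurable:
  fixes u :: "'a::euclidean_space \<Rightarrow> real"
  assumes "has_weak_gradient u g (ball 0 1)"
  shows "g \<in> borel_measurable (lebesgue_on (ball 0 1))"
proof (rule borel_measurable_LIMSEQ_metric)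
  define r where "r n = 1 - 1 / real (n + 2)" for n :: nat
  define h where "h n x = (if x \<in> cball 0 (r n) then g x else 0)" for n x
  show "h n \<in> borel_measurable (lebesgue_on (ball 0 1))" for n
  proof -
    have "r n < 1" by (simp add: r_def)
    then have "cball 0 (r n) \<subseteq> ball (0::'a) 1" by auto
    then have "integrable (lebesgue_on (cball 0 (r n))) g"
      using assms by (auto simp: has_weak_gradient_def)
    then have "integrable lebesgue (h n)" unfolding h_def by (subst Lebesgue_Measure.integrable_restrict_UNIV) auto
    then have "h n \<in> borel_measurable lebesgue" by auto
    then show ?thesis by (rule measurable_restrict_space1)
  qed
  fix x :: 'a assume "x \<in> space (lebesgue_on (ball 0 1))"
  then have "norm x < 1" by (simp add: space_restrict_space)
  then obtain N where N: "1 / real (Suc N) < 1 - norm x" using nat_approx_posE[of "1 - norm x"] by auto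
  have "h n x = g x" if "n \<ge> N" for n
  proof -
    have "1 / real (n + 2) \<le> 1 / real (Suc N)" using that by (intro divide_left_mono) auto
    then show ?thesis using N by (simp add: h_def r_def)
  qed
  then have "\<forall>\<^sub>F n in sequentially. h n x = g x" by (intro eventually_sequentiallyI[of N]) simp
  then show "(\<lambda>n. h n x) \<longlonglongrightarrow> g x" by (rule tendsto_eventually)
qed

lemma weak_grad_AE:
  fixes u :: "'a::euclidean_space \<Rightarrow> real"
  assumes "has_weak_gradient u g (ball 0 1)"
  shows "has_weak_gradient u (weak_grad (ball 0 1) u) (ball 0 1)"
    "AE x in lebesgue_on (ball 0 1). weak_grad (ball 0 1) u x = g x"
proof -
  show "has_weak_gradient u (weak_grad (ball 0 1) u) (ball 0 1)"
    unfolding weak_grad_def by (rule someI[of "\<lambda>g. has_weak_gradient u g (ball 0 1)", OF assms])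
  from has_weak_gradient_unique[OF this assms]
  show "AE x in lebesgue_on (ball 0 1). weak_grad (ball 0 1) u x = g x" .
qed

subsection \<open>Approximation by test functions\<close>

text \<open>\<open>H10_approx \<phi> u g\<close>: the test functions \<open>\<phi> k\<close> converge to \<open>u\<close> in mean and their gradients
  converge to \<open>g\<close>. This describes the elements of the Sobolev space together with their gradients
  without reference to the choice operator.\<close>

definition H10_approx :: "(nat \<Rightarrow> 'a::euclidean_space \<Rightarrow> real) \<Rightarrow> ('a \<Rightarrow> real) \<Rightarrow> ('a \<Rightarrow> 'a) \<Rightarrow> bool" where
  "H10_approx \<phi> u g \<longleftrightarrow> (\<forall>k. \<phi> k \<in> test_functions (ball 0 1)) \<and>
     L2lim (lebesgue_on (ball 0 1)) \<phi> u \<and> L2lim (lebesgue_on (ball 0 1)) (\<lambda>k. grad (\<phi> k)) g"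

lemma H10_approxD:
  assumes "H10_approx \<phi> u g"
  shows "\<phi> k \<in> test_functions (ball 0 1)" "L2lim (lebesgue_on (ball 0 1)) \<phi> u"
    "L2lim (lebesgue_on (ball 0 1)) (\<lambda>k. grad (\<phi> k)) g"
    "L2 (lebesgue_on (ball 0 1)) u" "L2 (lebesgue_on (ball 0 1)) g"
  using assms by (auto simp: H10_approx_def L2lim_def)

lemma integrable_lebesgue_on_subset:
  fixes u :: "'a::euclidean_space \<Rightarrow> 'b::euclidean_space"
  assumes "integrable (lebesgue_on \<Omega>) u" "K \<subseteq> \<Omega>" "K \<in> sets lebesgue" "\<Omega> \<in> sets lebesgue"
  shows "integrable (lebesgue_on K) u"
proof -
  have "integrable lebesgue (\<lambda>x. if x \<in> \<Omega> then u x else 0)"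
    using assms by (simp only: Lebesgue_Measure.integrable_restrict_UNIV)
  then have "integrable lebesgue (\<lambda>x. indicator K x *\<^sub>R (if x \<in> \<Omega> then u x else 0))"
    by (intro integrable_mult_indicator assms)
  moreover have "(\<lambda>x. indicator K x *\<^sub>R (if x \<in> \<Omega> then u x else 0)) = (\<lambda>x. if x \<in> K then u x else 0)"
    using assms(2) by (auto simp: fun_eq_iff indicator_def)
  ultimately show ?thesis using assms by (simp only: Lebesgue_Measure.integrable_restrict_UNIV)
qed

lemma H10_approx_has_weak_gradient:
  assumes "H10_approx \<phi> u g"
  shows "has_weak_gradient u g (ball 0 1)"
  unfolding has_weak_gradient_def
proof (intro conjI allI impI ballI)
  note D = H10_approxD[OF assms]
  fix K :: "'a set" assume K: "compact K \<and> K \<subseteq> ball 0 1"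
  then have "K \<in> sets lebesgue" by (simp add: compact_imp_closed)
  moreover have "integrable (lebesgue_on (ball 0 1)) u" "integrable (lebesgue_on (ball 0 1)) g"
    by (intro L2_integrable finite_measure_ball D)+
  ultimately show "integrable (lebesgue_on K) u" "integrable (lebesgue_on K) g"
    using K by (auto intro: integrable_lebesgue_on_subset)
next
  note D = H10_approxD[OF assms]
  let ?M = "lebesgue_on (ball (0::'a) 1)"
  fix \<psi> :: "'a \<Rightarrow> real" and i :: 'a assume \<psi>: "\<psi> \<in> test_functions (ball 0 1)" and i: "i \<in> Basis"
  have "L2 ?M (\<lambda>x. grad \<psi> x \<bullet> i)"
    by (rule L2norm_mono(1)[OF _ L2_test(2)[OF \<psi>]])
      (use L2_test(2)[OF \<psi>] Basis_le_norm[OF i] in \<open>auto simp: L2_def\<close>)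
  from L2lim_inner[OF D(2) this]
  have 1: "(\<lambda>k. LINT x|?M. \<phi> k x * (grad \<psi> x \<bullet> i)) \<longlonglongrightarrow> (LINT x|?M. u x * (grad \<psi> x \<bullet> i))" by simp
  have "L2 ?M (\<lambda>x. \<psi> x *\<^sub>R i)"
    by (rule L2norm_mono(1)[OF _ L2_test(1)[OF \<psi>]]) (use i L2_test(1)[OF \<psi>] in \<open>auto simp: L2_def\<close>)
  from L2lim_inner[OF D(3) this]
  have 2: "(\<lambda>k. LINT x|?M. (grad (\<phi> k) x \<bullet> i) * \<psi> x) \<longlonglongrightarrow> (LINT x|?M. (g x \<bullet> i) * \<psi> x)"
    by (simp add: mult.commute)
  have "(LINT x|?M. \<phi> k x * (grad \<psi> x \<bullet> i)) = - (LINT x|?M. (grad (\<phi> k) x \<bullet> i) * \<psi> x)" for k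
    by (intro integration_by_parts_test D \<psi> i) auto
  with 1 have "(\<lambda>k. - (LINT x|?M. (grad (\<phi> k) x \<bullet> i) * \<psi> x)) \<longlonglongrightarrow> (LINT x|?M. u x * (grad \<psi> x \<bullet> i))"
    by simp
  from LIMSEQ_unique[OF this tendsto_minus[OF 2]]
  show "(LINT x|?M. u x * frechet_derivative \<psi> (at x) i) = - (LINT x|?M. (g x \<bullet> i) * \<psi> x)"
    by (simp add: frechet_eq_grad[OF test_functions_smooth[OF \<psi>]])
qed

lemma Lp_space_2_iff: "u \<in> Lp_space 2 \<Omega> \<longleftrightarrow> L2 (lebesgue_on \<Omega>) u"
  by (simp add: Lp_space_def L2_def)

lemma test_has_weak_gradient:
  assumes "\<phi> \<in> test_functions (ball 0 1)"
  shows "has_weak_gradient \<phi> (grad \<phi>) (ball 0 1)"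
proof (rule H10_approx_has_weak_gradient)
  show "H10_approx (\<lambda>_. \<phi>) \<phi> (grad \<phi>)"
    using assms by (auto simp: H10_approx_def intro: L2lim_const L2_test)
qed

text \<open>Uniqueness replaces the gradient chosen inside \<open>H1_norm\<close> by the difference of the known ones.\<close>

lemma H1_norm_diff_test:
  assumes \<phi>: "\<phi> \<in> test_functions (ball 0 1)" and u: "has_weak_gradient u g (ball 0 1)"
  shows "H1_norm (ball 0 1) (\<lambda>x. \<phi> x - u x) =
    sqrt ((L2norm (lebesgue_on (ball 0 1)) (\<lambda>x. \<phi> x - u x))\<^sup>2 +
      (L2norm (lebesgue_on (ball 0 1)) (\<lambda>x. grad \<phi> x - g x))\<^sup>2)"
proof -
  let ?M = "lebesgue_on (ball (0::'a) 1)"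
  have w: "has_weak_gradient (\<lambda>x. \<phi> x - u x) (\<lambda>x. grad \<phi> x - g x) (ball 0 1)"
    by (intro has_weak_gradient_diff test_has_weak_gradient \<phi> u)
  note W = weak_grad_AE[OF w]
  have "(LINT x|?M. (norm (weak_grad (ball 0 1) (\<lambda>x. \<phi> x - u x) x))\<^sup>2) = (LINT x|?M. (norm (grad \<phi> x - g x))\<^sup>2)"
    using W(2) has_weak_gradient_measurable[OF W(1)] has_weak_gradient_measurable[OF w]
    by (intro integral_cong_AE borel_measurable_power borel_measurable_norm) auto
  then show ?thesis by (simp add: H1_norm_def L2norm_sq)
qed

lemma H10_approx_in_H10:
  assumes "H10_approx \<phi> u g"
  shows "u \<in> H10 (ball 0 1)"
proof -
  note D = H10_approxD[OF assms] and w = H10_approx_has_weak_gradient[OF assms]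
  have "(\<lambda>k. H1_norm (ball 0 1) (\<lambda>x. \<phi> k x - u x)) \<longlonglongrightarrow> sqrt (0\<^sup>2 + 0\<^sup>2)"
    unfolding H1_norm_diff_test[OF D(1) w]
    by (intro tendsto_intros L2limD(3)[OF D(2)] L2limD(3)[OF D(3)])
  moreover have "u \<in> H1 (ball 0 1)"
    using D w by (auto simp: H1_def Lp_space_2_iff)
  ultimately show ?thesis using D(1) by (auto simp: H10_def)
qed

lemma H10_obtain_approx:
  assumes "u \<in> H10 (ball 0 1)"
  obtains \<phi> where "H10_approx \<phi> u (weak_grad (ball 0 1) u)"
proof -
  let ?M = "lebesgue_on (ball (0::'a) 1)"
  let ?g = "weak_grad (ball 0 1) u"
  have "u \<in> H1 (ball 0 1)" using assms by (simp add: H10_def)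
  then obtain g where u: "L2 ?M u" and g: "L2 ?M g" "has_weak_gradient u g (ball 0 1)"
    by (auto simp: H1_def Lp_space_2_iff)
  have "\<exists>\<phi>. (\<forall>n::nat. \<phi> n \<in> test_functions (ball 0 1)) \<and>
      (\<lambda>n. H1_norm (ball 0 1) (\<lambda>x. \<phi> n x - u x)) \<longlonglongrightarrow> 0"
    using assms by (simp add: H10_def)
  then obtain \<phi> where \<phi>: "\<And>n::nat. \<phi> n \<in> test_functions (ball 0 1)"
    and lim: "(\<lambda>n. H1_norm (ball 0 1) (\<lambda>x. \<phi> n x - u x)) \<longlonglongrightarrow> 0" by auto
  note W = weak_grad_AE[OF g(2)]
  have gm: "?g \<in> borel_measurable ?M" using has_weak_gradient_measurable[OF W(1)] .
  have gL: "L2 ?M ?g"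
    by (rule L2norm_mono(1)[OF gm g(1)]) (use W(2) in \<open>auto elim: eventually_mono\<close>)
  have le: "L2norm ?M (\<lambda>x. \<phi> k x - u x) \<le> H1_norm (ball 0 1) (\<lambda>x. \<phi> k x - u x)"
    "L2norm ?M (\<lambda>x. grad (\<phi> k) x - ?g x) \<le> H1_norm (ball 0 1) (\<lambda>x. \<phi> k x - u x)" for k
    unfolding H1_norm_diff_test[OF \<phi> W(1)] by (auto intro!: real_le_rsqrt)
  have "(\<lambda>k. L2norm ?M (\<lambda>x. \<phi> k x - u x)) \<longlonglongrightarrow> 0" "(\<lambda>k. L2norm ?M (\<lambda>x. grad (\<phi> k) x - ?g x)) \<longlonglongrightarrow> 0"
    by (rule Lim_null_comparison[OF _ lim]; use le in \<open>auto intro: always_eventually\<close>)+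
  then have "H10_approx \<phi> u ?g"
    using \<phi> u gL by (auto simp: H10_approx_def L2lim_def intro: L2_test)
  then show ?thesis by (rule that)
qed

section \<open>Rotations\<close>

text \<open>Fubini's theorem and translation invariance show that a linear isometry multiplies Lebesgue
  measure by a constant, and the unit ball shows that the constant is \<open>1\<close>.\<close>

lemma nn_integral_orthogonal:
  fixes T :: "'a::euclidean_space \<Rightarrow> 'a"
  assumes T: "orthogonal_transformation T" and h: "h \<in> borel_measurable borel"
  shows "(\<integral>\<^sup>+x. h (T x) \<partial>lborel) = (\<integral>\<^sup>+x. h x \<partial>lborel)"
proof -
  let ?B = "indicator (ball (0::'a) 1) :: 'a \<Rightarrow> ennreal"
  \<comment> \<open>Both sides of the claim are compared after multiplication by the volume of the unit ball.\<close>
  define v where "v = (\<integral>\<^sup>+y. ?B y \<partial>lborel)"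
  have lin: "linear T" using T by (rule orthogonal_transformation_linear)
  have Tm [measurable]: "T \<in> borel_measurable borel"
    using lin by (simp add: borel_measurable_continuous_onI linear_continuous_on linear_linear)
  note h [measurable]
  have [measurable]: "ball (0::'a) 1 \<in> sets borel" by simp
  obtain S where S: "\<And>y. T (S y) = y"
    using orthogonal_transformation_surj[OF T] by (metis surjD)
  have v: "v = ennreal (measure lborel (ball (0::'a) 1))" "v \<noteq> 0" "v \<noteq> top"
  proof -
    have "emeasure lborel (ball (0::'a) 1) \<noteq> top" using emeasure_lborel_ball_finite[of "0::'a" 1] by simp
    moreover show "v = ennreal (measure lborel (ball (0::'a) 1))"
      unfolding v_def using emeasure_eq_ennreal_measure[OF calculation] by simp
    ultimately show "v \<noteq> 0" "v \<noteq> top" using content_ball_pos[of 1 "0::'a"] by auto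
  qed
  have "v * (\<integral>\<^sup>+x. h (T x) \<partial>lborel) = (\<integral>\<^sup>+y. ?B y * (\<integral>\<^sup>+z. h (T z) \<partial>lborel) \<partial>lborel)"
    unfolding v_def by (subst nn_integral_multc) auto
  also have "\<dots> = (\<integral>\<^sup>+y. (\<integral>\<^sup>+z. ?B y * h (T z + y) \<partial>lborel) \<partial>lborel)"
  proof (rule nn_integral_cong)
    fix y
    have "(\<integral>\<^sup>+z. h (T z + y) \<partial>lborel) = (\<integral>\<^sup>+z. h (T (S y + z)) \<partial>lborel)"
      using S by (simp add: linear_add[OF lin] add.commute)
    also have "\<dots> = (\<integral>\<^sup>+z. h (T z) \<partial>lborel)"
      by (rule nn_integral_translation) measurable
    finally show "?B y * (\<integral>\<^sup>+z. h (T z) \<partial>lborel) = (\<integral>\<^sup>+z. ?B y * h (T z + y) \<partial>lborel)"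
      by (subst nn_integral_cmult) auto
  qed
  also have "\<dots> = (\<integral>\<^sup>+z. (\<integral>\<^sup>+y. ?B y * h (T z + y) \<partial>lborel) \<partial>lborel)"
    by (rule lborel_pair.Fubini'[of "\<lambda>z y. ?B y * h (T z + y)"]) measurable
  also have "\<dots> = (\<integral>\<^sup>+z. (\<integral>\<^sup>+y. ?B (y - T z) * h y \<partial>lborel) \<partial>lborel)"
  proof (rule nn_integral_cong)
    fix z
    show "(\<integral>\<^sup>+y. ?B y * h (T z + y) \<partial>lborel) = (\<integral>\<^sup>+y. ?B (y - T z) * h y \<partial>lborel)"
      using nn_integral_translation[of "\<lambda>y. ?B (y - T z) * h y" "T z"] by simp
  qed
  also have "\<dots> = (\<integral>\<^sup>+y. (\<integral>\<^sup>+z. ?B (y - T z) * h y \<partial>lborel) \<partial>lborel)"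
    by (rule lborel_pair.Fubini'[of "\<lambda>y z. ?B (y - T z) * h y"]) measurable
  also have "\<dots> = (\<integral>\<^sup>+y. v * h y \<partial>lborel)"
  proof (rule nn_integral_cong)
    fix y
    have "?B (y - T z) = ?B (- S y + z)" for z
    proof -
      have "norm (y - T z) = norm (T (S y - z))" by (simp add: linear_diff[OF lin] S)
      also have "\<dots> = norm (- S y + z)"
        using T by (simp add: orthogonal_transformation norm_minus_commute)
      finally show ?thesis by (simp add: indicator_def)
    qed
    then have "(\<integral>\<^sup>+z. ?B (y - T z) \<partial>lborel) = v"
      using nn_integral_translation[of ?B "- S y"] by (simp add: v_def)
    then show "(\<integral>\<^sup>+z. ?B (y - T z) * h y \<partial>lborel) = v * h y"
      by (subst nn_integral_multc) auto
  qed
  also have "\<dots> = v * (\<integral>\<^sup>+x. h x \<partial>lborel)" by (rule nn_integral_cmult) simp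
  finally show ?thesis using v by (simp add: ennreal_mult_cancel_left)
qed

lemma integral_orthogonal:
  fixes T :: "'a::euclidean_space \<Rightarrow> 'a" and h :: "'a \<Rightarrow> real"
  assumes T: "orthogonal_transformation T" and h: "h \<in> borel_measurable borel"
  shows "(LINT x|lborel. h (T x)) = (LINT x|lborel. h x)"
proof -
  have Tm: "T \<in> measurable lborel borel"
    using orthogonal_transformation_linear[OF T]
    by (simp add: borel_measurable_continuous_onI linear_continuous_on linear_linear)
  have "distr lborel borel T = lborel"
  proof (rule measure_eqI)
    fix A :: "'a set" assume "A \<in> sets (distr lborel borel T)"
    then have A: "A \<in> sets borel" by simp
    have "emeasure (distr lborel borel T) A = (\<integral>\<^sup>+x. indicator A x \<partial>distr lborel borel T)"
      using A by simp
    also have "\<dots> = (\<integral>\<^sup>+x. indicator A (T x) \<partial>lborel)"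
      using A by (intro nn_integral_distr Tm) auto
    also have "\<dots> = emeasure lborel A"
      using nn_integral_orthogonal[OF T, of "indicator A"] A by simp
    finally show "emeasure (distr lborel borel T) A = emeasure lborel A" .
  qed simp
  then show ?thesis using integral_distr[OF Tm, of h] h by simp
qed

locale plane =
  fixes e f :: "'a::euclidean_space"
  assumes ee: "e \<bullet> e = 1" and ff: "f \<bullet> f = 1" and ef: "e \<bullet> f = 0"
begin

lemma fe: "f \<bullet> e = 0" using ef by (simp add: inner_commute)

text \<open>Rotation by the angle \<open>t\<close> in the plane spanned by \<open>e\<close> and \<open>f\<close>, and its generator.\<close>

definition rot :: "real \<Rightarrow> 'a \<Rightarrow> 'a" where
  "rot t x = x + ((cos t - 1) * (x \<bullet> e) - sin t * (x \<bullet> f)) *\<^sub>R e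
               + (sin t * (x \<bullet> e) + (cos t - 1) * (x \<bullet> f)) *\<^sub>R f"

definition rot_gen :: "'a \<Rightarrow> 'a" where
  "rot_gen x = (x \<bullet> e) *\<^sub>R f - (x \<bullet> f) *\<^sub>R e"

lemma rot_inner: "rot t x \<bullet> e = cos t * (x \<bullet> e) - sin t * (x \<bullet> f)"
  "rot t x \<bullet> f = sin t * (x \<bullet> e) + cos t * (x \<bullet> f)"
  by (simp_all add: rot_def inner_add_left ee ff ef fe algebra_simps)

lemma rot_0 [simp]: "rot 0 x = x"
  by (simp add: rot_def)

lemma rot_add: "rot (s + t) x = rot s (rot t x)"
proof -
  define a b where ab: "a = x \<bullet> e" "b = x \<bullet> f"
  have c: "((cos t - 1) * a - sin t * b) + ((cos s - 1) * (cos t * a - sin t * b) - sin s * (sin t * a + cos t * b))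
      = (cos s * cos t - sin s * sin t - 1) * a - (sin s * cos t + cos s * sin t) * b"
    "(sin t * a + (cos t - 1) * b) + (sin s * (cos t * a - sin t * b) + (cos s - 1) * (sin t * a + cos t * b))
      = (sin s * cos t + cos s * sin t) * a + (cos s * cos t - sin s * sin t - 1) * b"
    by (simp_all add: algebra_simps)
  have sc: "x + p *\<^sub>R e + q *\<^sub>R f + p' *\<^sub>R e + q' *\<^sub>R f = x + (p + p') *\<^sub>R e + (q + q') *\<^sub>R f" for p q p' q'
    by (simp add: algebra_simps)
  show ?thesis
    unfolding rot_def[of s "rot t x"] rot_inner
    unfolding rot_def ab[symmetric] sc c cos_add sin_add ..
qed

lemma linear_rot: "linear (rot t)"
  by (rule linearI) (simp_all add: rot_def inner_add_left algebra_simps)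

lemma norm_rot [simp]: "norm (rot t x) = norm x"
proof -
  define a where "a = x \<bullet> e"
  define b where "b = x \<bullet> f"
  define p where "p = (cos t - 1) * a - sin t * b"
  define q where "q = sin t * a + (cos t - 1) * b"
  have "rot t x \<bullet> rot t x = x \<bullet> x + 2 * (p * a + q * b) + (p * p + q * q)"
    unfolding rot_def p_def[symmetric, unfolded a_def b_def] q_def[symmetric, unfolded a_def b_def]
    by (simp add: inner_add_left inner_add_right ee ff ef fe inner_commute[of e x] inner_commute[of f x]
        a_def[symmetric] b_def[symmetric] p_def q_def algebra_simps)
  also have "p * p + q * q = ((cos t)\<^sup>2 + (sin t)\<^sup>2 + 1 - 2 * cos t) * (a * a + b * b)"
    unfolding p_def q_def by algebra
  also have "\<dots> = (2 - 2 * cos t) * (a * a + b * b)" by simp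
  also have "2 * (p * a + q * b) = (2 * cos t - 2) * (a * a + b * b)"
    by (simp add: p_def q_def algebra_simps)
  finally have "rot t x \<bullet> rot t x = x \<bullet> x" by (simp add: algebra_simps)
  then show ?thesis by (simp add: norm_eq)
qed

lemma orthogonal_rot: "orthogonal_transformation (rot t)"
  by (simp add: orthogonal_transformation linear_rot)

lemma rot_has_vector_derivative: "((\<lambda>t. rot t x) has_vector_derivative rot_gen (rot t x)) (at t)"
proof -
  have "((\<lambda>t. rot t x) has_vector_derivative
      (- sin t * (x \<bullet> e) - cos t * (x \<bullet> f)) *\<^sub>R e + (cos t * (x \<bullet> e) - sin t * (x \<bullet> f)) *\<^sub>R f) (at t)"
    unfolding rot_def by (auto intro!: derivative_eq_intros simp: has_real_derivative_iff_has_vector_derivative[symmetric] algebra_simps)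
  then show ?thesis by (simp add: rot_gen_def rot_inner algebra_simps)
qed

lemma norm_rot_gen_le: "norm (rot_gen x) \<le> norm x"
proof -
  define y where "y = x - (x \<bullet> e) *\<^sub>R e - (x \<bullet> f) *\<^sub>R f"
  have "rot_gen x \<bullet> rot_gen x = (x \<bullet> e)\<^sup>2 + (x \<bullet> f)\<^sup>2"
    by (simp add: rot_gen_def inner_diff_left inner_diff_right ee ff ef fe power2_eq_square algebra_simps)
  moreover have "x \<bullet> x = y \<bullet> y + (x \<bullet> e)\<^sup>2 + (x \<bullet> f)\<^sup>2"
    by (simp add: y_def inner_diff_left inner_diff_right ee ff ef fe inner_commute[of e x] inner_commute[of f x]
        power2_eq_square algebra_simps)
  moreover have "0 \<le> y \<bullet> y" by simp
  ultimately have "rot_gen x \<bullet> rot_gen x \<le> x \<bullet> x" by linarith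
  then show ?thesis by (simp add: norm_le)
qed

lemma continuous_rot: "continuous_on UNIV (\<lambda>z. rot (snd z) (fst z))"
  unfolding rot_def by (intro continuous_intros)

end

subsection \<open>The angular Poincare inequality\<close>

text \<open>For \<open>k < n\<close> the function \<open>tan (k (t - c - L / 2))\<close> is smooth on \<open>[c, c + L]\<close>, and writing \<open>T\<close> for it,
  \<open>(w')\<^sup>2 - k\<^sup>2 w\<^sup>2 + (k w\<^sup>2 T)' = (w' + k w T)\<^sup>2\<close>. The boundary terms vanish, so the inequality holds with \<open>k\<close>
  in place of \<open>n\<close>; then \<open>k\<close> tends to \<open>n\<close>.\<close>

lemma Wirtinger:
  fixes w w' :: "real \<Rightarrow> real"
  assumes w: "\<And>t. (w has_real_derivative w' t) (at t)" and w'c: "continuous_on UNIV w'"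
    and n: "n > 0" and L: "L = pi / n" and z: "w c = 0" "w (c + L) = 0"
  shows "n\<^sup>2 * integral {c..c+L} (\<lambda>t. (w t)\<^sup>2) \<le> integral {c..c+L} (\<lambda>t. (w' t)\<^sup>2)"
proof -
  have Lpos: "L > 0" using n by (simp add: L)
  have wc: "continuous_on S w" for S
    by (rule DERIV_continuous_on[of S w w']) (auto intro: has_field_derivative_at_within w)
  have w'c': "continuous_on S w'" for S using w'c by (rule continuous_on_subset) simp
  define A where "A = integral {c..c+L} (\<lambda>t. (w t)\<^sup>2)"
  define B where "B = integral {c..c+L} (\<lambda>t. (w' t)\<^sup>2)"
  have hA: "((\<lambda>t. (w t)\<^sup>2) has_integral A) {c..c+L}" and hB: "((\<lambda>t. (w' t)\<^sup>2) has_integral B) {c..c+L}"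
    unfolding A_def B_def
    by (intro integrable_integral integrable_continuous_real continuous_intros wc w'c')+
  have sub: "k\<^sup>2 * A \<le> B" if k: "0 < k" "k < n" for k
  proof -
    let ?T = "\<lambda>t. tan (k * (t - c - L / 2))"
    define P where "P t = k * (w t)\<^sup>2 * ?T t" for t
    define P' where "P' t = 2 * k * w t * w' t * ?T t + k\<^sup>2 * (w t)\<^sup>2 * (1 + (?T t)\<^sup>2)" for t
    have cos: "cos (k * (t - c - L / 2)) > 0" if "t \<in> {c..c+L}" for t
    proof (rule cos_gt_zero_pi)
      have "\<bar>t - c - L / 2\<bar> \<le> L / 2" using that unfolding abs_le_iff by (auto simp: field_simps)
      then have "\<bar>k * (t - c - L / 2)\<bar> \<le> k * (L / 2)" using k by (simp add: abs_mult)
      also have "\<dots> < n * (L / 2)" using k Lpos by simp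
      also have "\<dots> = pi / 2" using n by (simp add: L)
      finally show "- (pi / 2) < k * (t - c - L / 2)" "k * (t - c - L / 2) < pi / 2" by linarith+
    qed
    have "(P has_real_derivative P' t) (at t within {c..c+L})" if "t \<in> {c..c+L}" for t
    proof -
      have c0: "cos (k * (t - c - L / 2)) \<noteq> 0" using cos[OF that] by simp
      have T: "(?T has_real_derivative k * (1 + (?T t)\<^sup>2)) (at t)"
      proof -
        have "1 + (?T t)\<^sup>2 = 1 / (cos (k * (t - c - L / 2)))\<^sup>2"
          using tan_sec[OF c0] by (simp add: inverse_eq_divide power_divide)
        then show ?thesis using c0 by (auto intro!: derivative_eq_intros simp: inverse_eq_divide)
      qed
      have "((\<lambda>t. k * (w t)\<^sup>2) has_real_derivative k * (2 * w t * w' t)) (at t)"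
        by (auto intro!: derivative_eq_intros w)
      from DERIV_mult[OF this T] have "(P has_real_derivative P' t) (at t)"
        unfolding P_def by (rule DERIV_cong) (simp add: P'_def power2_eq_square algebra_simps)
      then show ?thesis by (rule has_field_derivative_at_within)
    qed
    then have "(P' has_integral (P (c + L) - P c)) {c..c+L}"
      using Lpos by (intro fundamental_theorem_of_calculus)
        (auto simp: has_real_derivative_iff_has_vector_derivative[symmetric])
    then have hP: "(P' has_integral 0) {c..c+L}" by (simp add: P_def z)
    have "((\<lambda>t. (w' t)\<^sup>2 - k\<^sup>2 * (w t)\<^sup>2 + P' t) has_integral (B - k\<^sup>2 * A + 0)) {c..c+L}"
      by (intro has_integral_add has_integral_diff has_integral_mult_right hA hB hP)
    moreover have "(w' t)\<^sup>2 - k\<^sup>2 * (w t)\<^sup>2 + P' t = (w' t + k * w t * ?T t)\<^sup>2" for t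
      by (simp add: P'_def power2_sum power_mult_distrib algebra_simps)
    ultimately have "((\<lambda>t. (w' t + k * w t * ?T t)\<^sup>2) has_integral (B - k\<^sup>2 * A + 0)) {c..c+L}"
      by simp
    then have "0 \<le> B - k\<^sup>2 * A + 0" by (rule has_integral_nonneg) simp
    then show ?thesis by simp
  qed
  have "n\<^sup>2 * A \<le> B"
  proof (rule tendsto_upperbound)
    show "((\<lambda>k. k\<^sup>2 * A) \<longlongrightarrow> n\<^sup>2 * A) (at_left n)" by (intro tendsto_intros)
    show "\<forall>\<^sub>F k in at_left n. k\<^sup>2 * A \<le> B"
      using eventually_at_left_real[OF n] by (auto elim!: eventually_mono intro!: sub)
  qed simp
  then show ?thesis by (simp add: A_def B_def)
qed

lemma integral_period_shift:
  fixes q :: "real \<Rightarrow> real"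
  assumes q: "continuous_on UNIV q" and per: "\<And>t. q (t + L) = q t" and c: "0 \<le> c" "c \<le> L"
  shows "integral {c..c+L} q = integral {0..L} q"
proof -
  have i: "q integrable_on {a..b}" for a b
    by (rule integrable_continuous_real) (rule continuous_on_subset[OF q], simp)
  have "integral {L..c+L} q = integral {0..c} q"
    using integral_shift[of 0 L c q] continuous_on_subset[OF q] by (simp add: o_def per)
  then show ?thesis
    using Henstock_Kurzweil_Integration.integral_combine[of c L "c + L" q] Henstock_Kurzweil_Integration.integral_combine[of 0 c L q] c i by simp
qed

text \<open>An antiperiodic function has a zero in every period, and \<open>w\<^sup>2\<close> and \<open>(w')\<^sup>2\<close> are periodic, so the interval may
  be shifted to start at a zero.\<close>

lemma Wirtinger_antiperiodic:
  fixes w w' :: "real \<Rightarrow> real"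
  assumes w: "\<And>t. (w has_real_derivative w' t) (at t)" and w'c: "continuous_on UNIV w'"
    and n: "n > 0" and L: "L = pi / n" and anti: "\<And>t. w (t + L) = - w t"
  shows "n\<^sup>2 * integral {0..L} (\<lambda>t. (w t)\<^sup>2) \<le> integral {0..L} (\<lambda>t. (w' t)\<^sup>2)"
proof -
  have Lpos: "L > 0" using n by (simp add: L)
  have wc: "continuous_on S w" for S
    by (rule DERIV_continuous_on[of S w w']) (auto intro: has_field_derivative_at_within w)
  have anti': "w' (t + L) = - w' t" for t
  proof -
    have "((\<lambda>t. w (t + L)) has_real_derivative w' (t + L)) (at t)"
      using w[of "t + L"] by (simp add: DERIV_shift)
    then have "((\<lambda>t. - w t) has_real_derivative w' (t + L)) (at t)" by (simp add: anti)
    moreover have "((\<lambda>t. - w t) has_real_derivative - w' t) (at t)" by (intro derivative_intros w)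
    ultimately show ?thesis by (rule DERIV_unique)
  qed
  obtain c where c: "0 \<le> c" "c \<le> L" "w c = 0"
  proof (cases "w 0 \<le> 0")
    case True
    then have "\<exists>x\<ge>0. x \<le> L \<and> w x = 0"
      using anti[of 0] Lpos wc by (intro IVT') auto
    then show ?thesis using that by blast
  next
    case False
    then have "\<exists>x\<ge>0. x \<le> L \<and> w x = 0"
      using anti[of 0] Lpos wc by (intro IVT2') auto
    then show ?thesis using that by blast
  qed
  have "n\<^sup>2 * integral {c..c+L} (\<lambda>t. (w t)\<^sup>2) \<le> integral {c..c+L} (\<lambda>t. (w' t)\<^sup>2)"
    by (rule Wirtinger[OF w w'c n L c(3)]) (simp add: anti c)
  moreover have "integral {c..c+L} (\<lambda>t. (w t)\<^sup>2) = integral {0..L} (\<lambda>t. (w t)\<^sup>2)"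
    by (intro integral_period_shift continuous_intros wc c) (simp add: anti)
  moreover have "integral {c..c+L} (\<lambda>t. (w' t)\<^sup>2) = integral {0..L} (\<lambda>t. (w' t)\<^sup>2)"
    by (intro integral_period_shift continuous_intros w'c c) (simp add: anti')
  ultimately show ?thesis by simp
qed

context plane
begin

text \<open>Averaging over rotations takes the place of integration in polar coordinates.\<close>

lemma nn_integral_rotation_average:
  fixes h :: "'a \<Rightarrow> real"
  assumes h: "continuous_on UNIV h" and A: "A \<in> sets borel" "\<And>t x. rot t x \<in> A \<longleftrightarrow> x \<in> A" and L: "L > 0"
  shows "(\<integral>\<^sup>+x. indicator A x * (\<integral>\<^sup>+t. ennreal (indicator {0..L} t * h (rot t x)) \<partial>lborel) \<partial>lborel)
    = ennreal L * (\<integral>\<^sup>+x. indicator A x * ennreal (h x) \<partial>lborel)"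
proof -
  have c: "continuous_on UNIV (\<lambda>z::'a \<times> real. h (rot (snd z) (fst z)))"
    by (rule continuous_on_compose2[OF h continuous_rot]) simp
  have hm: "(\<lambda>z::'a \<times> real. h (rot (snd z) (fst z))) \<in> borel_measurable (borel \<Otimes>\<^sub>M borel)"
    unfolding borel_prod by (rule borel_measurable_continuous_onI[OF c])
  have [measurable]: "A \<in> sets borel" by fact
  have "(\<lambda>z::'a \<times> real. indicator A (fst z) * ennreal (indicator {0..L} (snd z) * h (rot (snd z) (fst z))))
      \<in> borel_measurable (borel \<Otimes>\<^sub>M borel)"
    using hm by measurable
  then have M: "(\<lambda>(x, t). indicator A x * ennreal (indicator {0..L} t * h (rot t x)))
        \<in> borel_measurable (lborel \<Otimes>\<^sub>M lborel)"
    by (simp add: case_prod_beta' cong: measurable_cong_sets sets_pair_measure_cong)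
  have h2: "(\<lambda>x. indicator A x * ennreal (h x)) \<in> borel_measurable borel"
    using borel_measurable_continuous_onI[OF h] by measurable
  have in1: "indicator A x * (\<integral>\<^sup>+t. ennreal (indicator {0..L} t * h (rot t x)) \<partial>lborel) =
      (\<integral>\<^sup>+t. indicator A x * ennreal (indicator {0..L} t * h (rot t x)) \<partial>lborel)" for x
    by (cases "x \<in> A") auto
  have in2: "(\<integral>\<^sup>+x. indicator A x * ennreal (indicator {0..L} t * h (rot t x)) \<partial>lborel) =
     (\<integral>\<^sup>+x. indicator A x * ennreal (h x) \<partial>lborel) * indicator {0..L} t" for t
  proof -
    have "(\<integral>\<^sup>+x. indicator A x * ennreal (h (rot t x)) \<partial>lborel) =
        (\<integral>\<^sup>+x. indicator A (rot t x) * ennreal (h (rot t x)) \<partial>lborel)"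
      using A(2) by (intro nn_integral_cong) (simp add: indicator_def)
    also have "\<dots> = (\<integral>\<^sup>+x. indicator A x * ennreal (h x) \<partial>lborel)"
      by (rule nn_integral_orthogonal[OF orthogonal_rot h2])
    finally show ?thesis by (cases "t \<in> {0..L}") auto
  qed
  have "(\<integral>\<^sup>+x. indicator A x * (\<integral>\<^sup>+t. ennreal (indicator {0..L} t * h (rot t x)) \<partial>lborel) \<partial>lborel) =
      (\<integral>\<^sup>+t. (\<integral>\<^sup>+x. indicator A x * ennreal (indicator {0..L} t * h (rot t x)) \<partial>lborel) \<partial>lborel)"
    unfolding in1 by (rule lborel_pair.Fubini'[OF M, symmetric])
  also have "\<dots> = (\<integral>\<^sup>+x. indicator A x * ennreal (h x) \<partial>lborel) * ennreal L"
    unfolding in2 using L by (subst nn_integral_cmult_indicator) auto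
  finally show ?thesis by (simp add: mult.commute)
qed

text \<open>Along each orbit \<open>t \<mapsto> rot t x\<close> the function is antiperiodic with antiperiod \<open>pi / n\<close>, and the derivative along
  the orbit is at most \<open>norm x\<close> times the gradient. Wirtinger's inequality on the orbits is integrated
  over a rotation invariant set.\<close>

theorem angular_Poincare:
  assumes \<phi>: "smooth \<phi>" and n: "n > 0" and anti: "\<And>x. \<phi> (rot (pi / n) x) = - \<phi> x"
    and A: "A \<in> sets borel" "\<And>t x. rot t x \<in> A \<longleftrightarrow> x \<in> A"
  shows "ennreal (n\<^sup>2) * (\<integral>\<^sup>+x. indicator A x * ennreal ((\<phi> x)\<^sup>2) \<partial>lborel)
    \<le> (\<integral>\<^sup>+x. indicator A x * ennreal ((norm x)\<^sup>2 * (norm (grad \<phi> x))\<^sup>2) \<partial>lborel)"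
proof -
  define L where "L = pi / n"
  have L: "L > 0" using n by (simp add: L_def)
  let ?I = "\<lambda>h. (\<integral>\<^sup>+x. indicator A x * ennreal (h x) \<partial>lborel)"
  let ?h = "\<lambda>x. (\<phi> x)\<^sup>2" and ?k = "\<lambda>x. (norm x)\<^sup>2 * (norm (grad \<phi> x))\<^sup>2"
  have ch: "continuous_on UNIV ?h" "continuous_on UNIV ?k"
    by (intro continuous_intros continuous_smooth continuous_grad \<phi>)+
  have sl: "ennreal (n\<^sup>2) * (\<integral>\<^sup>+t. ennreal (indicator {0..L} t * ?h (rot t x)) \<partial>lborel)
     \<le> (\<integral>\<^sup>+t. ennreal (indicator {0..L} t * ?k (rot t x)) \<partial>lborel)" for x
  proof -
    define w where "w t = \<phi> (rot t x)" for t
    define w' where "w' t = grad \<phi> (rot t x) \<bullet> rot_gen (rot t x)" for t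
    have cr: "continuous_on UNIV (\<lambda>t. rot t x)" unfolding rot_def by (intro continuous_intros)
    have w: "(w has_real_derivative w' t) (at t)" for t
    proof -
      have "((\<lambda>t. rot t x) has_derivative (\<lambda>s. s *\<^sub>R rot_gen (rot t x))) (at t)"
        using rot_has_vector_derivative by (simp add: has_vector_derivative_def)
      from has_derivative_compose[OF this smooth_grad[OF \<phi>]]
      have "(w has_derivative (\<lambda>s. grad \<phi> (rot t x) \<bullet> (s *\<^sub>R rot_gen (rot t x)))) (at t)"
        unfolding w_def .
      moreover have "(\<lambda>s. grad \<phi> (rot t x) \<bullet> (s *\<^sub>R rot_gen (rot t x))) = (*) (w' t)"
        by (auto simp: w'_def mult.commute)
      ultimately show ?thesis by (simp only: has_field_derivative_def)
    qed
    have w'c: "continuous_on UNIV w'"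
      unfolding w'_def rot_gen_def
      by (intro continuous_intros cr continuous_on_compose2[OF continuous_grad[OF \<phi>] cr]) auto
    have wc: "continuous_on UNIV w"
      unfolding w_def by (rule continuous_on_compose2[OF continuous_smooth[OF \<phi>] cr]) auto
    have an: "w (t + L) = - w t" for t
      using anti[of "rot t x"] rot_add[of L t x] by (simp add: w_def L_def add.commute)
    have kc: "continuous_on UNIV (\<lambda>t. ?k (rot t x))"
      by (rule continuous_on_compose2[OF ch(2) cr]) auto
    have "n\<^sup>2 * integral {0..L} (\<lambda>t. (w t)\<^sup>2) \<le> integral {0..L} (\<lambda>t. (w' t)\<^sup>2)"
      by (rule Wirtinger_antiperiodic[OF w w'c n L_def an])
    also have "\<dots> \<le> integral {0..L} (\<lambda>t. ?k (rot t x))"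
    proof (rule integral_le)
      show "(\<lambda>t. (w' t)\<^sup>2) integrable_on {0..L}" "(\<lambda>t. ?k (rot t x)) integrable_on {0..L}"
        by (intro integrable_continuous_real continuous_on_subset[OF kc]
            continuous_on_subset[OF continuous_on_power[OF w'c]]; simp)+
      fix t
      have "\<bar>w' t\<bar> \<le> norm (grad \<phi> (rot t x)) * norm (rot_gen (rot t x))"
        unfolding w'_def by (rule Cauchy_Schwarz_ineq2)
      also have "\<dots> \<le> norm (grad \<phi> (rot t x)) * norm (rot t x)"
        by (intro mult_left_mono norm_rot_gen_le) auto
      finally have "\<bar>w' t\<bar> \<le> \<bar>norm (grad \<phi> (rot t x)) * norm (rot t x)\<bar>" by (simp add: abs_mult)
      then have "(w' t)\<^sup>2 \<le> (norm (grad \<phi> (rot t x)) * norm (rot t x))\<^sup>2" by (simp only: abs_le_square_iff)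
      then show "(w' t)\<^sup>2 \<le> ?k (rot t x)" by (simp add: power_mult_distrib mult.commute)
    qed
    finally have "ennreal (n\<^sup>2 * integral {0..L} (\<lambda>t. (w t)\<^sup>2)) \<le> ennreal (integral {0..L} (\<lambda>t. ?k (rot t x)))"
      by (rule ennreal_leI)
    moreover have "ennreal (integral {0..L} (\<lambda>t. ?k (rot t x))) =
        (\<integral>\<^sup>+t. ennreal (indicator {0..L} t * ?k (rot t x)) \<partial>lborel)"
      by (intro continuous_nn_integral_Icc[symmetric] continuous_on_subset[OF kc]) auto
    moreover have "ennreal (integral {0..L} (\<lambda>t. (w t)\<^sup>2)) =
        (\<integral>\<^sup>+t. ennreal (indicator {0..L} t * ?h (rot t x)) \<partial>lborel)"
      unfolding w_def[symmetric]
      by (intro continuous_nn_integral_Icc[symmetric] continuous_on_subset[OF continuous_on_power[OF wc]]) auto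
    ultimately show ?thesis by (simp add: ennreal_mult')
  qed
  have "ennreal L * (ennreal (n\<^sup>2) * ?I ?h) =
     ennreal (n\<^sup>2) * (\<integral>\<^sup>+x. indicator A x * (\<integral>\<^sup>+t. ennreal (indicator {0..L} t * ?h (rot t x)) \<partial>lborel) \<partial>lborel)"
    unfolding nn_integral_rotation_average[OF ch(1) A L] by (simp add: ac_simps)
  also have "\<dots> = (\<integral>\<^sup>+x. ennreal (n\<^sup>2) * (indicator A x * (\<integral>\<^sup>+t. ennreal (indicator {0..L} t * ?h (rot t x)) \<partial>lborel)) \<partial>lborel)"
  proof (rule nn_integral_cmult[symmetric])
    have c: "continuous_on UNIV (\<lambda>z::'a \<times> real. ?h (rot (snd z) (fst z)))"
      by (rule continuous_on_compose2[OF ch(1) continuous_rot]) simp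
    have hm: "(\<lambda>z::'a \<times> real. ?h (rot (snd z) (fst z))) \<in> borel_measurable (borel \<Otimes>\<^sub>M borel)"
      unfolding borel_prod by (rule borel_measurable_continuous_onI[OF c])
    have "(\<lambda>z::'a \<times> real. ennreal (indicator {0..L} (snd z) * ?h (rot (snd z) (fst z))))
        \<in> borel_measurable (borel \<Otimes>\<^sub>M borel)"
      using hm by measurable
    then have "(\<lambda>(x, t). ennreal (indicator {0..L} t * ?h (rot t x))) \<in> borel_measurable (lborel \<Otimes>\<^sub>M lborel)"
      by (simp add: case_prod_beta' cong: measurable_cong_sets sets_pair_measure_cong)
    from lborel.borel_measurable_nn_integral[OF this] A(1)
    show "(\<lambda>x. indicator A x * (\<integral>\<^sup>+t. ennreal (indicator {0..L} t * ?h (rot t x)) \<partial>lborel)) \<in> borel_measurable lborel"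
      by (intro borel_measurable_times_ennreal borel_measurable_indicator) auto
  qed
  also have "\<dots> \<le> (\<integral>\<^sup>+x. indicator A x * (\<integral>\<^sup>+t. ennreal (indicator {0..L} t * ?k (rot t x)) \<partial>lborel) \<partial>lborel)"
    by (intro nn_integral_mono) (use sl in \<open>auto simp: indicator_def mult.left_commute\<close>)
  also have "\<dots> = ennreal L * ?I ?k" by (rule nn_integral_rotation_average[OF ch(2) A L])
  finally have "ennreal L * (ennreal (n\<^sup>2) * ?I ?h) \<le> ennreal L * ?I ?k" .
  then show ?thesis using L by (subst (asm) ennreal_mult_le_mult_iff) auto
qed

end

section \<open>Whispering gallery test functions\<close>

context plane
begin

definition rad2 :: "'a \<Rightarrow> real" where
  "rad2 x = (x \<bullet> e)\<^sup>2 + (x \<bullet> f)\<^sup>2"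

text \<open>A smooth function that equals \<open>1 / rad2\<close> where \<open>rad2 \<ge> a\<close>.\<close>

definition inv_rad2 :: "real \<Rightarrow> 'a \<Rightarrow> real" where
  "inv_rad2 a x = inverse (rad2 x + bump (a - rad2 x))"

text \<open>Where \<open>rad2 \<ge> a\<close>, the number \<open>phase a x\<close> is \<open>exp (2 \<i> \<theta>)\<close> for the polar angle \<open>\<theta>\<close> of \<open>x\<close>.\<close>

definition phase :: "real \<Rightarrow> 'a \<Rightarrow> complex" where
  "phase a x = of_real (inv_rad2 a x) * (Complex (x \<bullet> e) (x \<bullet> f))\<^sup>2"

lemma smooth_rad2: "smooth rad2"
  unfolding rad2_def by (intro smooth_add smooth_power smooth_inner)

lemma inv_rad2_denominator:
  assumes "a > 0" shows "rad2 x + bump (a - rad2 x) > 0"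
proof (cases "rad2 x = 0")
  case True
  then show ?thesis using assms bump_pos_iff[of a] by simp
next
  case False
  moreover have "rad2 x \<ge> 0" by (simp add: rad2_def)
  ultimately show ?thesis using bump_nonneg[of "a - rad2 x"] by linarith
qed

lemma smooth_inv_rad2: "a > 0 \<Longrightarrow> smooth (inv_rad2 a)"
  unfolding inv_rad2_def
  by (intro smooth_inverse smooth_add smooth_rad2 smooth_flat smooth_diff smooth_const)
    (metis inv_rad2_denominator less_irrefl)

lemma inv_rad2_eq: "rad2 x \<ge> a \<Longrightarrow> inv_rad2 a x = 1 / rad2 x"
  by (simp add: inv_rad2_def bump_eq inverse_eq_divide)

lemma Re_phase: "Re (phase a x) = inv_rad2 a x * ((x \<bullet> e)\<^sup>2 - (x \<bullet> f)\<^sup>2)"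
  and Im_phase: "Im (phase a x) = inv_rad2 a x * (2 * (x \<bullet> e) * (x \<bullet> f))"
  by (simp_all add: phase_def power2_eq_square)

lemma smooth_phase_power:
  assumes "a > 0"
  shows "smooth (\<lambda>x. Re (phase a x ^ m))" "smooth (\<lambda>x. Im (phase a x ^ m))"
proof -
  have "smooth (\<lambda>x. Re (phase a x)) \<and> smooth (\<lambda>x. Im (phase a x))"
    unfolding Re_phase Im_phase
    by (intro conjI smooth_mult smooth_diff smooth_power smooth_inner smooth_const smooth_inv_rad2 assms)
  then have "smooth (\<lambda>x. Re (phase a x ^ m)) \<and> smooth (\<lambda>x. Im (phase a x ^ m))"
    by (induction m) (auto intro!: smooth_const smooth_diff smooth_add smooth_mult)
  then show "smooth (\<lambda>x. Re (phase a x ^ m))" "smooth (\<lambda>x. Im (phase a x ^ m))" by auto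
qed

lemma cmod_phase:
  assumes "a > 0" "rad2 x \<ge> a"
  shows "cmod (phase a x) = 1"
proof -
  have "cmod (phase a x) = \<bar>1 / rad2 x\<bar> * (cmod (Complex (x \<bullet> e) (x \<bullet> f)))\<^sup>2"
    by (simp only: phase_def norm_mult norm_power norm_of_real inv_rad2_eq[OF assms(2)])
  also have "(cmod (Complex (x \<bullet> e) (x \<bullet> f)))\<^sup>2 = rad2 x" by (simp add: cmod_power2 rad2_def)
  finally show ?thesis using assms by simp
qed

lemma rad2_has_derivative: "(rad2 has_derivative (\<lambda>h. 2 * (x \<bullet> e) * (h \<bullet> e) + 2 * (x \<bullet> f) * (h \<bullet> f))) (at x)"
  unfolding rad2_def by (auto intro!: derivative_eq_intros simp: algebra_simps)

lemma inv_rad2_has_derivative: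
  assumes "a > 0" "rad2 x \<ge> a"
  shows "(inv_rad2 a has_derivative
     (\<lambda>h. - ((2 * (x \<bullet> e) * (h \<bullet> e) + 2 * (x \<bullet> f) * (h \<bullet> f)) / (rad2 x)\<^sup>2))) (at x)"
proof -
  have fl: "flat (flat_deriv 1) (a - rad2 x) = 0" "bump (a - rad2 x) = 0"
    using assms by (auto simp: flat_def)
  have "((\<lambda>y. bump (a - rad2 y)) has_derivative (\<lambda>h. flat (flat_deriv 1) (a - rad2 x) *
      (0 - (2 * (x \<bullet> e) * (h \<bullet> e) + 2 * (x \<bullet> f) * (h \<bullet> f))))) (at x)"
    by (rule has_derivative_compose[OF has_derivative_diff[OF has_derivative_const rad2_has_derivative]
        has_field_derivative_imp_has_derivative[OF flat_has_derivative]])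
  then have 1: "((\<lambda>y. bump (a - rad2 y)) has_derivative (\<lambda>h. 0)) (at x)" by (simp add: fl)
  have "(inv_rad2 a has_derivative (\<lambda>h. - (inverse (rad2 x + bump (a - rad2 x)) *
      ((2 * (x \<bullet> e) * (h \<bullet> e) + 2 * (x \<bullet> f) * (h \<bullet> f)) + 0) * inverse (rad2 x + bump (a - rad2 x))))) (at x)"
    unfolding inv_rad2_def
    by (rule Deriv.has_derivative_inverse[OF _ has_derivative_add[OF rad2_has_derivative 1]])
      (use inv_rad2_denominator[OF assms(1), of x] in simp)
  then show ?thesis by (simp add: fl inverse_eq_divide power2_eq_square)
qed

text \<open>The angle \<open>2 \<theta>\<close> has the gradient \<open>(2 / rad2 x) *\<^sub>R rot_gen x\<close>.\<close>

lemma grad_phase: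
  assumes "a > 0" "rad2 x \<ge> a"
  shows "grad (\<lambda>x. Re (phase a x)) x = (- Im (phase a x) * (2 / rad2 x)) *\<^sub>R rot_gen x"
    and "grad (\<lambda>x. Im (phase a x)) x = (Re (phase a x) * (2 / rad2 x)) *\<^sub>R rot_gen x"
proof -
  define p q where pq: "p = x \<bullet> e" "q = x \<bullet> f"
  have r: "rad2 x = p\<^sup>2 + q\<^sup>2" "rad2 x > 0" using assms by (auto simp: rad2_def pq)
  note D = inv_rad2_has_derivative[OF assms, folded pq]
  have w: "inv_rad2 a x = 1 / rad2 x" using assms by (simp add: inv_rad2_eq)
  have dRe: "((\<lambda>x. (x \<bullet> e)\<^sup>2 - (x \<bullet> f)\<^sup>2) has_derivative (\<lambda>h. 2 * p * (h \<bullet> e) - 2 * q * (h \<bullet> f))) (at x)"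
    unfolding pq by (auto intro!: derivative_eq_intros simp: algebra_simps)
  have dIm: "((\<lambda>x. 2 * (x \<bullet> e) * (x \<bullet> f)) has_derivative (\<lambda>h. 2 * p * (h \<bullet> f) + 2 * q * (h \<bullet> e))) (at x)"
    unfolding pq by (auto intro!: derivative_eq_intros simp: algebra_simps)
  show "grad (\<lambda>x. Re (phase a x)) x = (- Im (phase a x) * (2 / rad2 x)) *\<^sub>R rot_gen x"
    unfolding Re_phase
  proof (rule grad_eqI[OF has_derivative_mult[OF D dRe]])
    fix h
    define u v where uv: "u = h \<bullet> e" "v = h \<bullet> f"
    have "rad2 x * (2 * p * u - 2 * q * v) - (2 * p * u + 2 * q * v) * (p\<^sup>2 - q\<^sup>2) =
        - (2 * p * q) * 2 * (p * v - q * u)"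
      unfolding r by algebra
    then have "(rad2 x * (2 * p * u - 2 * q * v) - (2 * p * u + 2 * q * v) * (p\<^sup>2 - q\<^sup>2)) / (rad2 x)\<^sup>2 =
        (- (2 * p * q) * 2 * (p * v - q * u)) / (rad2 x)\<^sup>2"
      by simp
    moreover have "(rad2 x * (2 * p * u - 2 * q * v) - (2 * p * u + 2 * q * v) * (p\<^sup>2 - q\<^sup>2)) / (rad2 x)\<^sup>2 =
        1 / rad2 x * (2 * p * u - 2 * q * v) + - ((2 * p * u + 2 * q * v) / (rad2 x)\<^sup>2) * (p\<^sup>2 - q\<^sup>2)"
      using r(2) by (simp add: diff_divide_distrib power2_eq_square)
    moreover have "(- (2 * p * q) * 2 * (p * v - q * u)) / (rad2 x)\<^sup>2 =
        (- (1 / rad2 x * (2 * p * q)) * (2 / rad2 x)) * (p * v - q * u)"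
      by (simp add: power2_eq_square)
    ultimately show "inv_rad2 a x * (2 * p * (h \<bullet> e) - 2 * q * (h \<bullet> f)) +
          - ((2 * p * (h \<bullet> e) + 2 * q * (h \<bullet> f)) / (rad2 x)\<^sup>2) * ((x \<bullet> e)\<^sup>2 - (x \<bullet> f)\<^sup>2) =
         ((- Im (phase a x) * (2 / rad2 x)) *\<^sub>R rot_gen x) \<bullet> h"
      unfolding Im_phase w rot_gen_def inner_scaleR_left inner_diff_left pq[symmetric]
        inner_commute[of e h] inner_commute[of f h] uv[symmetric]
      by simp
  qed
  show "grad (\<lambda>x. Im (phase a x)) x = (Re (phase a x) * (2 / rad2 x)) *\<^sub>R rot_gen x"
    unfolding Im_phase
  proof (rule grad_eqI[OF has_derivative_mult[OF D dIm]])
    fix h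
    define u v where uv: "u = h \<bullet> e" "v = h \<bullet> f"
    have "rad2 x * (2 * p * v + 2 * q * u) - (2 * p * u + 2 * q * v) * (2 * p * q) =
        (p\<^sup>2 - q\<^sup>2) * 2 * (p * v - q * u)"
      unfolding r by algebra
    then have "(rad2 x * (2 * p * v + 2 * q * u) - (2 * p * u + 2 * q * v) * (2 * p * q)) / (rad2 x)\<^sup>2 =
        ((p\<^sup>2 - q\<^sup>2) * 2 * (p * v - q * u)) / (rad2 x)\<^sup>2"
      by simp
    moreover have "(rad2 x * (2 * p * v + 2 * q * u) - (2 * p * u + 2 * q * v) * (2 * p * q)) / (rad2 x)\<^sup>2 =
        1 / rad2 x * (2 * p * v + 2 * q * u) + - ((2 * p * u + 2 * q * v) / (rad2 x)\<^sup>2) * (2 * p * q)"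
      using r(2) by (simp add: diff_divide_distrib power2_eq_square)
    moreover have "((p\<^sup>2 - q\<^sup>2) * 2 * (p * v - q * u)) / (rad2 x)\<^sup>2 =
        ((1 / rad2 x * (p\<^sup>2 - q\<^sup>2)) * (2 / rad2 x)) * (p * v - q * u)"
      by (simp add: power2_eq_square)
    ultimately show "inv_rad2 a x * (2 * p * (h \<bullet> f) + 2 * q * (h \<bullet> e)) +
          - ((2 * p * (h \<bullet> e) + 2 * q * (h \<bullet> f)) / (rad2 x)\<^sup>2) * (2 * (x \<bullet> e) * (x \<bullet> f)) =
         ((Re (phase a x) * (2 / rad2 x)) *\<^sub>R rot_gen x) \<bullet> h"
      unfolding Re_phase w rot_gen_def inner_scaleR_left inner_diff_left pq[symmetric]
        inner_commute[of e h] inner_commute[of f h] uv[symmetric]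
      by simp
  qed
qed

lemma grad_phase_power:
  assumes a: "a > 0" "rad2 x \<ge> a"
  shows "grad (\<lambda>x. Re (phase a x ^ m)) x = (- (real m * Im (phase a x ^ m) * (2 / rad2 x))) *\<^sub>R rot_gen x \<and>
    grad (\<lambda>x. Im (phase a x ^ m)) x = (real m * Re (phase a x ^ m) * (2 / rad2 x)) *\<^sub>R rot_gen x"
proof (induction m)
  case 0
  have "grad (\<lambda>x. c) x = 0" for c :: real by (rule grad_eqI[of _ "\<lambda>_. 0"]) auto
  then show ?case by simp
next
  case (Suc m)
  define C S P Q \<alpha> where d: "C = Re (phase a x)" "S = Im (phase a x)" "P = Re (phase a x ^ m)"
    "Q = Im (phase a x ^ m)" "\<alpha> = 2 / rad2 x"
  note s1 = smooth_phase_power[OF a(1), of 1, simplified] and sm = smooth_phase_power[OF a(1), of m]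
  note g1 = grad_phase[OF a, folded d] and IH = Suc.IH[folded d]
  have "grad (\<lambda>x. Re (phase a x ^ Suc m)) x = grad (\<lambda>x. Re (phase a x) * Re (phase a x ^ m) - Im (phase a x) * Im (phase a x ^ m)) x"
    by simp
  also have "\<dots> = (C *\<^sub>R ((- (real m * Q * \<alpha>)) *\<^sub>R rot_gen x) + P *\<^sub>R ((- S * \<alpha>) *\<^sub>R rot_gen x))
     - (S *\<^sub>R ((real m * P * \<alpha>) *\<^sub>R rot_gen x) + Q *\<^sub>R ((C * \<alpha>) *\<^sub>R rot_gen x))"
    using IH by (simp add: grad_diff grad_mult smooth_mult s1 sm g1 d[symmetric])
  also have "\<dots> = (- (real (Suc m) * (C * Q + S * P) * \<alpha>)) *\<^sub>R rot_gen x"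
    unfolding scaleR_scaleR scaleR_add_left[symmetric] scaleR_diff_left[symmetric]
    by (intro arg_cong2[where f = "(*\<^sub>R)"] refl) (simp add: algebra_simps)
  finally have 1: "grad (\<lambda>x. Re (phase a x ^ Suc m)) x = (- (real (Suc m) * Im (phase a x ^ Suc m) * \<alpha>)) *\<^sub>R rot_gen x"
    by (simp add: d)
  have "grad (\<lambda>x. Im (phase a x ^ Suc m)) x = grad (\<lambda>x. Re (phase a x) * Im (phase a x ^ m) + Im (phase a x) * Re (phase a x ^ m)) x"
    by simp
  also have "\<dots> = (C *\<^sub>R ((real m * P * \<alpha>) *\<^sub>R rot_gen x) + Q *\<^sub>R ((- S * \<alpha>) *\<^sub>R rot_gen x))
     + (S *\<^sub>R ((- (real m * Q * \<alpha>)) *\<^sub>R rot_gen x) + P *\<^sub>R ((C * \<alpha>) *\<^sub>R rot_gen x))"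
    using IH by (simp add: grad_add grad_mult smooth_mult s1 sm g1 d[symmetric])
  also have "\<dots> = (real (Suc m) * (C * P - S * Q) * \<alpha>) *\<^sub>R rot_gen x"
    unfolding scaleR_scaleR scaleR_add_left[symmetric] scaleR_diff_left[symmetric]
    by (intro arg_cong2[where f = "(*\<^sub>R)"] refl) (simp add: algebra_simps)
  finally have 2: "grad (\<lambda>x. Im (phase a x ^ Suc m)) x = (real (Suc m) * Re (phase a x ^ Suc m) * \<alpha>) *\<^sub>R rot_gen x"
    by (simp add: d)
  show ?case using 1 2 by (simp add: d)
qed

lemma rad2_rot: "rad2 (rot t x) = rad2 x"
proof -
  have "rad2 (rot t x) = ((cos t)\<^sup>2 + (sin t)\<^sup>2) * rad2 x"
    unfolding rad2_def rot_inner by algebra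
  then show ?thesis by simp
qed

lemma phase_rot: "phase a (rot t x) = cis (2 * t) * phase a x"
proof -
  have "Complex (rot t x \<bullet> e) (rot t x \<bullet> f) = cis t * Complex (x \<bullet> e) (x \<bullet> f)"
    by (simp add: complex_eq_iff rot_inner)
  then show ?thesis
    by (simp add: phase_def inv_rad2_def rad2_rot power_mult_distrib cis_mult power2_eq_square)
qed

lemma norm_rot_gen: "(norm (rot_gen x))\<^sup>2 = rad2 x"
  unfolding power2_norm_eq_inner
  by (simp add: rot_gen_def rad2_def inner_diff_left inner_diff_right ee ff ef fe power2_eq_square)

text \<open>A cutoff to the part of the ball of radius \<open>sqrt b\<close> outside the cylinder \<open>rad2 \<le> a\<close>.\<close>

definition rim :: "real \<Rightarrow> real \<Rightarrow> 'a \<Rightarrow> real" where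
  "rim a b x = bump (rad2 x - a) * bump (b - (norm x)\<^sup>2)"

lemma rim_test:
  assumes "b < 1" "smooth h"
  shows "(\<lambda>x. h x * rim a b x) \<in> test_functions (ball 0 1)"
proof (rule test_functionsI)
  show "smooth (\<lambda>x. h x * rim a b x)"
    unfolding rim_def
    by (intro smooth_mult assms smooth_flat smooth_diff smooth_const smooth_rad2 smooth_norm_sq)
  show "compact (cball (0::'a) (sqrt b))" by simp
  show "cball 0 (sqrt b) \<subseteq> ball (0::'a) 1" 
  proof -
    have "sqrt b < 1" using assms by simp
    then have "norm x < 1" if "norm x \<le> sqrt b" for x :: 'a using that by (rule le_less_trans[rotated])
    then show ?thesis by auto
  qed
  fix x :: 'a assume "x \<notin> cball 0 (sqrt b)"
  then have "sqrt b < norm x" by simp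
  then have "b \<le> (norm x)\<^sup>2" using sqrt_le_D[of b "norm x"] by simp
  then show "h x * rim a b x = 0" by (simp add: rim_def bump_zero_iff)
qed

lemma smooth_rim: "smooth (rim a b)"
  unfolding rim_def by (intro smooth_mult smooth_flat smooth_diff smooth_const smooth_rad2 smooth_norm_sq)

lemma rim_outside:
  assumes "rad2 x < a"
  shows "rim a b x = 0" "grad (rim a b) x = 0"
proof -
  have s: "smooth (\<lambda>x. bump (rad2 x - a))" "smooth (\<lambda>x. bump (b - (norm x)\<^sup>2))"
    by (intro smooth_flat smooth_diff smooth_const smooth_rad2 smooth_norm_sq)+
  have 0: "bump (rad2 x - a) = 0" using assms by (simp add: bump_zero_iff)
  then show "rim a b x = 0" by (simp add: rim_def)
  have "grad (\<lambda>x. bump (rad2 x - a)) x = flat (flat_deriv 1) (rad2 x - a) *\<^sub>R grad (\<lambda>x. rad2 x - a) x"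
    by (rule grad_real_compose[OF flat_has_derivative]) (intro smooth_diff smooth_const smooth_rad2)
  then have "grad (\<lambda>x. bump (rad2 x - a)) x = 0" using assms by (simp add: flat_def)
  then show "grad (rim a b) x = 0"
    unfolding rim_def grad_mult[OF s] by (simp add: 0)
qed

text \<open>For the cosine and sine waves together the cross terms between the gradients of the cutoff and of the
  phase cancel, because \<open>cos\<^sup>2 + sin\<^sup>2\<close> is constant.\<close>

lemma rim_wave_pointwise:
  fixes m :: nat
  assumes a: "0 < a" "b < 1"
  defines "\<phi> \<equiv> \<lambda>x. Re (phase a x ^ m) * rim a b x" and "\<psi> \<equiv> \<lambda>x. Im (phase a x ^ m) * rim a b x"
  shows "(\<phi> x)\<^sup>2 + (\<psi> x)\<^sup>2 = (rim a b x)\<^sup>2"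
    "(norm (grad \<phi> x))\<^sup>2 + (norm (grad \<psi> x))\<^sup>2 \<le> (norm (grad (rim a b) x))\<^sup>2 + (2 * real m)\<^sup>2 / a * (rim a b x)\<^sup>2"
proof -
  define P Q where PQ: "P = Re (phase a x ^ m)" "Q = Im (phase a x ^ m)"
  note s = smooth_phase_power[OF a(1), of m]
  have g: "grad \<phi> x = P *\<^sub>R grad (rim a b) x + rim a b x *\<^sub>R grad (\<lambda>x. Re (phase a x ^ m)) x"
    "grad \<psi> x = Q *\<^sub>R grad (rim a b) x + rim a b x *\<^sub>R grad (\<lambda>x. Im (phase a x ^ m)) x"
    unfolding \<phi>_def \<psi>_def PQ by (rule grad_mult[OF s(1) smooth_rim] grad_mult[OF s(2) smooth_rim])+
  have "(\<phi> x)\<^sup>2 + (\<psi> x)\<^sup>2 = (rim a b x)\<^sup>2 \<and>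
    (norm (grad \<phi> x))\<^sup>2 + (norm (grad \<psi> x))\<^sup>2 \<le> (norm (grad (rim a b) x))\<^sup>2 + (2 * real m)\<^sup>2 / a * (rim a b x)\<^sup>2"
  proof (cases "rad2 x < a")
    case True
    then show ?thesis unfolding g by (simp add: rim_outside \<phi>_def \<psi>_def)
  next
    case False
    then have ra: "rad2 x \<ge> a" by simp
    have "cmod (phase a x ^ m) = 1" using cmod_phase[OF a(1) ra] by (simp add: norm_power)
    then have 1: "P\<^sup>2 + Q\<^sup>2 = 1" by (simp add: PQ cmod_def)
    define c where "c = rim a b x"
    define v where "v = grad (rim a b) x"
    define w where "w = (real m * (2 / rad2 x)) *\<^sub>R rot_gen x"
    have g': "grad \<phi> x = P *\<^sub>R v - (c * Q) *\<^sub>R w" "grad \<psi> x = Q *\<^sub>R v + (c * P) *\<^sub>R w"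
      unfolding g using grad_phase_power[OF a(1) ra, of m]
      by (simp_all add: PQ c_def v_def w_def mult.assoc mult.left_commute)
    have "(norm (grad \<phi> x))\<^sup>2 + (norm (grad \<psi> x))\<^sup>2 = (P\<^sup>2 + Q\<^sup>2) * (v \<bullet> v) + (P\<^sup>2 + Q\<^sup>2) * c\<^sup>2 * (w \<bullet> w)"
      unfolding g' power2_norm_eq_inner
      by (simp add: inner_add_left inner_add_right inner_diff_left inner_diff_right inner_commute[of w v]
          power2_eq_square algebra_simps)
    also have "\<dots> = (norm v)\<^sup>2 + c\<^sup>2 * (norm w)\<^sup>2" by (simp add: 1 power2_norm_eq_inner)
    also have "(norm w)\<^sup>2 = (2 * real m)\<^sup>2 / rad2 x"
      using ra a by (simp add: w_def power_mult_distrib norm_rot_gen power_divide) (simp add: power2_eq_square)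
    also have "(2 * real m)\<^sup>2 / rad2 x \<le> (2 * real m)\<^sup>2 / a"
      using ra a by (intro divide_left_mono) auto
    finally have "(norm (grad \<phi> x))\<^sup>2 + (norm (grad \<psi> x))\<^sup>2 \<le> (norm v)\<^sup>2 + c\<^sup>2 * ((2 * real m)\<^sup>2 / a)"
      by (simp add: mult_left_mono)
    moreover have "(\<phi> x)\<^sup>2 + (\<psi> x)\<^sup>2 = (P\<^sup>2 + Q\<^sup>2) * c\<^sup>2"
      by (simp add: \<phi>_def \<psi>_def PQ c_def power_mult_distrib algebra_simps)
    ultimately show ?thesis by (simp add: 1 c_def v_def mult.commute)
  qed
  then show "(\<phi> x)\<^sup>2 + (\<psi> x)\<^sup>2 = (rim a b x)\<^sup>2"
    "(norm (grad \<phi> x))\<^sup>2 + (norm (grad \<psi> x))\<^sup>2 \<le> (norm (grad (rim a b) x))\<^sup>2 + (2 * real m)\<^sup>2 / a * (rim a b x)\<^sup>2"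
    by auto
qed

lemma rim_nontrivial:
  assumes "0 < a" "a < b" "b < 1"
  shows "L2norm (lebesgue_on (ball 0 1)) (rim a b) > 0"
proof (rule ccontr)
  let ?M = "lebesgue_on (ball (0::'a) 1)"
  have t: "rim a b \<in> test_functions (ball 0 1)" using rim_test[OF assms(3) smooth_const[of 1]] by simp
  assume "\<not> L2norm ?M (rim a b) > 0"
  then have "L2norm ?M (rim a b) = 0" using L2norm_nonneg[of ?M "rim a b"] by linarith
  then have "AE x in ?M. rim a b x = 0" by (rule L2norm_eq_0[OF L2_test(1)[OF t]])
  then have "AE x in lebesgue. x \<in> ball 0 1 \<longrightarrow> rim a b x = 0" by (subst (asm) AE_restrict_space_iff) auto
  then have "AE x in lebesgue. rim a b x = 0"
    by eventually_elim (use test_functions_outside[OF t] in blast)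
  moreover have o: "open {x. rim a b x \<noteq> 0}"
    using continuous_smooth[OF smooth_rim] by (intro open_Collect_neq) auto
  ultimately have "negligible {x. rim a b x \<noteq> 0}"
    unfolding negligible_iff_null_sets by (subst AE_iff_null_sets) auto
  moreover have "sqrt ((a + b) / 2) *\<^sub>R e \<in> {x. rim a b x \<noteq> 0}"
  proof -
    let ?x = "sqrt ((a + b) / 2) *\<^sub>R e"
    have "rad2 ?x = (a + b) / 2" "(norm ?x)\<^sup>2 = (a + b) / 2"
      using assms by (simp_all add: rad2_def ee ef power_mult_distrib power2_norm_eq_inner del: norm_scaleR)
    then have "rad2 ?x - a > 0" "b - (norm ?x)\<^sup>2 > 0" using assms by (auto simp: field_simps)
    then show ?thesis using bump_pos_iff by (simp add: rim_def bump_zero_iff not_le)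
  qed
  ultimately show False using open_not_negligible[OF o] by blast
qed

text \<open>As \<open>a\<close> tends to \<open>1\<close> the waves live where \<open>rad2\<close> is close to \<open>1\<close>, and there the angular part of the
  Rayleigh quotient is about \<open>n\<^sup>2\<close> with \<open>n = 2 m\<close>. The radial part does not depend on \<open>m\<close>, hence it is negligible
  for large \<open>m\<close>. Of the cosine and the sine wave, at least one is not worse than their average.\<close>

lemma exists_low_Rayleigh:
  assumes "\<epsilon> > 0"
  obtains m :: nat and \<phi> where "m \<ge> N" "m \<ge> 1" "\<phi> \<in> test_functions (ball 0 1)"
    "\<And>x. \<phi> (rot (pi / real (2 * m)) x) = - \<phi> x"
    "(L2norm (lebesgue_on (ball 0 1)) (grad \<phi>))\<^sup>2 < (1 + \<epsilon>) * (real (2 * m))\<^sup>2 * (L2norm (lebesgue_on (ball 0 1)) \<phi>)\<^sup>2"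
proof -
  let ?M = "lebesgue_on (ball (0::'a) 1)"
  \<comment> \<open>Half of \<open>\<epsilon>\<close> pays for \<open>1 / a > 1\<close>, the other half for the gradient of the cutoff.\<close>
  define a where "a = 1 / (1 + \<epsilon> / 2)"
  define b where "b = (a + 1) / 2"
  have "0 < a" "a < 1" using assms by (simp_all add: a_def)
  then have ab: "0 < a" "a < b" "b < 1" by (auto simp: b_def)
  have t: "rim a b \<in> test_functions (ball 0 1)" using rim_test[OF ab(3) smooth_const[of 1]] by simp
  define X where "X = (L2norm ?M (rim a b))\<^sup>2"
  define Y where "Y = (L2norm ?M (grad (rim a b)))\<^sup>2"
  have X: "X > 0" using rim_nontrivial[OF ab] by (simp add: X_def)
  obtain m0 :: nat where m0: "2 * Y / (\<epsilon> * X) < real m0" using reals_Archimedean2 by blast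
  define m where "m = max m0 (max N 1)"
  have m: "m \<ge> N" "m \<ge> 1" "m \<ge> m0" by (auto simp: m_def)
  define n where "n = real (2 * m)"
  have nY: "Y < \<epsilon> / 2 * n\<^sup>2 * X"
  proof -
    have "2 * Y / (\<epsilon> * X) < real m" using m0 m(3) by linarith
    also have "\<dots> \<le> n\<^sup>2"
      using m(2) by (simp add: n_def power2_eq_square)
    finally show ?thesis using assms X by (simp add: field_simps)
  qed
  define \<phi> where "\<phi> x = Re (phase a x ^ m) * rim a b x" for x
  define \<psi> where "\<psi> x = Im (phase a x ^ m) * rim a b x" for x
  note pw = rim_wave_pointwise[OF ab(1,3), where m = m, folded \<phi>_def \<psi>_def]
  have T: "\<phi> \<in> test_functions (ball 0 1)" "\<psi> \<in> test_functions (ball 0 1)"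
    unfolding \<phi>_def \<psi>_def by (intro rim_test ab smooth_phase_power)+
  have anti: "\<phi> (rot (pi / n) x) = - \<phi> x" "\<psi> (rot (pi / n) x) = - \<psi> x" for x
  proof -
    have "phase a (rot (pi / n) x) ^ m = cis (real m * (2 * (pi / n))) * phase a x ^ m"
      by (simp only: phase_rot power_mult_distrib Complex.DeMoivre)
    also have "real m * (2 * (pi / n)) = pi" using m(2) by (simp add: n_def)
    finally have "phase a (rot (pi / n) x) ^ m = - (phase a x ^ m)" by simp
    then show "\<phi> (rot (pi / n) x) = - \<phi> x" "\<psi> (rot (pi / n) x) = - \<psi> x"
      by (simp_all add: \<phi>_def \<psi>_def rim_def rad2_rot)
  qed
  have int: "integrable ?M (\<lambda>x. (norm (u x))\<^sup>2)" "integrable ?M (\<lambda>x. (norm (grad u x))\<^sup>2)"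
    if "u \<in> test_functions (ball 0 1)" for u :: "'a \<Rightarrow> real"
    using L2_test[OF that] by (auto simp: L2_def)
  have "(L2norm ?M \<phi>)\<^sup>2 + (L2norm ?M \<psi>)\<^sup>2 = X"
    unfolding X_def L2norm_sq using int(1)[OF T(1)] int(1)[OF T(2)]
    by (subst Bochner_Integration.integral_add[symmetric]) (auto simp: pw(1))
  moreover have "(L2norm ?M (grad \<phi>))\<^sup>2 + (L2norm ?M (grad \<psi>))\<^sup>2 \<le> Y + n\<^sup>2 / a * X"
  proof -
    have "(L2norm ?M (grad \<phi>))\<^sup>2 + (L2norm ?M (grad \<psi>))\<^sup>2 =
        (LINT x|?M. (norm (grad \<phi> x))\<^sup>2 + (norm (grad \<psi> x))\<^sup>2)"
      unfolding L2norm_sq using int(2)[OF T(1)] int(2)[OF T(2)] by simp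
    also have "\<dots> \<le> (LINT x|?M. (norm (grad (rim a b) x))\<^sup>2 + n\<^sup>2 / a * (norm (rim a b x))\<^sup>2)"
      using int[OF T(1)] int[OF T(2)] int[OF t] pw(2)
      by (intro integral_mono Bochner_Integration.integrable_add integrable_mult_right) (auto simp: n_def)
    also have "\<dots> = Y + n\<^sup>2 / a * X"
      unfolding X_def Y_def L2norm_sq using int[OF t] by simp
    finally show ?thesis .
  qed
  moreover have "n\<^sup>2 / a * X = (1 + \<epsilon> / 2) * n\<^sup>2 * X" by (simp add: a_def)
  ultimately have "(L2norm ?M (grad \<phi>))\<^sup>2 + (L2norm ?M (grad \<psi>))\<^sup>2 <
      (1 + \<epsilon>) * n\<^sup>2 * ((L2norm ?M \<phi>)\<^sup>2 + (L2norm ?M \<psi>)\<^sup>2)"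
    using nY by (simp add: algebra_simps)
  then consider "(L2norm ?M (grad \<phi>))\<^sup>2 < (1 + \<epsilon>) * n\<^sup>2 * (L2norm ?M \<phi>)\<^sup>2"
    | "(L2norm ?M (grad \<psi>))\<^sup>2 < (1 + \<epsilon>) * n\<^sup>2 * (L2norm ?M \<psi>)\<^sup>2"
    by (simp only: distrib_left) linarith
  then show ?thesis
  proof cases
    case 1
    then show ?thesis using that[OF m(1,2) T(1)] anti(1) by (simp add: n_def)
  next
    case 2
    then show ?thesis using that[OF m(1,2) T(2)] anti(2) by (simp add: n_def)
  qed
qed

end

section \<open>Minimisation in the antiperiodic class\<close>

context plane
begin

text \<open>The symmetry class: with \<open>n = 2 m\<close>, these functions are antiperiodic with antiperiod \<open>pi / n\<close> in the angle.
  Only even \<open>n\<close> occur because \<open>phase\<close> rotates with twice the angle.\<close>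

definition odd_tests :: "nat \<Rightarrow> ('a \<Rightarrow> real) set" where
  "odd_tests m = {\<phi> \<in> test_functions (ball 0 1). \<forall>x. \<phi> (rot (pi / real (2 * m)) x) = - \<phi> x}"

lemma odd_testsD: "\<phi> \<in> odd_tests m \<Longrightarrow> \<phi> \<in> test_functions (ball 0 1)"
  "\<phi> \<in> odd_tests m \<Longrightarrow> \<phi> (rot (pi / real (2 * m)) x) = - \<phi> x"
  by (auto simp: odd_tests_def)

lemma odd_tests_0: "(\<lambda>x. 0) \<in> odd_tests m"
  by (simp add: odd_tests_def test_functions_0)

lemma odd_tests_add: "\<phi> \<in> odd_tests m \<Longrightarrow> \<psi> \<in> odd_tests m \<Longrightarrow> (\<lambda>x. \<phi> x + \<psi> x) \<in> odd_tests m"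
  by (simp add: odd_tests_def test_functions_add)

lemma odd_tests_cmult: "\<phi> \<in> odd_tests m \<Longrightarrow> (\<lambda>x. c * \<phi> x) \<in> odd_tests m"
  by (simp add: odd_tests_def test_functions_cmult)

lemma L2_indicator:
  fixes v :: "'a \<Rightarrow> 'b::euclidean_space"
  assumes v: "L2 (lebesgue_on (ball 0 1)) v" and A: "A \<in> sets borel"
  shows "L2 (lebesgue_on (ball 0 1)) (\<lambda>x. indicator A x *\<^sub>R v x)"
proof -
  let ?M = "lebesgue_on (ball (0::'a) 1)"
  have AM: "A \<inter> ball 0 1 \<in> sets ?M" using A by (simp add: sets_restrict_space_iff)
  have "(\<lambda>x. indicator A x *\<^sub>R v x) \<in> borel_measurable ?M \<longleftrightarrow>
      (\<lambda>x. indicator (A \<inter> ball 0 1) x *\<^sub>R v x) \<in> borel_measurable ?M"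
    by (rule measurable_cong) (simp add: space_restrict_space indicator_def)
  then have "(\<lambda>x. indicator A x *\<^sub>R v x) \<in> borel_measurable ?M"
    using borel_measurable_scaleR[OF borel_measurable_indicator[OF AM] L2_measurable[OF v]] by simp
  then show ?thesis by (rule L2norm_mono(1)[OF _ v]) (simp add: indicator_def)
qed

text \<open>Taking for \<open>A\<close> a ball, its complement or the whole space gives the inequality with the best constant
  \<open>c\<close> that \<open>A\<close> permits.\<close>

lemma odd_tests_Poincare:
  assumes \<phi>: "\<phi> \<in> odd_tests m" and m: "m \<ge> 1"
    and A: "A \<in> sets borel" "\<And>t x. rot t x \<in> A \<longleftrightarrow> x \<in> A" and c: "\<And>x. x \<in> A \<Longrightarrow> norm x < 1 \<Longrightarrow> norm x \<le> c" "0 \<le> c"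
  shows "(real (2 * m))\<^sup>2 * (L2norm (lebesgue_on (ball 0 1)) (\<lambda>x. indicator A x *\<^sub>R \<phi> x))\<^sup>2
    \<le> c\<^sup>2 * (L2norm (lebesgue_on (ball 0 1)) (\<lambda>x. indicator A x *\<^sub>R grad \<phi> x))\<^sup>2"
proof -
  let ?M = "lebesgue_on (ball (0::'a) 1)"
  define n where "n = real (2 * m)"
  have n: "n > 0" using m by (simp add: n_def)
  have t: "\<phi> \<in> test_functions (ball 0 1)" using odd_testsD(1)[OF \<phi>] .
  have L: "L2 ?M (\<lambda>x. indicator A x *\<^sub>R \<phi> x)" "L2 ?M (\<lambda>x. indicator A x *\<^sub>R grad \<phi> x)"
    by (intro L2_indicator L2_test[OF t] A)+
  have eq: "(\<integral>\<^sup>+x. indicator A x * ennreal ((norm (v x))\<^sup>2) \<partial>lborel) =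
      ennreal ((L2norm ?M (\<lambda>x. indicator A x *\<^sub>R v x))\<^sup>2)"
    if "L2 ?M (\<lambda>x. indicator A x *\<^sub>R v x)" "\<And>x. x \<notin> ball 0 1 \<Longrightarrow> v x = 0" for v :: "'a \<Rightarrow> 'b::euclidean_space"
  proof -
    have "(\<integral>\<^sup>+x. indicator A x * ennreal ((norm (v x))\<^sup>2) \<partial>lborel) =
        (\<integral>\<^sup>+x. indicator A x * ennreal ((norm (v x))\<^sup>2) \<partial>?M)"
      using that(2) by (subst nn_integral_lebesgue_on_eq) auto
    also have "\<dots> = (\<integral>\<^sup>+x. ennreal ((norm (indicator A x *\<^sub>R v x))\<^sup>2) \<partial>?M)"
      by (intro nn_integral_cong) (simp add: indicator_def)
    also have "\<dots> = ennreal ((L2norm ?M (\<lambda>x. indicator A x *\<^sub>R v x))\<^sup>2)"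
      using that(1) by (subst nn_integral_eq_integral) (auto simp: L2_def L2norm_sq)
    finally show ?thesis .
  qed
  have "ennreal (n\<^sup>2) * (\<integral>\<^sup>+x. indicator A x * ennreal ((norm (\<phi> x))\<^sup>2) \<partial>lborel)
    \<le> (\<integral>\<^sup>+x. indicator A x * ennreal ((norm x)\<^sup>2 * (norm (grad \<phi> x))\<^sup>2) \<partial>lborel)"
    using angular_Poincare[OF test_functions_smooth[OF t] n _ A] odd_testsD(2)[OF \<phi>]
    by (simp add: n_def)
  also have "\<dots> \<le> (\<integral>\<^sup>+x. ennreal (c\<^sup>2) * (indicator A x * ennreal ((norm (grad \<phi> x))\<^sup>2)) \<partial>lborel)"
  proof (rule nn_integral_mono)
    fix x
    show "indicator A x * ennreal ((norm x)\<^sup>2 * (norm (grad \<phi> x))\<^sup>2) \<le>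
        ennreal (c\<^sup>2) * (indicator A x * ennreal ((norm (grad \<phi> x))\<^sup>2))"
    proof (cases "x \<in> A \<and> x \<in> ball 0 1")
      case True
      then have "(norm x)\<^sup>2 \<le> c\<^sup>2" using c by (intro power_mono) auto
      then have "(norm x)\<^sup>2 * (norm (grad \<phi> x))\<^sup>2 \<le> c\<^sup>2 * (norm (grad \<phi> x))\<^sup>2" by (intro mult_right_mono) auto
      then show ?thesis using True by (simp add: ennreal_mult'[symmetric] ennreal_leI)
    next
      case False
      then show ?thesis using test_functions_outside(2)[OF t, of x] by (auto simp: indicator_def)
    qed
  qed
  also have "\<dots> = ennreal (c\<^sup>2) * (\<integral>\<^sup>+x. indicator A x * ennreal ((norm (grad \<phi> x))\<^sup>2) \<partial>lborel)"
    using A(1) grad_measurable[OF test_functions_smooth[OF t]]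
    by (intro nn_integral_cmult borel_measurable_times_ennreal borel_measurable_indicator) auto
  finally have "ennreal (n\<^sup>2 * (L2norm ?M (\<lambda>x. indicator A x *\<^sub>R \<phi> x))\<^sup>2)
      \<le> ennreal (c\<^sup>2 * (L2norm ?M (\<lambda>x. indicator A x *\<^sub>R grad \<phi> x))\<^sup>2)"
    using eq[OF L(1) test_functions_outside(1)[OF t]] eq[OF L(2) test_functions_outside(2)[OF t]]
    by (simp add: ennreal_mult')
  then show ?thesis by (simp add: n_def)
qed

lemma test_rot:
  assumes "v \<in> test_functions (ball 0 1)"
  shows "(\<lambda>x. v (rot t x)) \<in> test_functions (ball 0 1)"
proof -
  obtain K where K: "smooth v" "compact K" "K \<subseteq> ball 0 1" "\<And>x. x \<notin> K \<Longrightarrow> v x = 0"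
    "\<And>x. x \<notin> K \<Longrightarrow> grad v x = 0" by (rule test_functionsE[OF assms]) (rule that)
  show ?thesis
  proof (rule test_functionsI)
    show "smooth (\<lambda>x. v (rot t x))" by (rule smooth_linear_compose[OF linear_rot K(1)])
    have "continuous_on K (rot (- t))" unfolding rot_def by (intro continuous_intros)
    then show "compact (rot (- t) ` K)" using K(2) by (rule compact_continuous_image)
    show "rot (- t) ` K \<subseteq> ball 0 1" using K(3) by auto
    fix x assume x: "x \<notin> rot (- t) ` K"
    have "x = rot (- t) (rot t x)" using rot_add[of "- t" t x] by simp
    then have "rot t x \<notin> K" using x by blast
    then show "v (rot t x) = 0" by (rule K(4))
  qed
qed

end

text \<open>The assumptions on the density each have one purpose: the bound on \<open>g\<close> makes the lower order part of
  the energy Lipschitz for convergence in mean, the lower bound on \<open>G\<close> keeps gradients bounded along minimising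
  sequences, and oddness of \<open>g\<close> lets the first variation change sign under the generating rotation.\<close>

locale truncated_energy = plane e f for e f :: "'a::euclidean_space" +
  fixes G g :: "real \<Rightarrow> real" and C c0 :: real and m :: nat
  assumes G_deriv: "\<And>s. (G has_real_derivative g s) (at s)"
    and g_cont: "continuous_on UNIV g"
    and g_bound: "\<And>s. \<bar>g s\<bar> \<le> C"
    and g_odd: "\<And>s. g (- s) = - g s"
    and G_lower: "\<And>s. - c0 \<le> G s"
    and m: "m \<ge> 1"
begin

abbreviation M :: "'a measure" where "M \<equiv> lebesgue_on (ball 0 1)"

definition energy_functional :: "('a \<Rightarrow> real) \<Rightarrow> ('a \<Rightarrow> 'a) \<Rightarrow> real" where
  "energy_functional u \<gamma> = (L2norm M \<gamma>)\<^sup>2 / 2 + (LINT x|M. G (u x))"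

lemma C_nonneg: "0 \<le> C" using g_bound[of 0] by linarith

lemma G_Lipschitz: "\<bar>G a - G b\<bar> \<le> C * \<bar>a - b\<bar>"
proof -
  have "norm (G a - G b) \<le> C * norm (a - b)"
    by (rule field_differentiable_bound[of UNIV G g])
      (auto intro: has_field_derivative_at_within G_deriv g_bound)
  then show ?thesis by simp
qed

lemma fin: "finite_measure M" by simp

lemma L2_G: "L2 M u \<Longrightarrow> L2 M (\<lambda>x. G (u x))"
  by (rule L2lim_Lipschitz_integral(2)[OF fin L2lim_const G_Lipschitz])

lemma integrable_G: "L2 M u \<Longrightarrow> integrable M (\<lambda>x. G (u x))"
  by (rule L2_integrable[OF fin L2_G])

lemma G_integral_Lipschitz:
  assumes "L2 M u" "L2 M v"
  shows "\<bar>(LINT x|M. G (u x)) - (LINT x|M. G (v x))\<bar> \<le> C * L2norm M (\<lambda>_. 1::real) * L2norm M (\<lambda>x. u x - v x)"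
proof -
  have one: "L2 M (\<lambda>_. 1::real)" by (rule L2_bounded[OF fin, where C = 1]) auto
  have d: "L2 M (\<lambda>x. G (u x) - G (v x))" by (intro L2_diff L2_G assms)
  have "L2norm M (\<lambda>x. G (u x) - G (v x)) \<le> L2norm M (\<lambda>x. C *\<^sub>R (u x - v x))"
    by (rule L2norm_mono(2)[OF L2_measurable[OF d] L2_scaleR[OF L2_diff[OF assms]]])
      (use G_Lipschitz C_nonneg in \<open>auto simp: abs_mult\<close>)
  then have 1: "L2norm M (\<lambda>x. G (u x) - G (v x)) \<le> C * L2norm M (\<lambda>x. u x - v x)"
    using C_nonneg by (simp only: L2norm_scaleR abs_of_nonneg)
  have "(LINT x|M. G (u x)) - (LINT x|M. G (v x)) = (LINT x|M. (G (u x) - G (v x)) \<bullet> 1)"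
    using integrable_G assms by simp
  also have "\<bar>\<dots>\<bar> \<le> L2norm M (\<lambda>x. G (u x) - G (v x)) * L2norm M (\<lambda>_. 1::real)"
    by (rule L2_Cauchy_Schwarz[OF d one])
  also have "\<dots> \<le> (C * L2norm M (\<lambda>x. u x - v x)) * L2norm M (\<lambda>_. 1::real)"
    by (intro mult_right_mono 1) auto
  finally show ?thesis by (simp add: ac_simps)
qed

lemma energy_functional_lower:
  assumes "L2 M u"
  shows "(L2norm M \<gamma>)\<^sup>2 / 2 - c0 * measure M (space M) \<le> energy_functional u \<gamma>"
proof -
  have "(LINT x|M. - c0) \<le> (LINT x|M. G (u x))"
    by (intro integral_mono integrable_G assms G_lower) (simp add: finite_measure.integrable_const fin)
  then show ?thesis by (simp add: energy_functional_def mult.commute)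
qed

lemma energy_functional_tendsto:
  assumes "L2lim M \<phi> u" "L2lim M \<gamma>s \<gamma>"
  shows "(\<lambda>k. energy_functional (\<phi> k) (\<gamma>s k)) \<longlonglongrightarrow> energy_functional u \<gamma>"
  unfolding energy_functional_def
  by (intro tendsto_intros L2lim_norm assms L2lim_Lipschitz_integral(1)[OF fin _ G_Lipschitz]) simp

lemma odd_tests_L2norm_le:
  assumes "\<phi> \<in> odd_tests m"
  shows "(real (2 * m))\<^sup>2 * (L2norm M \<phi>)\<^sup>2 \<le> (L2norm M (grad \<phi>))\<^sup>2" "L2norm M \<phi> \<le> L2norm M (grad \<phi>)"
proof -
  show 1: "(real (2 * m))\<^sup>2 * (L2norm M \<phi>)\<^sup>2 \<le> (L2norm M (grad \<phi>))\<^sup>2"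
    using odd_tests_Poincare[OF assms m, of UNIV 1] by simp
  have "1 \<le> (real (2 * m))\<^sup>2" using m by (intro one_le_power) simp
  then have "1 * (L2norm M \<phi>)\<^sup>2 \<le> (real (2 * m))\<^sup>2 * (L2norm M \<phi>)\<^sup>2" by (intro mult_right_mono) auto
  with 1 have "(L2norm M \<phi>)\<^sup>2 \<le> (L2norm M (grad \<phi>))\<^sup>2" by linarith
  then show "L2norm M \<phi> \<le> L2norm M (grad \<phi>)" by (rule power2_le_imp_le) simp
qed

text \<open>Along a minimising sequence, Rellich's theorem makes the lower order part of the energy
  converge; the parallelogram identity for the Dirichlet integral then forces the gradients to
  converge in mean as well.\<close>

theorem exists_minimiser:
  obtains \<phi> u \<gamma> where "H10_approx \<phi> u \<gamma>" "\<And>k. \<phi> k \<in> odd_tests m" "AE x in M. (\<lambda>k. \<phi> k x) \<longlonglongrightarrow> u x"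
    "\<And>v. v \<in> odd_tests m \<Longrightarrow> energy_functional u \<gamma> \<le> energy_functional v (grad v)"
proof -
  let ?J = "\<lambda>\<phi>. energy_functional \<phi> (grad \<phi>)"
  have L2t: "L2 M \<phi>" "L2 M (grad \<phi>)" if "\<phi> \<in> odd_tests m" for \<phi>
    using L2_test odd_testsD(1)[OF that] by auto
  define V where "V = c0 * measure M (space M)"
  define I where "I = Inf (?J ` odd_tests m)"
  have low: "(L2norm M (grad \<phi>))\<^sup>2 / 2 - V \<le> ?J \<phi>" if "\<phi> \<in> odd_tests m" for \<phi>
    unfolding V_def by (rule energy_functional_lower[OF L2t(1)[OF that]])
  have bdd: "bdd_below (?J ` odd_tests m)"
  proof (rule bdd_belowI2)
    fix \<phi> assume "\<phi> \<in> odd_tests m"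
    from low[OF this] show "- V \<le> ?J \<phi>" by (smt (verit) zero_le_power2 divide_nonneg_pos)
  qed
  have ne: "?J ` odd_tests m \<noteq> {}" using odd_tests_0 by blast
  have I_le: "I \<le> ?J \<phi>" if "\<phi> \<in> odd_tests m" for \<phi>
    unfolding I_def by (rule cInf_lower[OF imageI[OF that] bdd])
  have "\<exists>\<phi>\<in>odd_tests m. ?J \<phi> < I + 1 / real (Suc k)" for k
    using cInf_lessD[OF ne, of "I + 1 / real (Suc k)"] by (auto simp: I_def)
  then obtain \<phi>0 where \<phi>0: "\<And>k. \<phi>0 k \<in> odd_tests m" "\<And>k. ?J (\<phi>0 k) < I + 1 / real (Suc k)" by metis
  define B where "B = sqrt (2 * (I + 1 + V))"
  have gb: "L2norm M (grad (\<phi>0 k)) \<le> B" for k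
  proof -
    have "1 / real (Suc k) \<le> 1" by simp
    then have "(L2norm M (grad (\<phi>0 k)))\<^sup>2 \<le> 2 * (I + 1 + V)" using low[OF \<phi>0(1), of k] \<phi>0(2)[of k] by argo
    then show ?thesis unfolding B_def by (rule real_le_rsqrt)
  qed
  have ub: "L2norm M (\<phi>0 k) \<le> B" for k using odd_tests_L2norm_le(2)[OF \<phi>0(1)] gb order_trans by blast
  obtain r0 where r0: "strict_mono (r0 :: nat \<Rightarrow> nat)"
    "\<And>e. e > 0 \<Longrightarrow> \<exists>N. \<forall>k\<ge>N. \<forall>l\<ge>N. L2norm M (\<lambda>x. \<phi>0 (r0 k) x - \<phi>0 (r0 l) x) < e"
    using Rellich[of \<phi>0 B] odd_testsD(1)[OF \<phi>0(1)] ub gb by blast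
  define \<psi> where "\<psi> k = \<phi>0 (r0 k)" for k
  have \<psi>: "\<psi> k \<in> odd_tests m" for k unfolding \<psi>_def by (rule \<phi>0)
  have s: "smooth (\<psi> k)" for k using odd_testsD(1)[OF \<psi>] by (rule test_functions_smooth)
  have J\<psi>: "?J (\<psi> k) < I + 1 / real (Suc k)" for k
  proof -
    have "1 / real (Suc (r0 k)) \<le> 1 / real (Suc k)" using seq_suble[OF r0(1), of k] by (intro divide_left_mono) auto
    then show ?thesis using \<phi>0(2)[of "r0 k"] unfolding \<psi>_def by linarith
  qed
  define D where "D = C * L2norm M (\<lambda>_. 1::real)"
  have D: "0 \<le> D" using C_nonneg by (simp add: D_def)
  have par: "(L2norm M (\<lambda>x. grad (\<psi> k) x - grad (\<psi> l) x))\<^sup>2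
      \<le> 4 * (1 / real (Suc k) + 1 / real (Suc l) + D * L2norm M (\<lambda>x. \<psi> k x - \<psi> l x))" for k l
  proof -
    \<comment> \<open>The midpoint is admissible, so its energy is not below the infimum.\<close>
    define \<omega> where "\<omega> x = (1/2) * (\<psi> k x + \<psi> l x)" for x
    have \<omega>: "\<omega> \<in> odd_tests m" unfolding \<omega>_def by (intro odd_tests_cmult odd_tests_add \<psi>)
    have g\<omega>: "grad \<omega> x = (1/2) *\<^sub>R (grad (\<psi> k) x + 1 *\<^sub>R grad (\<psi> l) x)" for x
      unfolding \<omega>_def by (simp only: grad_cmult[OF smooth_add[OF s s]] grad_add[OF s s]) simp
    define i where "i = (LINT x|M. grad (\<psi> k) x \<bullet> grad (\<psi> l) x)"
    have q: "(L2norm M (grad \<omega>))\<^sup>2 = ((L2norm M (grad (\<psi> k)))\<^sup>2 + 2 * i + (L2norm M (grad (\<psi> l)))\<^sup>2) / 4"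
    proof -
      have E: "L2norm M (grad \<omega>) = \<bar>1/2\<bar> * L2norm M (\<lambda>x. grad (\<psi> k) x + 1 *\<^sub>R grad (\<psi> l) x)"
        unfolding g\<omega>[abs_def] by (rule L2norm_scaleR)
      have "(L2norm M (grad \<omega>))\<^sup>2 = (L2norm M (\<lambda>x. grad (\<psi> k) x + 1 *\<^sub>R grad (\<psi> l) x))\<^sup>2 / 4"
        unfolding E by (simp add: power_mult_distrib power_divide)
      then show ?thesis
        unfolding L2norm_sq[of M "\<lambda>x. grad (\<psi> k) x + 1 *\<^sub>R grad (\<psi> l) x"]
          L2norm_quadratic[OF L2t(2)[OF \<psi>] L2t(2)[OF \<psi>]] i_def by simp
    qed
    have d: "(L2norm M (\<lambda>x. grad (\<psi> k) x - grad (\<psi> l) x))\<^sup>2 =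
        (L2norm M (grad (\<psi> k)))\<^sup>2 - 2 * i + (L2norm M (grad (\<psi> l)))\<^sup>2"
      using L2norm_quadratic[OF L2t(2)[OF \<psi>[of k]] L2t(2)[OF \<psi>[of l]], of "-1"] by (simp add: L2norm_sq i_def)
    have h: "L2norm M (\<lambda>x. \<omega> x - \<psi> j x) = L2norm M (\<lambda>x. \<psi> k x - \<psi> l x) / 2" if "j = k \<or> j = l" for j
    proof -
      have "L2norm M (\<lambda>x. \<omega> x - \<psi> j x) = L2norm M (\<lambda>x. (1/2) *\<^sub>R (\<psi> k x - \<psi> l x))"
        unfolding L2norm_def \<omega>_def using that
        by (intro arg_cong[where f = sqrt] Bochner_Integration.integral_cong) (auto simp: power2_eq_square algebra_simps)
      then show ?thesis by (simp only: L2norm_scaleR)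
    qed
    have Gj: "(LINT x|M. G (\<omega> x)) - (LINT x|M. G (\<psi> j x)) \<le> D * (L2norm M (\<lambda>x. \<psi> k x - \<psi> l x) / 2)"
      if "j = k \<or> j = l" for j
      using abs_le_D1[OF G_integral_Lipschitz[OF L2t(1)[OF \<omega>] L2t(1)[OF \<psi>], of j]] h[OF that]
      by (simp add: D_def)
    have Gd: "2 * (LINT x|M. G (\<omega> x)) - (LINT x|M. G (\<psi> k x)) - (LINT x|M. G (\<psi> l x))
        \<le> D * L2norm M (\<lambda>x. \<psi> k x - \<psi> l x)" using Gj[of k] Gj[of l] by simp
    have J: "?J (\<psi> k) < I + 1 / real (Suc k)" "?J (\<psi> l) < I + 1 / real (Suc l)" "I \<le> ?J \<omega>"
      by (intro J\<psi> I_le \<omega>)+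
    show ?thesis using J Gd q unfolding energy_functional_def d by argo
  qed
  have gCau: "\<exists>N. \<forall>k\<ge>N. \<forall>l\<ge>N. L2norm M (\<lambda>x. grad (\<psi> k) x - grad (\<psi> l) x) < e" if e: "e > 0" for e
  proof -
    have e2: "e\<^sup>2 / 16 > 0" using e by simp
    obtain N1 where N1: "1 / real (Suc N1) < e\<^sup>2 / 16" using nat_approx_posE[OF e2] by blast
    have "e\<^sup>2 / (16 * (D + 1)) > 0" using e D by simp
    from r0(2)[OF this] obtain N2 where
      N2: "\<And>k l. k \<ge> N2 \<Longrightarrow> l \<ge> N2 \<Longrightarrow> L2norm M (\<lambda>x. \<psi> k x - \<psi> l x) < e\<^sup>2 / (16 * (D + 1))"
      unfolding \<psi>_def by blast
    have "L2norm M (\<lambda>x. grad (\<psi> k) x - grad (\<psi> l) x) < e" if "k \<ge> max N1 N2" "l \<ge> max N1 N2" for k l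
    proof -
      have "1 / real (Suc j) \<le> 1 / real (Suc N1)" if "j \<ge> N1" for j using that by (intro divide_left_mono) auto
      then have 1: "1 / real (Suc k) < e\<^sup>2 / 16" "1 / real (Suc l) < e\<^sup>2 / 16"
        using N1 that by (meson le_less_trans max.boundedE)+
      have "D * L2norm M (\<lambda>x. \<psi> k x - \<psi> l x) \<le> (D + 1) * L2norm M (\<lambda>x. \<psi> k x - \<psi> l x)"
        by (intro mult_right_mono) auto
      also have "\<dots> < (D + 1) * (e\<^sup>2 / (16 * (D + 1)))"
        using N2[of k l] that D by (intro mult_strict_left_mono) auto
      also have "\<dots> = e\<^sup>2 / 16" using D by (simp add: field_simps)
      finally have 2: "D * L2norm M (\<lambda>x. \<psi> k x - \<psi> l x) < e\<^sup>2 / 16" .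
      have "(L2norm M (\<lambda>x. grad (\<psi> k) x - grad (\<psi> l) x))\<^sup>2 < 4 * (e\<^sup>2 / 16 + e\<^sup>2 / 16 + e\<^sup>2 / 16)"
        by (rule le_less_trans[OF par[of k l]]) (intro mult_strict_left_mono add_strict_mono 1 2 zero_less_numeral)
      also have "\<dots> < e\<^sup>2" using e2 by simp
      finally have "(L2norm M (\<lambda>x. grad (\<psi> k) x - grad (\<psi> l) x))\<^sup>2 < e\<^sup>2" .
      then show ?thesis by (rule power2_less_imp_less) (use e in simp)
    qed
    then show ?thesis by blast
  qed
  have uCau: "\<exists>N. \<forall>k\<ge>N. \<forall>l\<ge>N. L2norm M (\<lambda>x. \<psi> k x - \<psi> l x) < e" if "e > 0" for e
    using r0(2)[OF that] by (simp add: \<psi>_def)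
  obtain u r where u: "L2lim M \<psi> u" "strict_mono (r :: nat \<Rightarrow> nat)" "AE x in M. (\<lambda>k. \<psi> (r k) x) \<longlonglongrightarrow> u x"
    by (rule L2_complete[OF L2t(1)[OF \<psi>] uCau])
  obtain \<gamma> r' where \<gamma>: "L2lim M (\<lambda>k. grad (\<psi> k)) \<gamma>" "strict_mono (r' :: nat \<Rightarrow> nat)"
      "AE x in M. (\<lambda>k. grad (\<psi> (r' k)) x) \<longlonglongrightarrow> \<gamma> x"
    by (rule L2_complete[OF L2t(2)[OF \<psi>] gCau])
  show ?thesis
  proof (rule that[of "\<lambda>k. \<psi> (r k)" u \<gamma>])
    show "H10_approx (\<lambda>k. \<psi> (r k)) u \<gamma>"
      unfolding H10_approx_def
      using odd_testsD(1)[OF \<psi>] L2lim_subseq[OF u(1,2)] L2lim_subseq[OF \<gamma>(1) u(2)] by simp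
    show "\<psi> (r k) \<in> odd_tests m" for k by (rule \<psi>)
    show "AE x in M. (\<lambda>k. \<psi> (r k) x) \<longlonglongrightarrow> u x" by (rule u)
    fix v assume v: "v \<in> odd_tests m"
    have "energy_functional u \<gamma> \<le> I + 0"
    proof (rule LIMSEQ_le[OF energy_functional_tendsto[OF u(1) \<gamma>(1)]])
      show "(\<lambda>k. I + 1 / real (Suc k)) \<longlonglongrightarrow> I + 0"
        using LIMSEQ_inverse_real_of_nat by (intro tendsto_intros) (simp add: inverse_eq_divide)
      show "\<exists>N. \<forall>k\<ge>N. energy_functional (\<psi> k) (grad (\<psi> k)) \<le> I + 1 / real (Suc k)"
        using J\<psi> less_imp_le by blast
    qed
    then show "energy_functional u \<gamma> \<le> energy_functional v (grad v)" using I_le[OF v] by simp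
  qed
qed

end

subsection \<open>The Euler--Lagrange equation\<close>

context truncated_energy
begin

definition first_variation :: "('a \<Rightarrow> real) \<Rightarrow> ('a \<Rightarrow> 'a) \<Rightarrow> ('a \<Rightarrow> real) \<Rightarrow> real" where
  "first_variation u \<gamma> v = (LINT x|M. \<gamma> x \<bullet> grad v x) + (LINT x|M. g (u x) * v x)"

lemma g_measurable: "u \<in> borel_measurable M \<Longrightarrow> (\<lambda>x. g (u x)) \<in> borel_measurable M"
  using measurable_compose[OF _ borel_measurable_continuous_onI[OF g_cont]] by blast

lemma L2_g: "u \<in> borel_measurable M \<Longrightarrow> L2 M (\<lambda>x. g (u x))"
  by (rule L2_bounded[OF fin g_measurable, where C = C]) (auto simp: g_bound)

lemma integrable_g_mult: "u \<in> borel_measurable M \<Longrightarrow> L2 M v \<Longrightarrow> integrable M (\<lambda>x. g (u x) * v x)"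
  using L2_inner_integrable[OF L2_g, of u v] by simp

lemma first_variation_add:
  assumes "L2 M u" "L2 M \<gamma>" "v \<in> test_functions (ball 0 1)" "w \<in> test_functions (ball 0 1)"
  shows "first_variation u \<gamma> (\<lambda>x. v x + w x) = first_variation u \<gamma> v + first_variation u \<gamma> w"
proof -
  have "(LINT x|M. \<gamma> x \<bullet> grad (\<lambda>x. v x + w x) x) = (LINT x|M. \<gamma> x \<bullet> grad v x) + (LINT x|M. \<gamma> x \<bullet> grad w x)"
    using L2_inner_integrable[OF assms(2) L2_test(2)[OF assms(3)]]
      L2_inner_integrable[OF assms(2) L2_test(2)[OF assms(4)]]
    by (simp add: grad_add[OF test_functions_smooth[OF assms(3)] test_functions_smooth[OF assms(4)]]
        inner_add_right)
  moreover have "(LINT x|M. g (u x) * (v x + w x)) = (LINT x|M. g (u x) * v x) + (LINT x|M. g (u x) * w x)"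
    using integrable_g_mult[OF L2_measurable[OF assms(1)] L2_test(1)[OF assms(3)]]
      integrable_g_mult[OF L2_measurable[OF assms(1)] L2_test(1)[OF assms(4)]]
    by (simp add: distrib_left)
  ultimately show ?thesis by (simp add: first_variation_def)
qed

lemma first_variation_cmult:
  assumes "v \<in> test_functions (ball 0 1)"
  shows "first_variation u \<gamma> (\<lambda>x. c * v x) = c * first_variation u \<gamma> v"
  by (simp add: first_variation_def grad_cmult[OF test_functions_smooth[OF assms]] mult.left_commute[of _ c] distrib_left)

end

text \<open>The data delivered by \<open>exists_minimiser\<close>.\<close>

locale energy_minimiser = truncated_energy e f G g C c0 m
  for e f :: "'a::euclidean_space" and G g C c0 m +
  fixes \<phi> :: "nat \<Rightarrow> 'a \<Rightarrow> real" and u :: "'a \<Rightarrow> real" and \<gamma> :: "'a \<Rightarrow> 'a"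
  assumes approx: "H10_approx \<phi> u \<gamma>"
    and odd: "\<And>k. \<phi> k \<in> odd_tests m"
    and ae: "AE x in M. (\<lambda>k. \<phi> k x) \<longlonglongrightarrow> u x"
    and minimal: "\<And>v. v \<in> odd_tests m \<Longrightarrow> energy_functional u \<gamma> \<le> energy_functional v (grad v)"
begin

lemmas lims = H10_approxD[OF approx]

lemma um: "u \<in> borel_measurable M" by (rule L2_measurable[OF lims(4)])

lemma minimal_perturbation:
  assumes v: "v \<in> odd_tests m"
  shows "energy_functional u \<gamma> \<le> energy_functional (\<lambda>x. u x + t * v x) (\<lambda>x. \<gamma> x + t *\<^sub>R grad v x)"
proof (rule LIMSEQ_le_const)
  have s: "smooth v" "smooth (\<phi> k)" for k
    using odd_testsD(1)[OF v] odd_testsD(1)[OF odd] by (auto intro: test_functions_smooth)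
  have Lv: "L2 M v" "L2 M (grad v)" using L2_test[OF odd_testsD(1)[OF v]] by auto
  show "(\<lambda>k. energy_functional (\<lambda>x. \<phi> k x + t * v x) (\<lambda>x. grad (\<phi> k) x + t *\<^sub>R grad v x))
      \<longlonglongrightarrow> energy_functional (\<lambda>x. u x + t * v x) (\<lambda>x. \<gamma> x + t *\<^sub>R grad v x)"
  proof (rule energy_functional_tendsto)
    show "L2lim M (\<lambda>k x. \<phi> k x + t * v x) (\<lambda>x. u x + t * v x)"
      by (rule L2lim_contraction[OF lims(2), of _ _ 1])
        (use L2limD[OF lims(2)] L2_scaleR[OF Lv(1), of t] in \<open>auto intro!: L2_add\<close>)
    show "L2lim M (\<lambda>k x. grad (\<phi> k) x + t *\<^sub>R grad v x) (\<lambda>x. \<gamma> x + t *\<^sub>R grad v x)"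
      by (rule L2lim_contraction[OF lims(3), of _ _ 1])
        (use L2limD[OF lims(3)] L2_scaleR[OF Lv(2), of t] in \<open>auto intro!: L2_add\<close>)
  qed
  have "energy_functional u \<gamma> \<le> energy_functional (\<lambda>x. \<phi> k x + t * v x) (\<lambda>x. grad (\<phi> k) x + t *\<^sub>R grad v x)" for k
  proof -
    have "(\<lambda>x. \<phi> k x + t * v x) \<in> odd_tests m" by (intro odd_tests_add odd_tests_cmult odd v)
    moreover have "grad (\<lambda>x. \<phi> k x + t * v x) = (\<lambda>x. grad (\<phi> k) x + t *\<^sub>R grad v x)"
      by (rule ext) (simp add: grad_add[OF s(2) smooth_mult[OF smooth_const s(1)]] grad_cmult[OF s(1)])
    ultimately show ?thesis using minimal[of "\<lambda>x. \<phi> k x + t * v x"] by simp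
  qed
  then show "\<exists>N. \<forall>k\<ge>N. energy_functional u \<gamma> \<le>
      energy_functional (\<lambda>x. \<phi> k x + t * v x) (\<lambda>x. grad (\<phi> k) x + t *\<^sub>R grad v x)" by blast
qed

text \<open>The one-sided derivative of the energy at a minimum, with difference quotients of \<open>G\<close> dominated by
  \<open>C * \<bar>v x\<bar>\<close>.\<close>

lemma first_variation_nonneg:
  assumes v: "v \<in> odd_tests m"
  shows "0 \<le> first_variation u \<gamma> v"
proof -
  have Lv: "L2 M v" "L2 M (grad v)" using L2_test[OF odd_testsD(1)[OF v]] by auto
  define t where "t n = 1 / real (Suc n)" for n
  have t: "t n > 0" for n by (simp add: t_def)
  have t0: "t \<longlonglongrightarrow> 0"
    unfolding t_def[abs_def] using LIMSEQ_inverse_real_of_nat by (simp add: inverse_eq_divide)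
  have LG: "integrable M (\<lambda>x. G (u x + c * v x))" for c
    using L2_add[OF lims(4) L2_scaleR[OF Lv(1), of c]] by (intro integrable_G) simp
  have quot: "(\<lambda>n. LINT x|M. (G (u x + t n * v x) - G (u x)) / t n) \<longlonglongrightarrow> (LINT x|M. g (u x) * v x)"
  proof (rule integral_dominated_convergence[where w = "\<lambda>x. C * \<bar>v x\<bar>"])
    show "(\<lambda>x. g (u x) * v x) \<in> borel_measurable M" using integrable_g_mult[OF um Lv(1)] by auto
    show "(\<lambda>x. (G (u x + t n * v x) - G (u x)) / t n) \<in> borel_measurable M" for n
      using LG[of "t n"] LG[of 0] by (intro borel_measurable_divide borel_measurable_diff) auto
    show "integrable M (\<lambda>x. C * \<bar>v x\<bar>)" using L2_integrable[OF fin Lv(1)] by auto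
    show "AE x in M. (\<lambda>n. (G (u x + t n * v x) - G (u x)) / t n) \<longlonglongrightarrow> g (u x) * v x"
    proof (rule AE_I2)
      fix x
      have d: "((\<lambda>s. G (u x + s * v x)) has_real_derivative g (u x) * v x) (at 0)"
        by (rule DERIV_chain'[of "\<lambda>s. u x + s * v x" "v x" 0 UNIV G, THEN DERIV_cong])
          (auto intro!: derivative_eq_intros G_deriv)
      have "filterlim t (at 0) sequentially" unfolding filterlim_at using t0 t by (auto simp: less_imp_neq[symmetric])
      from filterlim_compose[OF d[unfolded DERIV_def] this]
      show "(\<lambda>n. (G (u x + t n * v x) - G (u x)) / t n) \<longlonglongrightarrow> g (u x) * v x" by simp
    qed
    show "AE x in M. norm ((G (u x + t n * v x) - G (u x)) / t n) \<le> C * \<bar>v x\<bar>" for n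
    proof (rule AE_I2)
      fix x
      have "\<bar>G (u x + t n * v x) - G (u x)\<bar> \<le> C * (t n * \<bar>v x\<bar>)"
        using G_Lipschitz[of "u x + t n * v x" "u x"] t[of n] by (simp add: abs_mult)
      then show "norm ((G (u x + t n * v x) - G (u x)) / t n) \<le> C * \<bar>v x\<bar>"
        using t[of n] by (simp add: pos_divide_le_eq ac_simps)
    qed
  qed
  define i where "i = (LINT x|M. \<gamma> x \<bullet> grad v x)"
  have ge: "0 \<le> i + t n / 2 * (L2norm M (grad v))\<^sup>2 + (LINT x|M. (G (u x + t n * v x) - G (u x)) / t n)" for n
  proof -
    have "energy_functional u \<gamma> \<le> energy_functional (\<lambda>x. u x + t n * v x) (\<lambda>x. \<gamma> x + t n *\<^sub>R grad v x)"
      by (rule minimal_perturbation[OF v])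
    moreover have "(L2norm M (\<lambda>x. \<gamma> x + t n *\<^sub>R grad v x))\<^sup>2 =
        (L2norm M \<gamma>)\<^sup>2 + 2 * t n * i + (t n)\<^sup>2 * (L2norm M (grad v))\<^sup>2"
      using L2norm_quadratic[OF lims(5) Lv(2)] by (simp add: L2norm_sq i_def)
    moreover have "(LINT x|M. (G (u x + t n * v x) - G (u x)) / t n) =
        ((LINT x|M. G (u x + t n * v x)) - (LINT x|M. G (u x))) / t n"
      using LG[of "t n"] LG[of 0] by simp
    ultimately have "0 \<le> t n * i + (t n)\<^sup>2 / 2 * (L2norm M (grad v))\<^sup>2 +
        t n * (LINT x|M. (G (u x + t n * v x) - G (u x)) / t n)"
      using t[of n] by (simp add: energy_functional_def) argo
    also have "\<dots> = t n * (i + t n / 2 * (L2norm M (grad v))\<^sup>2 + (LINT x|M. (G (u x + t n * v x) - G (u x)) / t n))"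
      by (simp only: distrib_left power2_eq_square) simp
    finally show ?thesis using t[of n] by (simp only: zero_le_mult_iff) linarith
  qed
  have "(\<lambda>n. i + t n / 2 * (L2norm M (grad v))\<^sup>2 + (LINT x|M. (G (u x + t n * v x) - G (u x)) / t n))
      \<longlonglongrightarrow> i + 0 / 2 * (L2norm M (grad v))\<^sup>2 + (LINT x|M. g (u x) * v x)"
    by (intro tendsto_intros t0 quot) simp
  from LIMSEQ_le_const[OF this, of 0] ge show ?thesis by (auto simp: first_variation_def i_def)
qed

lemma first_variation_odd_tests:
  assumes v: "v \<in> odd_tests m"
  shows "first_variation u \<gamma> v = 0"
proof -
  have "0 \<le> first_variation u \<gamma> (\<lambda>x. (-1) * v x)"
    by (intro first_variation_nonneg odd_tests_cmult v)
  then have "first_variation u \<gamma> v \<le> 0"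
    using first_variation_cmult[OF odd_testsD(1)[OF v], of u \<gamma> "-1"] by simp
  with first_variation_nonneg[OF v] show ?thesis by simp
qed

lemma first_variation_tendsto:
  assumes v: "v \<in> test_functions (ball 0 1)"
  shows "(\<lambda>k. first_variation (\<phi> k) (grad (\<phi> k)) v) \<longlonglongrightarrow> first_variation u \<gamma> v"
proof -
  have Lv: "L2 M v" "L2 M (grad v)" using L2_test[OF v] by auto
  have pm: "\<phi> k \<in> borel_measurable M" for k by (rule L2_measurable[OF L2limD(1)[OF lims(2)]])
  have "(\<lambda>k. LINT x|M. g (\<phi> k x) * v x) \<longlonglongrightarrow> (LINT x|M. g (u x) * v x)"
  proof (rule integral_dominated_convergence[where w = "\<lambda>x. C * \<bar>v x\<bar>"])
    show "(\<lambda>x. g (u x) * v x) \<in> borel_measurable M" using integrable_g_mult[OF um Lv(1)] by auto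
    show "(\<lambda>x. g (\<phi> k x) * v x) \<in> borel_measurable M" for k using integrable_g_mult[OF pm Lv(1)] by auto
    show "integrable M (\<lambda>x. C * \<bar>v x\<bar>)" using L2_integrable[OF fin Lv(1)] by auto
    show "AE x in M. (\<lambda>k. g (\<phi> k x) * v x) \<longlonglongrightarrow> g (u x) * v x"
      using ae
    proof eventually_elim
      case (elim x)
      have "isCont g (u x)" using g_cont by (simp add: continuous_on_eq_continuous_at)
      from isCont_tendsto_compose[OF this elim] show ?case by (intro tendsto_intros)
    qed
    show "AE x in M. norm (g (\<phi> k x) * v x) \<le> C * \<bar>v x\<bar>" for k
      using g_bound by (intro AE_I2) (simp add: abs_mult mult_right_mono)
  qed
  then show ?thesis
    unfolding first_variation_def by (intro tendsto_add L2lim_inner lims Lv)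
qed

text \<open>Composition with the generating rotation changes the sign of the first variation at an
  antiperiodic function. So the first variation in any direction is a multiple of the one in the
  direction of the antiperiodic average, where it vanishes by minimality.\<close>

lemma first_variation_rotate:
  assumes v: "v \<in> test_functions (ball 0 1)"
  shows "first_variation u \<gamma> (\<lambda>x. v (rot (pi / real (2 * m)) x)) = - first_variation u \<gamma> v"
proof (rule LIMSEQ_unique[OF first_variation_tendsto[OF test_rot[OF v]]])
  define R where "R = rot (pi / real (2 * m))"
  have R: "orthogonal_transformation R" unfolding R_def by (rule orthogonal_rot)
  have RR: "R x \<bullet> R y = x \<bullet> y" for x y using R by (simp add: orthogonal_transformation_def)
  have nR: "norm (R x) = norm x" for x by (simp add: R_def)
  have sv: "smooth v" using v by (rule test_functions_smooth)
  have eq: "first_variation (\<phi> k) (grad (\<phi> k)) (\<lambda>x. v (R x)) = - first_variation (\<phi> k) (grad (\<phi> k)) v" for k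
  proof -
    have pt: "\<phi> k \<in> test_functions (ball 0 1)" and anti: "\<phi> k (R x) = - \<phi> k x" for x
      using odd_testsD[OF odd] by (auto simp: R_def)
    have sp: "smooth (\<phi> k)" using pt by (rule test_functions_smooth)
    have gR: "R (grad (\<phi> k) x) = - grad (\<phi> k) (R x)" for x
    proof -
      have "grad (\<lambda>x. \<phi> k (R x)) x = - grad (\<phi> k) x"
        using grad_cmult[OF sp, of "-1" x] by (simp add: anti)
      then show ?thesis
        using grad_orthogonal[OF R sp, of x] linear_neg[OF orthogonal_transformation_linear[OF R]]
        by (metis minus_minus)
    qed
    have i1: "grad (\<phi> k) x \<bullet> grad (\<lambda>x. v (R x)) x = - (grad (\<phi> k) (R x) \<bullet> grad v (R x))" for x
      using RR[of "grad (\<phi> k) x" "grad (\<lambda>x. v (R x)) x"] by (simp add: gR grad_orthogonal[OF R sv])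
    have i2: "g (\<phi> k x) * v (R x) = - (g (\<phi> k (R x)) * v (R x))" for x
      by (simp add: anti g_odd)
    have c1: "continuous_on UNIV (\<lambda>x. grad (\<phi> k) x \<bullet> grad v x)"
      by (intro continuous_intros continuous_grad sp sv)
    have c2: "continuous_on UNIV (\<lambda>x. g (\<phi> k x) * v x)"
      by (intro continuous_intros continuous_on_compose2[OF g_cont continuous_smooth[OF sp]] continuous_smooth sv) auto
    have m1: "(\<lambda>x. grad (\<phi> k) x \<bullet> grad v x) \<in> borel_measurable borel"
      and m2: "(\<lambda>x. g (\<phi> k x) * v x) \<in> borel_measurable borel"
      by (intro borel_measurable_continuous_onI c1 c2)+
    have Rm: "R \<in> borel_measurable borel"
      using orthogonal_transformation_linear[OF R]
      by (simp add: borel_measurable_continuous_onI linear_continuous_on linear_linear)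
    have I: "(LINT x|M. h (R x)) = (LINT x|M. h x)"
      if "h \<in> borel_measurable borel" "\<And>x. x \<notin> ball 0 1 \<Longrightarrow> h x = 0" for h :: "'a \<Rightarrow> real"
    proof -
      have "(LINT x|M. h (R x)) = (LINT x|lborel. h (R x))"
        using measurable_compose[OF Rm that(1)] that(2) nR by (intro integral_lebesgue_on_eq) auto
      also have "\<dots> = (LINT x|lborel. h x)" by (rule integral_orthogonal[OF R that(1)])
      also have "\<dots> = (LINT x|M. h x)" using that by (intro integral_lebesgue_on_eq[symmetric]) auto
      finally show ?thesis .
    qed
    show ?thesis
      unfolding first_variation_def i1 i2
      using I[OF m1] I[OF m2] test_functions_outside[OF v] by simp
  qed
  show "(\<lambda>k. first_variation (\<phi> k) (grad (\<phi> k)) (\<lambda>x. v (rot (pi / real (2 * m)) x))) \<longlonglongrightarrow> - first_variation u \<gamma> v"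
    using tendsto_minus[OF first_variation_tendsto[OF v]] eq by (simp add: R_def)
qed

theorem Euler_Lagrange:
  assumes v: "v \<in> test_functions (ball 0 1)"
  shows "first_variation u \<gamma> v = 0"
proof -
  define L where "L = pi / real (2 * m)"
  define w where "w j x = v (rot (real j * L) x)" for j and x
  have w: "w j \<in> test_functions (ball 0 1)" for j unfolding w_def by (rule test_rot[OF v])
  have step: "w j (rot L x) = w (Suc j) x" for j x
    by (simp add: w_def rot_add[symmetric] distrib_right add.commute)
  have A: "first_variation u \<gamma> (w j) = (-1) ^ j * first_variation u \<gamma> v" for j
  proof (induction j)
    case 0
    have "w 0 = v" by (auto simp: w_def)
    then show ?case by simp
  next
    case (Suc j)
    have "w (Suc j) = (\<lambda>x. w j (rot L x))" by (auto simp: step)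
    then show ?case using first_variation_rotate[OF w, of j] Suc by (simp add: L_def)
  qed
  define S where "S N x = (\<Sum>j<N. (-1) ^ j * w j x)" for N and x
  have St: "S N \<in> test_functions (ball 0 1)" for N
    unfolding S_def by (intro test_functions_sum test_functions_cmult w)
  have AS: "first_variation u \<gamma> (S N) = real N * first_variation u \<gamma> v" for N
  proof (induction N)
    case 0
    have "S 0 = (\<lambda>x. 0)" by (auto simp: S_def)
    then show ?case using first_variation_cmult[OF v, of u \<gamma> 0] by simp
  next
    case (Suc N)
    have "S (Suc N) = (\<lambda>x. S N x + (-1) ^ N * w N x)" by (auto simp: S_def)
    then have "first_variation u \<gamma> (S (Suc N)) = first_variation u \<gamma> (S N) + first_variation u \<gamma> (\<lambda>x. (-1) ^ N * w N x)"
      using first_variation_add[OF lims(4,5) St test_functions_cmult[OF w]] by simp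
    also have "first_variation u \<gamma> (\<lambda>x. (-1) ^ N * w N x) = (-1) ^ N * ((-1) ^ N * first_variation u \<gamma> v)"
      using first_variation_cmult[OF w] A by simp
    also have "\<dots> = first_variation u \<gamma> v" by (simp add: mult.assoc[symmetric] power_mult_distrib[symmetric])
    finally show ?case using Suc by (simp add: algebra_simps)
  qed
  \<comment> \<open>The generating rotation has order \<open>4 m\<close>, and this order is even, so the alternating sum is antiperiodic.\<close>
  define N where "N = 4 * m"
  have "S N \<in> odd_tests m"
  proof -
    have "S N (rot L x) = - S N x" for x
    proof -
      have wN: "w N x = w 0 x"
      proof -
        have "real N * L = 2 * pi" using m by (simp add: N_def L_def)
        then have "rot (real N * L) x = x" by (simp add: rot_def)
        then show ?thesis by (simp add: w_def)
      qed
      have "S N (rot L x) = - (\<Sum>j<N. (-1) ^ Suc j * w (Suc j) x)"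
        by (simp add: S_def step sum_negf[symmetric])
      also have "(\<Sum>j<N. (-1) ^ Suc j * w (Suc j) x) = (\<Sum>j<Suc N. (-1) ^ j * w j x) - w 0 x"
        by (subst sum.lessThan_Suc_shift) simp
      also have "\<dots> = S N x" by (simp only: S_def sum.lessThan_Suc wN) (simp add: N_def)
      finally show ?thesis .
    qed
    then show ?thesis using St by (simp add: odd_tests_def L_def)
  qed
  then have "real N * first_variation u \<gamma> v = 0"
    using first_variation_odd_tests AS[of N] by simp
  then show ?thesis using m by (simp add: N_def)
qed

subsection \<open>Boundedness of the minimiser\<close>

text \<open>The equation is tested with \<open>\<Phi>(u)\<close>, where \<open>\<Phi>\<close> is nondecreasing and vanishes exactly on
  \<open>[-B, B]\<close>. Both resulting terms are nonnegative, so \<open>g(u) \<Phi>(u) = 0\<close> almost everywhere.\<close>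

theorem minimiser_bounded:
  assumes B: "0 \<le> B" and pos: "\<And>s. s > B \<Longrightarrow> 0 < g s"
  shows "AE x in M. \<bar>u x\<bar> \<le> B"
proof -
  define \<Phi> where "\<Phi> s = bump (s - B) - bump (- s - B)" for s
  define \<Phi>' where "\<Phi>' s = flat [:0, 0, 1:] (s - B) + flat [:0, 0, 1:] (- s - B)" for s
  have d: "(\<Phi> has_real_derivative \<Phi>' s) (at s)" for s
  proof -
    have "((\<lambda>s. bump (s - B)) has_real_derivative flat [:0, 0, 1:] (s - B) * 1) (at s)"
      by (rule DERIV_chain2[OF bump_deriv(1)]) (auto intro!: derivative_eq_intros)
    moreover have "((\<lambda>s. bump (- s - B)) has_real_derivative flat [:0, 0, 1:] (- s - B) * (-1)) (at s)"
      by (rule DERIV_chain2[OF bump_deriv(1)]) (auto intro!: derivative_eq_intros)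
    ultimately show ?thesis unfolding \<Phi>_def \<Phi>'_def by (auto intro!: derivative_eq_intros)
  qed
  have \<Phi>'b: "0 \<le> \<Phi>' s" "\<Phi>' s \<le> 4" for s
    using bump_deriv(2,3)[of "s - B"] bump_deriv(2,3)[of "- s - B"] by (auto simp: \<Phi>'_def)
  have Lip: "\<bar>\<Phi> a - \<Phi> b\<bar> \<le> 4 * \<bar>a - b\<bar>" for a b
  proof -
    have "norm (\<Phi> a - \<Phi> b) \<le> 4 * norm (a - b)"
      by (rule field_differentiable_bound[of UNIV \<Phi> \<Phi>'])
        (use \<Phi>'b in \<open>auto intro: has_field_derivative_at_within d\<close>)
    then show ?thesis by simp
  qed
  have s\<Phi>: "smooth (\<lambda>x. \<Phi> (v x))" if "smooth v" for v :: "'a \<Rightarrow> real"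
    unfolding \<Phi>_def using smooth_mult[OF smooth_const[of "-1"] that]
    by (intro smooth_diff smooth_flat that smooth_const) simp
  have \<Phi>0: "\<Phi> 0 = 0" using B by (simp add: \<Phi>_def bump_eq)
  have t: "\<phi> k \<in> test_functions (ball 0 1)" and s: "smooth (\<phi> k)" for k
    using lims(1) by (auto intro: test_functions_smooth)
  have t\<Phi>: "(\<lambda>x. \<Phi> (\<phi> k x)) \<in> test_functions (ball 0 1)" for k
  proof -
    obtain K where K: "compact K" "K \<subseteq> ball 0 1" "\<And>x. x \<notin> K \<Longrightarrow> \<phi> k x = 0"
      by (rule test_functionsE[OF t]) (rule that)
    show ?thesis by (rule test_functionsI[OF s\<Phi>[OF s] K(1,2)]) (simp add: K(3) \<Phi>0)
  qed
  have g\<Phi>: "grad (\<lambda>x. \<Phi> (\<phi> k x)) x = \<Phi>' (\<phi> k x) *\<^sub>R grad (\<phi> k) x" for k x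
    by (rule grad_real_compose[OF d s])
  note gL = L2_g[OF um]
  have \<Phi>lim: "L2lim M (\<lambda>k x. \<Phi> (\<phi> k x)) (\<lambda>x. \<Phi> (u x))"
    by (rule L2lim_contraction[OF lims(2), of _ _ 4])
      (use L2_test(1)[OF t\<Phi>] L2lim_Lipschitz_integral(2)[OF fin lims(2) Lip] Lip in auto)
  have up: "(\<lambda>k. LINT x|M. \<Phi> (\<phi> k x) * g (u x)) \<longlonglongrightarrow> (LINT x|M. \<Phi> (u x) * g (u x))"
    using L2lim_inner[OF \<Phi>lim gL] by simp
  have le: "(LINT x|M. \<Phi> (\<phi> k x) * g (u x)) \<le> 4 * (L2norm M \<gamma> * L2norm M (\<lambda>x. grad (\<phi> k) x - \<gamma> x))" for k
  proof -
    define h where "h x = \<Phi>' (\<phi> k x) *\<^sub>R (grad (\<phi> k) x - \<gamma> x)" for x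
    have L2d: "L2 M (\<lambda>x. 4 *\<^sub>R (grad (\<phi> k) x - \<gamma> x))" by (intro L2_scaleR L2_diff lims L2_test t)
    have fc: "continuous_on UNIV (flat [:0, 0, 1:])"
      by (rule DERIV_continuous_on[OF has_field_derivative_at_within[OF flat_has_derivative]])
    have "continuous_on UNIV (\<lambda>s. s - B)" "continuous_on UNIV (\<lambda>s. - s - B)" by (intro continuous_intros)+
    then have \<Phi>'c: "continuous_on UNIV \<Phi>'"
      unfolding \<Phi>'_def by (intro continuous_on_add continuous_on_compose2[OF fc _ subset_UNIV])
    have pm: "(\<lambda>x. \<Phi>' (\<phi> k x)) \<in> borel_measurable M"
      by (intro continuous_measurable_lebesgue_on continuous_on_compose2[OF \<Phi>'c continuous_smooth[OF s]]) auto
    have hm: "h \<in> borel_measurable M"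
      unfolding h_def using pm L2_measurable[OF L2_diff[OF L2_test(2)[OF t] lims(5)]]
      by (intro borel_measurable_scaleR) auto
    have hle: "norm (h x) \<le> norm (4 *\<^sub>R (grad (\<phi> k) x - \<gamma> x))" for x
      using \<Phi>'b[of "\<phi> k x"] by (simp add: h_def mult_right_mono)
    have hL: "L2 M h" "L2norm M h \<le> L2norm M (\<lambda>x. 4 *\<^sub>R (grad (\<phi> k) x - \<gamma> x))"
      by (rule L2norm_mono[OF hm L2d]; use hle in simp)+
    have dec: "\<gamma> x \<bullet> grad (\<lambda>x. \<Phi> (\<phi> k x)) x = \<gamma> x \<bullet> h x + \<Phi>' (\<phi> k x) * (norm (\<gamma> x))\<^sup>2" for x
      by (simp add: g\<Phi> h_def inner_diff_right power2_norm_eq_inner algebra_simps)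
    have i1: "integrable M (\<lambda>x. \<gamma> x \<bullet> h x)" by (rule L2_inner_integrable[OF lims(5) hL(1)])
    have i2: "integrable M (\<lambda>x. \<gamma> x \<bullet> grad (\<lambda>x. \<Phi> (\<phi> k x)) x)"
      by (rule L2_inner_integrable[OF lims(5) L2_test(2)[OF t\<Phi>]])
    have "(LINT x|M. \<gamma> x \<bullet> h x) \<le> (LINT x|M. \<gamma> x \<bullet> grad (\<lambda>x. \<Phi> (\<phi> k x)) x)"
      by (rule integral_mono[OF i1 i2]) (simp add: dec \<Phi>'b)
    moreover have "\<bar>LINT x|M. \<gamma> x \<bullet> h x\<bar> \<le> L2norm M \<gamma> * L2norm M h"
      by (rule L2_Cauchy_Schwarz[OF lims(5) hL(1)])
    moreover have "L2norm M \<gamma> * L2norm M h \<le> L2norm M \<gamma> * (4 * L2norm M (\<lambda>x. grad (\<phi> k) x - \<gamma> x))"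
      using hL(2) by (intro mult_left_mono) (simp_all only: L2norm_scaleR, simp_all)
    moreover have "(LINT x|M. \<gamma> x \<bullet> grad (\<lambda>x. \<Phi> (\<phi> k x)) x) + (LINT x|M. g (u x) * \<Phi> (\<phi> k x)) = 0"
      using Euler_Lagrange[OF t\<Phi>[of k]] by (simp add: first_variation_def)
    ultimately show ?thesis by (simp add: mult.commute[of "g _"])
  qed
  have "(\<lambda>k. 4 * (L2norm M \<gamma> * L2norm M (\<lambda>x. grad (\<phi> k) x - \<gamma> x))) \<longlonglongrightarrow> 4 * (L2norm M \<gamma> * 0)"
    by (intro tendsto_intros L2limD(3)[OF lims(3)])
  from LIMSEQ_le[OF up this] le have le0: "(LINT x|M. \<Phi> (u x) * g (u x)) \<le> 0" by auto
  have sign: "0 \<le> \<Phi> s * g s \<and> (\<Phi> s * g s = 0 \<longrightarrow> \<bar>s\<bar> \<le> B)" for s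
  proof -
    consider "\<bar>s\<bar> \<le> B" | "s > B" | "s < - B" by linarith
    then show ?thesis
    proof cases
      case 1
      then have "\<Phi> s = 0" by (simp add: abs_le_iff \<Phi>_def bump_eq)
      then show ?thesis using 1 by simp
    next
      case 2
      then have "\<Phi> s > 0" "g s > 0" using B pos by (auto simp: \<Phi>_def bump_eq)
      then show ?thesis using mult_pos_pos[of "\<Phi> s" "g s"] by simp
    next
      case 3
      then have "g (- s) > 0" "\<Phi> s < 0" using B pos[of "- s"] by (auto simp: \<Phi>_def bump_eq)
      then show ?thesis using g_odd[of s] mult_neg_neg[of "\<Phi> s" "g s"] by simp
    qed
  qed
  have int: "integrable M (\<lambda>x. \<Phi> (u x) * g (u x))"
    using L2_inner_integrable[OF L2limD(2)[OF \<Phi>lim] gL] by simp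
  have "0 \<le> (LINT x|M. \<Phi> (u x) * g (u x))" using sign by (intro integral_nonneg_AE) auto
  with le0 have "(LINT x|M. \<Phi> (u x) * g (u x)) = 0" by simp
  then have "AE x in M. \<Phi> (u x) * g (u x) = 0"
    using integral_nonneg_eq_0_iff_AE[OF int] sign by auto
  then show ?thesis by eventually_elim (use sign in blast)
qed

end

section \<open>The nonlinearity\<close>

lemma abs_powr_has_derivative:
  assumes "q > 2"
  shows "((\<lambda>s. \<bar>s\<bar> powr q) has_real_derivative q * (\<bar>s\<bar> powr (q - 2) * s)) (at s)"
proof -
  have pos: "((\<lambda>s. \<bar>s\<bar> powr q) has_real_derivative q * (\<bar>s\<bar> powr (q - 2) * s)) (at s)" if "s > 0" for s
  proof -
    have "s powr (q - 1) = s powr (q - 2) * s"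
      using powr_add[of s "q - 2" 1] that by simp
    then have d: "((\<lambda>s. s powr q) has_real_derivative q * (\<bar>s\<bar> powr (q - 2) * s)) (at s)"
      using has_real_derivative_powr[OF that, of q] that by simp
    show ?thesis
      by (rule has_field_derivative_transform_within_open[OF d, of "{0<..}"]) (use that in auto)
  qed
  consider "s > 0" | "s < 0" | "s = 0" by linarith
  then show ?thesis
  proof cases
    case 1
    then show ?thesis by (rule pos)
  next
    case 2
    have "((\<lambda>s. \<bar>- s\<bar> powr q) has_real_derivative q * (\<bar>- s\<bar> powr (q - 2) * (- s)) * (- 1)) (at s)"
      by (rule DERIV_chain2[OF pos]) (use 2 in \<open>auto intro!: derivative_eq_intros\<close>)
    then show ?thesis by simp
  next
    case 3
    have "((\<lambda>h. \<bar>h\<bar> powr q / h) \<longlongrightarrow> 0) (at 0)"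
    proof (rule Lim_null_comparison)
      have "continuous_on UNIV (\<lambda>h::real. \<bar>h\<bar> powr (q - 1))"
        using assms by (intro continuous_on_powr' continuous_intros) auto
      then have "isCont (\<lambda>h::real. \<bar>h\<bar> powr (q - 1)) 0" by (simp add: continuous_on_eq_continuous_at)
      then show "((\<lambda>h::real. \<bar>h\<bar> powr (q - 1)) \<longlongrightarrow> 0) (at 0)" using assms by (simp add: isCont_def)
      have "norm (\<bar>h\<bar> powr q / h) \<le> \<bar>h\<bar> powr (q - 1)" for h :: real
        using powr_diff[of "\<bar>h\<bar>" q 1] by (cases "h = 0") simp_all
      then show "\<forall>\<^sub>F h in at 0. norm (\<bar>h\<bar> powr q / h) \<le> \<bar>h\<bar> powr (q - 1)" by simp
    qed
    then show ?thesis using 3 assms by (simp add: DERIV_def)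
  qed
qed

locale power_potential =
  fixes F f :: "real \<Rightarrow> real" and b p :: "nat \<Rightarrow> real" and k :: nat and b0 :: real
  assumes k: "k \<ge> 1"
    and p_gt: "2 < p 1"
    and p_mono: "strict_mono_on {1..k} p"
    and F_eq: "\<And>s. F s = (\<Sum>i=1..k. b i * \<bar>s\<bar> powr p i)"
    and F_nonneg: "\<And>s. 0 \<le> F s"
    and b0: "0 < b0"
    and F_ge: "\<And>s. F s \<ge> b0 * \<bar>s\<bar> powr p 1"
    and f_deriv: "\<And>s. (F has_real_derivative f s) (at s)"
begin

lemma p_ge: "i \<in> {1..k} \<Longrightarrow> p 1 \<le> p i"
  using p_mono k by (cases "i = 1") (auto simp: strict_mono_on_def less_eq_real_def)

lemma p_gt_2: "i \<in> {1..k} \<Longrightarrow> p i > 2"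
  using p_ge[of i] p_gt by linarith

lemma f_eq: "f s = (\<Sum>i=1..k. b i * (p i * (\<bar>s\<bar> powr (p i - 2) * s)))"
proof (rule DERIV_unique[OF f_deriv])
  have "((\<lambda>s. \<Sum>i=1..k. b i * \<bar>s\<bar> powr p i) has_real_derivative
      (\<Sum>i=1..k. b i * (p i * (\<bar>s\<bar> powr (p i - 2) * s)))) (at s)"
    by (intro DERIV_sum DERIV_cmult abs_powr_has_derivative p_gt_2)
  then show "(F has_real_derivative (\<Sum>i=1..k. b i * (p i * (\<bar>s\<bar> powr (p i - 2) * s)))) (at s)"
    by (simp add: F_eq[abs_def])
qed

lemma f_odd: "f (- s) = - f s"
  by (simp add: f_eq sum_negf)

lemma f_continuous: "continuous_on UNIV f"
  unfolding f_eq[abs_def]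
  by (intro continuous_intros continuous_on_powr') (use p_gt_2 in force)+

lemma F_continuous: "continuous_on UNIV F"
  by (rule DERIV_continuous_on[OF has_field_derivative_at_within[OF f_deriv]])

lemma F_0: "F 0 = 0"
  by (simp add: F_eq)

lemma F_small:
  assumes "\<bar>s\<bar> \<le> 1"
  shows "F s \<le> (\<Sum>i=1..k. \<bar>b i\<bar>) * \<bar>s\<bar> powr p 1"
  unfolding F_eq sum_distrib_right
proof (rule sum_mono)
  fix i assume i: "i \<in> {1..k}"
  have "\<bar>s\<bar> powr p i \<le> \<bar>s\<bar> powr p 1" using assms p_ge[OF i] by (intro powr_mono') auto
  then have "\<bar>b i\<bar> * \<bar>s\<bar> powr p i \<le> \<bar>b i\<bar> * \<bar>s\<bar> powr p 1" by (rule mult_left_mono) simp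
  moreover have "b i * \<bar>s\<bar> powr p i \<le> \<bar>b i\<bar> * \<bar>s\<bar> powr p i" by (intro mult_right_mono) auto
  ultimately show "b i * \<bar>s\<bar> powr p i \<le> \<bar>b i\<bar> * \<bar>s\<bar> powr p 1" by linarith
qed

text \<open>Otherwise \<open>F\<close> would grow at most quadratically, contrary to \<open>F s \<ge> b0 * \<bar>s\<bar> powr p 1\<close> with \<open>p 1 > 2\<close>.\<close>

lemma f_superlinear:
  assumes l: "l > 0"
  shows "\<exists>B>0. f B > l * B"
proof (rule ccontr)
  assume "\<not> ?thesis"
  then have le: "f B \<le> l * B" if "B > 0" for B using that by (meson not_le)
  \<comment> \<open>At this point \<open>b0 * s powr p 1 = l * s\<^sup>2\<close>, twice what the upper bound permits.\<close>
  define s where "s = (l / b0) powr (1 / (p 1 - 2))"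
  have s: "s > 0" using l b0 by (simp add: s_def)
  have "F s - l * s\<^sup>2 / 2 \<le> F 0 - l * 0\<^sup>2 / 2"
  proof (rule DERIV_nonpos_imp_nonincreasing[of 0 s "\<lambda>s. F s - l * s\<^sup>2 / 2"])
    fix t assume t: "0 \<le> t" "t \<le> s"
    have "((\<lambda>s. F s - l * s\<^sup>2 / 2) has_real_derivative f t - l * t) (at t)"
      by (auto intro!: derivative_eq_intros f_deriv)
    moreover have "f t - l * t \<le> 0" using le[of t] t f_odd[of 0] by (cases "t = 0") auto
    ultimately show "\<exists>y. ((\<lambda>s. F s - l * s\<^sup>2 / 2) has_real_derivative y) (at t) \<and> y \<le> 0" by blast
  qed (use s in simp)
  then have 1: "F s \<le> l * s\<^sup>2 / 2" by (simp add: F_0)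
  have "s powr (p 1 - 2) = l / b0" using p_gt l b0 by (simp add: s_def powr_powr)
  then have "b0 * s powr p 1 = l * s\<^sup>2"
    using powr_add[of s "p 1 - 2" 2] s b0 by simp
  then have "F s \<ge> l * s\<^sup>2" using F_ge[of s] s by simp
  moreover have "l * s\<^sup>2 > 0" using l s by simp
  ultimately show False using 1 by linarith
qed

text \<open>Beyond \<open>\<plusminus>B\<close> the derivative of \<open>F s - l s\<^sup>2 / 2\<close> is frozen at its value at \<open>\<plusminus>B\<close>, which points
  outwards. The resulting density \<open>G\<close> is Lipschitz and bounded from below, and \<open>minimiser_bounded\<close> shows that
  the truncation is invisible to the minimiser.\<close>

lemma truncation:
  assumes l: "l > 0"
  obtains B C c0 G g where "B > 0"
    "\<And>s. (G has_real_derivative g s) (at s)" "continuous_on UNIV g" "\<And>s. \<bar>g s\<bar> \<le> (C::real)"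
    "\<And>s. g (- s) = - g s" "\<And>s. - c0 \<le> G s"
    "\<And>s. s > B \<Longrightarrow> 0 < g s" "\<And>s. \<bar>s\<bar> \<le> B \<Longrightarrow> g s = f s - l * s"
    "\<And>s. \<bar>s\<bar> \<le> B \<Longrightarrow> G s = F s - l * s\<^sup>2 / 2"
proof -
  obtain B where B: "B > 0" "f B > l * B" using f_superlinear[OF l] by blast
  define cl where "cl s = max (- B) (min B s)" for s
  define g where "g s = f (cl s) - l * cl s" for s
  have clc: "continuous_on UNIV cl" unfolding cl_def by (intro continuous_intros)
  have clb: "cl s \<in> {-B..B}" for s using B by (auto simp: cl_def)
  have cl_id: "cl s = s" if "\<bar>s\<bar> \<le> B" for s using that by (auto simp: cl_def)
  have gc: "continuous_on UNIV g"
    unfolding g_def by (intro continuous_intros clc continuous_on_compose2[OF f_continuous clc]) auto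
  have "continuous_on {-B..B} (\<lambda>s. f s - l * s)"
    by (intro continuous_intros continuous_on_subset[OF f_continuous]) simp
  then have "bounded ((\<lambda>s. f s - l * s) ` {-B..B})"
    by (rule compact_imp_bounded[OF compact_continuous_image[OF _ compact_Icc]])
  then obtain C where "\<And>s. s \<in> {-B..B} \<Longrightarrow> norm (f s - l * s) \<le> C"
    by (auto simp: bounded_iff simp del: atLeastAtMost_iff)
  then have C: "\<bar>g s\<bar> \<le> C" for s using clb[of s] by (simp add: g_def)
  have godd: "g (- s) = - g s" for s
  proof -
    have "cl (- s) = - cl s" using B by (auto simp: cl_def)
    then show ?thesis by (simp add: g_def f_odd)
  qed
  have gB: "g s = f B - l * B" if "s > B" for s using that B by (simp add: g_def cl_def)
  have gpos: "0 < g s" if "s > B" for s using gB[OF that] B by simp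
  have "\<exists>H. \<forall>s. - \<infinity> < ereal s \<longrightarrow> ereal s < \<infinity> \<longrightarrow> (H has_vector_derivative g s) (at s)"
    by (rule einterval_antiderivative) (use gc in \<open>auto simp: continuous_on_eq_continuous_at\<close>)
  then obtain H where H: "\<And>s. (H has_real_derivative g s) (at s)"
    by (auto simp: has_real_derivative_iff_has_vector_derivative)
  define G where "G s = H s - H 0" for s
  have Gd: "(G has_real_derivative g s) (at s)" for s
    unfolding G_def by (auto intro!: derivative_eq_intros H)
  have GF: "G s = F s - l * s\<^sup>2 / 2" if s: "\<bar>s\<bar> \<le> B" for s
  proof -
    have "((\<lambda>s. G s - (F s - l * s\<^sup>2 / 2)) has_field_derivative 0) (at t within {-B..B})" if "t \<in> {-B..B}" for t
    proof -
      have "((\<lambda>s. G s - (F s - l * s\<^sup>2 / 2)) has_field_derivative g t - (f t - l * t)) (at t)"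
        by (auto intro!: derivative_eq_intros Gd f_deriv)
      moreover have "g t = f t - l * t" using cl_id[of t] that by (simp add: g_def abs_le_iff)
      ultimately show ?thesis by (simp add: has_field_derivative_at_within)
    qed
    then obtain c where c: "\<And>t. t \<in> {-B..B} \<Longrightarrow> G t - (F t - l * t\<^sup>2 / 2) = c"
      using has_field_derivative_zero_constant[of "{-B..B}" "\<lambda>s. G s - (F s - l * s\<^sup>2 / 2)"] by auto
    have "c = 0" using c[of 0] B by (simp add: G_def F_0)
    then show ?thesis using c[of s] s by (simp add: abs_le_iff)
  qed
  have Glow: "- (l * B\<^sup>2 / 2) \<le> G s" for s
  proof -
    have inn: "- (l * B\<^sup>2 / 2) \<le> G t" if "\<bar>t\<bar> \<le> B" for t
    proof -
      have "t\<^sup>2 \<le> B\<^sup>2" using that by (simp add: abs_le_square_iff[symmetric])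
      then have "l * t\<^sup>2 \<le> l * B\<^sup>2" using l by simp
      then show ?thesis using GF[OF that] F_nonneg[of t] by simp
    qed
    consider "\<bar>s\<bar> \<le> B" | "s > B" | "s < - B" by linarith
    then show ?thesis
    proof cases
      case 1
      then show ?thesis by (rule inn)
    next
      case 2
      have "G B \<le> G s"
      proof (rule DERIV_nonneg_imp_nondecreasing[of B s G])
        fix t assume t: "B \<le> t" "t \<le> s"
        have "0 \<le> g t" using gpos[of t] t B cl_id[of B] by (cases "t = B") (auto simp: g_def)
        then show "\<exists>y. (G has_real_derivative y) (at t) \<and> 0 \<le> y" using Gd by blast
      qed (use 2 in simp)
      then show ?thesis using inn[of B] B by simp
    next
      case 3
      have "G (- B) \<le> G s"
      proof (rule DERIV_nonpos_imp_nonincreasing[of s "- B" G])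
        fix t assume t: "s \<le> t" "t \<le> - B"
        have "0 \<le> g (- t)" using gpos[of "- t"] t B cl_id[of B] by (cases "- t = B") (auto simp: g_def)
        then have "g t \<le> 0" using godd[of t] by simp
        then show "\<exists>y. (G has_real_derivative y) (at t) \<and> y \<le> 0" using Gd by blast
      qed (use 3 in simp)
      then show ?thesis using inn[of "- B"] B by simp
    qed
  qed
  show ?thesis
  proof (rule that[of B G g C "l * B\<^sup>2 / 2"])
    show "g s = f s - l * s" if "\<bar>s\<bar> \<le> B" for s using cl_id[OF that] by (simp add: g_def)
  qed (use B(1) Gd gc C godd Glow gpos GF in auto)
qed

end

section \<open>Concentration near the boundary\<close>

locale plane_potential = plane e1 e2 + power_potential F f b p k b0
  for e1 e2 :: "'a::euclidean_space" and F f b p k b0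
begin

abbreviation M :: "'a measure" where "M \<equiv> lebesgue_on (ball 0 1)"

text \<open>Since \<open>F\<close> is superquadratic at \<open>0\<close>, small multiples of a function with Rayleigh quotient below
  \<open>l\<close> have negative energy.\<close>

lemma negative_energy:
  assumes \<phi>: "\<phi> \<in> test_functions (ball (0::'a) 1)" and l: "(L2norm M (grad \<phi>))\<^sup>2 < l * (L2norm M \<phi>)\<^sup>2"
    and B: "B > 0"
  obtains t where "t > 0" "\<And>x. \<bar>t * \<phi> x\<bar> \<le> B"
    "(L2norm M (grad (\<lambda>x. t * \<phi> x)))\<^sup>2 / 2 + (LINT x|M. F (t * \<phi> x) - l * (t * \<phi> x)\<^sup>2 / 2) < 0"
proof -
  obtain K0 where K0: "0 \<le> K0" "\<And>x. \<bar>\<phi> x\<bar> \<le> K0" by (rule test_functions_bounded[OF \<phi>]) (rule that)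
  define K where "K = K0 + 1"
  have K: "K > 0" "\<bar>\<phi> x\<bar> \<le> K" for x using K0(1) K0(2)[of x] by (auto simp: K_def)
  define D where "D = (\<Sum>i=1..k. \<bar>b i\<bar>)"
  have D: "D \<ge> 0" unfolding D_def by (intro sum_nonneg) auto
  define V where "V = measure M (space M)"
  define \<delta> where "\<delta> = (l * (L2norm M \<phi>)\<^sup>2 - (L2norm M (grad \<phi>))\<^sup>2) / 2"
  have \<delta>: "\<delta> > 0" using l by (simp add: \<delta>_def)
  have "((\<lambda>t. D * (K powr p 1 * (t powr (p 1 - 2))) * V) \<longlongrightarrow> D * (K powr p 1 * 0) * V) (at_right 0)"
  proof (intro tendsto_intros)
    have "((\<lambda>t::real. t powr (p 1 - 2)) \<longlongrightarrow> 0 powr (p 1 - 2)) (at_right 0)"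
      using p_gt by (intro tendsto_powr' tendsto_intros) (auto simp: eventually_at_right_field intro: exI[of _ 1])
    then show "((\<lambda>t::real. t powr (p 1 - 2)) \<longlongrightarrow> 0) (at_right 0)" by simp
  qed
  then have "\<forall>\<^sub>F t in at_right 0. D * (K powr p 1 * (t powr (p 1 - 2))) * V < \<delta>"
    using \<delta> by (intro order_tendstoD(2)[where y = "D * (K powr p 1 * 0) * V"]) auto
  moreover have "\<forall>\<^sub>F t in at_right 0. t < min B 1 / K"
    using K B by (intro eventually_at_right_less[THEN eventually_mono] order_tendstoD(2)[OF tendsto_ident_at]) auto
  moreover have "\<forall>\<^sub>F t in at_right (0::real). t > 0" by (simp add: eventually_at_right_less)
  ultimately have "\<forall>\<^sub>F t in at_right 0. D * (K powr p 1 * (t powr (p 1 - 2))) * V < \<delta> \<and> t < min B 1 / K \<and> t > 0"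
    by eventually_elim simp
  then obtain t where t: "D * (K powr p 1 * (t powr (p 1 - 2))) * V < \<delta>" "t < min B 1 / K" "t > 0"
    using eventually_happens[of _ "at_right (0::real)"] by auto
  have tK: "t * K \<le> min B 1" using t(2) K by (simp add: pos_less_divide_eq)
  have bd: "\<bar>t * \<phi> x\<bar> \<le> t * K" for x using K(2)[of x] t(3) by (simp add: abs_mult)
  have Fb: "F (t * \<phi> x) \<le> D * (t * K) powr p 1" for x
  proof -
    have "F (t * \<phi> x) \<le> D * \<bar>t * \<phi> x\<bar> powr p 1"
      unfolding D_def using bd[of x] tK by (intro F_small) simp
    also have "\<dots> \<le> D * (t * K) powr p 1"
      using bd[of x] D p_gt by (intro mult_left_mono powr_mono2) auto
    finally show ?thesis .
  qed
  have s: "smooth \<phi>" using \<phi> by (rule test_functions_smooth)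
  note L = L2_test[OF \<phi>]
  have Fc: "continuous_on UNIV (\<lambda>x. F (t * \<phi> x))"
    by (rule continuous_on_compose2[OF F_continuous _ subset_UNIV])
      (intro continuous_intros continuous_smooth[OF s])
  have FL: "L2 M (\<lambda>x. F (t * \<phi> x))"
    by (rule L2_bounded[where C = "D * (t * K) powr p 1"])
      (use Fb F_nonneg in \<open>auto intro!: continuous_measurable_lebesgue_on Fc\<close>)
  have Fi: "integrable M (\<lambda>x. F (t * \<phi> x))" by (rule L2_integrable[OF _ FL]) simp
  have si: "integrable M (\<lambda>x. (\<phi> x)\<^sup>2)" using L(1) by (simp add: L2_def)
  have "(LINT x|M. F (t * \<phi> x)) \<le> (LINT x|M. D * (t * K) powr p 1)"
    by (intro integral_mono Fi Fb) (simp add: finite_measure.integrable_const)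
  also have "\<dots> = D * (t * K) powr p 1 * V" by (simp add: V_def mult.commute)
  also have "(t * K) powr p 1 = t\<^sup>2 * (K powr p 1 * t powr (p 1 - 2))"
    using t(3) K(1) powr_add[of t "p 1 - 2" 2] by (simp add: powr_mult mult_ac)
  finally have 1: "(LINT x|M. F (t * \<phi> x)) \<le> t\<^sup>2 * (D * (K powr p 1 * t powr (p 1 - 2)) * V)"
    by (simp add: mult_ac)
  also have "\<dots> < t\<^sup>2 * \<delta>" using t by simp
  finally have 2: "(LINT x|M. F (t * \<phi> x)) < t\<^sup>2 * \<delta>" .
  have "(LINT x|M. F (t * \<phi> x) - l * (t * \<phi> x)\<^sup>2 / 2) = (LINT x|M. F (t * \<phi> x)) - (LINT x|M. (l * t\<^sup>2 / 2) * (\<phi> x)\<^sup>2)"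
    using Fi si by (subst Bochner_Integration.integral_diff[symmetric]) (auto simp: power_mult_distrib)
  also have "(LINT x|M. (l * t\<^sup>2 / 2) * (\<phi> x)\<^sup>2) = l * t\<^sup>2 / 2 * (L2norm M \<phi>)\<^sup>2"
    by (simp add: L2norm_sq)
  finally have 3: "(LINT x|M. F (t * \<phi> x) - l * (t * \<phi> x)\<^sup>2 / 2) < t\<^sup>2 * \<delta> - l * t\<^sup>2 / 2 * (L2norm M \<phi>)\<^sup>2"
    using 2 by simp
  have "L2norm M (grad (\<lambda>x. t * \<phi> x)) = \<bar>t\<bar> * L2norm M (grad \<phi>)"
    unfolding grad_cmult[OF s, abs_def] by (rule L2norm_scaleR)
  then have 4: "(L2norm M (grad (\<lambda>x. t * \<phi> x)))\<^sup>2 = t\<^sup>2 * (L2norm M (grad \<phi>))\<^sup>2"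
    by (simp add: power_mult_distrib)
  have "t\<^sup>2 * (L2norm M (grad \<phi>))\<^sup>2 / 2 + (t\<^sup>2 * \<delta> - l * t\<^sup>2 / 2 * (L2norm M \<phi>)\<^sup>2) = 0"
    by (simp add: \<delta>_def field_simps)
  then have "(L2norm M (grad (\<lambda>x. t * \<phi> x)))\<^sup>2 / 2 + (LINT x|M. F (t * \<phi> x) - l * (t * \<phi> x)\<^sup>2 / 2) < 0"
    using 3 4 by linarith
  then show ?thesis using that[OF t(3)] bd tK by (meson min.boundedE order_trans)
qed

text \<open>The angular Poincare inequality survives passage to the limit in mean.\<close>

lemma H10_approx_Poincare:
  assumes ap: "H10_approx \<phi> u \<gamma>" and odd: "\<And>j. \<phi> j \<in> odd_tests m" and m: "m \<ge> 1"
    and A: "A \<in> sets borel" "\<And>t x. rot t x \<in> A \<longleftrightarrow> x \<in> A"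
    and c: "\<And>x. x \<in> A \<Longrightarrow> norm x < 1 \<Longrightarrow> norm x \<le> c" "0 \<le> c"
  shows "(real (2 * m))\<^sup>2 * (LINT x|M. indicator A x * (u x)\<^sup>2) \<le> c\<^sup>2 * (LINT x|M. indicator A x * (norm (\<gamma> x))\<^sup>2)"
proof -
  note D = H10_approxD[OF ap]
  have lim: "L2lim M (\<lambda>j x. indicator A x *\<^sub>R \<phi> j x) (\<lambda>x. indicator A x *\<^sub>R u x)"
    by (rule L2lim_contraction[OF D(2) L2_indicator[OF L2limD(1)[OF D(2)] A(1)] L2_indicator[OF D(4) A(1)], where C = 1])
      (auto simp: indicator_def)
  have glim: "L2lim M (\<lambda>j x. indicator A x *\<^sub>R grad (\<phi> j) x) (\<lambda>x. indicator A x *\<^sub>R \<gamma> x)"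
    by (rule L2lim_contraction[OF D(3) L2_indicator[OF L2limD(1)[OF D(3)] A(1)] L2_indicator[OF D(5) A(1)], where C = 1])
      (auto simp: indicator_def)
  have "(real (2 * m))\<^sup>2 * (L2norm M (\<lambda>x. indicator A x *\<^sub>R u x))\<^sup>2 \<le> c\<^sup>2 * (L2norm M (\<lambda>x. indicator A x *\<^sub>R \<gamma> x))\<^sup>2"
  proof (rule LIMSEQ_le)
    show "(\<lambda>j. (real (2 * m))\<^sup>2 * (L2norm M (\<lambda>x. indicator A x *\<^sub>R \<phi> j x))\<^sup>2) \<longlonglongrightarrow>
        (real (2 * m))\<^sup>2 * (L2norm M (\<lambda>x. indicator A x *\<^sub>R u x))\<^sup>2"
      by (intro tendsto_mult tendsto_const tendsto_power L2lim_norm lim)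
    show "(\<lambda>j. c\<^sup>2 * (L2norm M (\<lambda>x. indicator A x *\<^sub>R grad (\<phi> j) x))\<^sup>2) \<longlonglongrightarrow>
        c\<^sup>2 * (L2norm M (\<lambda>x. indicator A x *\<^sub>R \<gamma> x))\<^sup>2"
      by (intro tendsto_mult tendsto_const tendsto_power L2lim_norm glim)
    show "\<exists>N. \<forall>j\<ge>N. (real (2 * m))\<^sup>2 * (L2norm M (\<lambda>x. indicator A x *\<^sub>R \<phi> j x))\<^sup>2
        \<le> c\<^sup>2 * (L2norm M (\<lambda>x. indicator A x *\<^sub>R grad (\<phi> j) x))\<^sup>2"
      using odd_tests_Poincare[OF odd m A c] by blast
  qed
  moreover have sq: "(L2norm M (\<lambda>x. indicator A x *\<^sub>R v x))\<^sup>2 = (LINT x|M. indicator A x * (norm (v x))\<^sup>2)"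
    for v :: "'a \<Rightarrow> 'b::euclidean_space"
    unfolding L2norm_sq by (intro Bochner_Integration.integral_cong) (auto simp: indicator_def)
  ultimately show ?thesis unfolding sq by simp
qed

lemma integral_lebesgue_on_ball:
  fixes h :: "'a \<Rightarrow> real"
  assumes "\<tau> \<le> 1"
  shows "(LINT x|lebesgue_on (ball 0 \<tau>). h x) = (LINT x|M. indicator (ball 0 \<tau>) x * h x)"
proof -
  have "(\<lambda>x. indicator (ball 0 1) x *\<^sub>R (indicator (ball 0 \<tau>) x * h x)) = (\<lambda>x. indicator (ball 0 \<tau>) x *\<^sub>R h x)"
    using assms by (auto simp: fun_eq_iff indicator_def)
  then show ?thesis by (simp only: integral_restrict_space sets.Int_space_eq2 lmeasurable_ball fmeasurableD)
qed

text \<open>The angular Poincare inequality gives \<open>n\<^sup>2 / \<tau>\<^sup>2\<close> as a lower bound for the Dirichlet integral per unit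
  mass inside the ball of radius \<open>\<tau>\<close>, and \<open>n\<^sup>2\<close> outside. As \<open>\<lambda>\<close> exceeds \<open>n\<^sup>2\<close> only by the factor
  \<open>1 + \<epsilon>\<close>, negative total energy leaves only mass and energy of order \<open>\<epsilon>\<close> inside.\<close>

lemma energy_ratio_le:
  fixes X Xi Di Do Fi Fo n \<epsilon> \<tau> :: real
  assumes neg: "(Di + Do) / 2 + (Fi + Fo) < (1 + \<epsilon>) * n\<^sup>2 / 2 * X"
    and inn: "n\<^sup>2 * Xi \<le> \<tau>\<^sup>2 * Di" and out: "n\<^sup>2 * (X - Xi) \<le> Do"
    and F: "0 \<le> Fi" "0 \<le> Fo" and D: "0 \<le> Di" "0 \<le> Do" and X: "0 \<le> Xi" "0 \<le> X"
    and tot: "n\<^sup>2 * X \<le> Di + Do"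
    and \<tau>: "0 < \<tau>" "\<tau> < 1" and \<epsilon>: "\<epsilon> > 0" and n: "n > 0"
  shows "0 < Di / 2 + Fi + (Do / 2 + Fo)" "(Di / 2 + Fi) / (Di / 2 + Fi + (Do / 2 + Fo)) \<le> \<epsilon> / (1 - \<tau>\<^sup>2)"
proof -
  define E Et where E: "E = Di / 2 + Fi + (Do / 2 + Fo)" and Et: "Et = Di / 2 + Fi"
  have \<tau>2: "\<tau>\<^sup>2 < 1" "\<tau>\<^sup>2 > 0" using \<tau> by (auto simp: power_less_one_iff)
  have X0: "X > 0"
  proof (rule ccontr)
    assume "\<not> X > 0"
    then have "X = 0" using X by simp
    moreover have "0 \<le> (Di + Do) / 2 + (Fi + Fo)" using F D by (intro add_nonneg_nonneg) auto
    ultimately show False using neg by simp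
  qed
  have nX: "n\<^sup>2 * X > 0" using X0 n by simp
  have E_ge: "n\<^sup>2 * X / 2 \<le> E" using tot F by (simp add: E)
  then show pos: "0 < Di / 2 + Fi + (Do / 2 + Fo)" using nX by (simp add: E)
  have a: "2 * Et \<le> \<epsilon> * (n\<^sup>2 * X) + n\<^sup>2 * Xi"
  proof -
    have lin: "2 * Et \<le> v + w" if "(Di + Do) / 2 + (Fi + Fo) < (s + v) / 2" "s - w \<le> Do" for s v w
      using that F unfolding Et by argo
    have "(1 + \<epsilon>) * n\<^sup>2 / 2 * X = (n\<^sup>2 * X + \<epsilon> * (n\<^sup>2 * X)) / 2" by (simp add: algebra_simps)
    moreover have "n\<^sup>2 * (X - Xi) = n\<^sup>2 * X - n\<^sup>2 * Xi" by (simp add: algebra_simps)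
    ultimately show ?thesis using neg out by (intro lin) simp_all
  qed
  have "n\<^sup>2 * Xi \<le> \<tau>\<^sup>2 * (2 * Et)"
  proof -
    have "\<tau>\<^sup>2 * Di \<le> \<tau>\<^sup>2 * (2 * Et)" using F \<tau>2 by (intro mult_left_mono) (auto simp: Et)
    with inn show ?thesis by linarith
  qed
  with a have "2 * Et * (1 - \<tau>\<^sup>2) \<le> \<epsilon> * (n\<^sup>2 * X)" by (simp add: algebra_simps)
  also have "\<dots> \<le> \<epsilon> * (2 * E)" using E_ge \<epsilon> by (intro mult_left_mono) auto
  finally have "Et * (1 - \<tau>\<^sup>2) \<le> \<epsilon> * E" by simp
  then have "Et / E \<le> \<epsilon> / (1 - \<tau>\<^sup>2)"
    using pos \<tau>2 unfolding E[symmetric] by (simp add: pos_divide_le_eq pos_le_divide_eq mult.commute)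
  then show "(Di / 2 + Fi) / (Di / 2 + Fi + (Do / 2 + Fo)) \<le> \<epsilon> / (1 - \<tau>\<^sup>2)" by (simp add: E Et)
qed

text \<open>With \<open>l = (1 + \<epsilon>) * n\<^sup>2\<close>, a test function with low Rayleigh quotient makes the minimal energy in the symmetry
  class negative. The minimiser solves the equation, and \<open>energy_ratio_le\<close> applies to it.\<close>

theorem concentrated_solution:
  assumes \<epsilon>: "\<epsilon> > 0"
  shows "\<exists>u l. u \<in> V_space (p k) (ball (0::'a) 1) \<and> weak_solution f (p k) (ball 0 1) l u \<and> real N \<le> l \<and>
    energy F 1 u > 0 \<and>
    (\<forall>\<tau>\<in>{0<..<1}. 0 \<le> energy F \<tau> u \<and> energy F \<tau> u / energy F 1 u \<le> \<epsilon> / (1 - \<tau>\<^sup>2))"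
proof -
  obtain m \<phi>0 where m: "m \<ge> N" "m \<ge> 1" and \<phi>0: "\<phi>0 \<in> test_functions (ball 0 1)"
    "\<And>x. \<phi>0 (rot (pi / real (2 * m)) x) = - \<phi>0 x"
    and Ray: "(L2norm M (grad \<phi>0))\<^sup>2 < (1 + \<epsilon>) * (real (2 * m))\<^sup>2 * (L2norm M \<phi>0)\<^sup>2"
    by (rule exists_low_Rayleigh[OF \<epsilon>, of N]) (rule that)
  define n where "n = real (2 * m)"
  have n: "n \<ge> 1" "n > 0" "real N \<le> n" using m by (auto simp: n_def)
  define l where "l = (1 + \<epsilon>) * n\<^sup>2"
  have l: "l > 0" using \<epsilon> n by (simp add: l_def)
  have lN: "real N \<le> l"
  proof -
    have "n * 1 \<le> n * n" using n by (intro mult_left_mono) auto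
    also have "\<dots> = 1 * n\<^sup>2" by (simp add: power2_eq_square)
    also have "\<dots> \<le> l" unfolding l_def using \<epsilon> by (intro mult_right_mono) auto
    finally show ?thesis using n by linarith
  qed
  obtain B C c0 G g where B: "B > 0" and Gd: "\<And>s. (G has_real_derivative g s) (at s)"
    and gc: "continuous_on UNIV g" and gb: "\<And>s. \<bar>g s\<bar> \<le> (C::real)"
    and godd: "\<And>s. g (- s) = - g s" and Glow: "\<And>s. - c0 \<le> G s" and gpos: "\<And>s. s > B \<Longrightarrow> 0 < g s"
    and gf: "\<And>s. \<bar>s\<bar> \<le> B \<Longrightarrow> g s = f s - l * s"
    and GF: "\<And>s. \<bar>s\<bar> \<le> B \<Longrightarrow> G s = F s - l * s\<^sup>2 / 2"
    by (rule truncation[OF l]) (rule that)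
  interpret T: truncated_energy e1 e2 G g C c0 m
    by unfold_locales (use Gd gc gb godd Glow m in auto)
  obtain \<phi> u \<gamma> where ap: "H10_approx \<phi> u \<gamma>" and odd: "\<And>j. \<phi> j \<in> odd_tests m"
    and ae: "AE x in M. (\<lambda>j. \<phi> j x) \<longlonglongrightarrow> u x"
    and mini: "\<And>v. v \<in> odd_tests m \<Longrightarrow> T.energy_functional u \<gamma> \<le> T.energy_functional v (grad v)"
    by (rule T.exists_minimiser) (rule that)
  interpret E: energy_minimiser e1 e2 G g C c0 m \<phi> u \<gamma>
    by unfold_locales (use ap odd ae mini in auto)
  have fin: "finite_measure M" by simp
  have uL: "L2 M u" and \<gamma>L: "L2 M \<gamma>" using H10_approxD[OF ap] by auto
  note um = L2_measurable[OF uL]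
  have uB: "AE x in M. \<bar>u x\<bar> \<le> B" by (rule E.minimiser_bounded) (use B gpos in auto)
  have Jneg: "T.energy_functional u \<gamma> < 0"
  proof -
    obtain t where t: "t > 0" "\<And>x. \<bar>t * \<phi>0 x\<bar> \<le> B"
      "(L2norm M (grad (\<lambda>x. t * \<phi>0 x)))\<^sup>2 / 2 + (LINT x|M. F (t * \<phi>0 x) - l * (t * \<phi>0 x)\<^sup>2 / 2) < 0"
      using negative_energy[OF \<phi>0(1) _ B, of l] Ray by (auto simp: l_def n_def)
    have "(\<lambda>x. t * \<phi>0 x) \<in> odd_tests m"
      using \<phi>0 by (intro odd_tests_cmult) (simp add: odd_tests_def)
    from mini[OF this] t(3) show ?thesis by (simp add: T.energy_functional_def GF[OF t(2)])
  qed
  have Fm: "(\<lambda>x. F (u x)) \<in> borel_measurable M" "(\<lambda>x. f (u x)) \<in> borel_measurable M"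
    using measurable_compose[OF um borel_measurable_continuous_onI[OF F_continuous]]
      measurable_compose[OF um borel_measurable_continuous_onI[OF f_continuous]] by auto
  have GFae: "AE x in M. G (u x) = F (u x) - l * (u x)\<^sup>2 / 2" using uB by eventually_elim (rule GF)
  have gfae: "AE x in M. f (u x) = g (u x) + l * u x" using uB by eventually_elim (simp add: gf)
  have Gi: "integrable M (\<lambda>x. G (u x))" by (rule T.integrable_G[OF uL])
  have u2i: "integrable M (\<lambda>x. (u x)\<^sup>2)" using uL by (simp add: L2_def)
  have \<gamma>2i: "integrable M (\<lambda>x. (norm (\<gamma> x))\<^sup>2)" using \<gamma>L by (simp add: L2_def)
  have Fi: "integrable M (\<lambda>x. F (u x))"
  proof (rule integrable_cong_AE_imp[OF _ Fm(1)])
    show "integrable M (\<lambda>x. G (u x) + l / 2 * (u x)\<^sup>2)" using Gi u2i by simp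
    show "AE x in M. G (u x) + l / 2 * (u x)\<^sup>2 = F (u x)" using GFae by eventually_elim simp
  qed
  have tot: "(LINT x|M. (norm (\<gamma> x))\<^sup>2) / 2 + (LINT x|M. F (u x)) < l / 2 * (LINT x|M. (u x)\<^sup>2)"
  proof -
    have "(LINT x|M. G (u x)) = (LINT x|M. F (u x) - l / 2 * (u x)\<^sup>2)"
      using GFae Gi Fi u2i by (intro integral_cong_AE) auto
    also have "\<dots> = (LINT x|M. F (u x)) - l / 2 * (LINT x|M. (u x)\<^sup>2)" using Fi u2i by simp
    finally show ?thesis using Jneg by (simp add: T.energy_functional_def L2norm_sq)
  qed
  let ?Du = "weak_grad (ball 0 1) u"
  note W = weak_grad_AE[OF H10_approx_has_weak_gradient[OF ap]]
  have Dum: "?Du \<in> borel_measurable M" by (rule has_weak_gradient_measurable[OF W(1)])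
  have DuL: "L2 M ?Du" by (rule L2norm_mono(1)[OF Dum \<gamma>L]) (use W(2) in \<open>auto elim: eventually_mono\<close>)
  have gL: "L2 M (\<lambda>x. g (u x))" by (rule T.L2_g[OF um])
  have fL: "L2 M (\<lambda>x. f (u x))"
  proof -
    have "L2 M (\<lambda>x. g (u x) + l * u x)" using L2_add[OF gL L2_scaleR[OF uL, of l]] by simp
    moreover have "AE x in M. norm (f (u x)) \<le> norm (g (u x) + l * u x)" using gfae by eventually_elim simp
    ultimately show ?thesis by (rule L2norm_mono(1)[OF Fm(2)])
  qed
  have uV: "u \<in> V_space (p k) (ball 0 1)"
  proof -
    have H: "u \<in> H10 (ball 0 1)" by (rule H10_approx_in_H10[OF ap])
    define q where "q = real DIM('a) * (p k - 2) / 2"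
    have q: "q \<ge> 0" using p_gt_2[of k] k by (simp add: q_def)
    have "integrable M (\<lambda>x. norm (u x) powr q)"
    proof (rule L2_integrable[OF fin], rule L2_bounded[OF fin, where C = "B powr q"])
      show "(\<lambda>x. norm (u x) powr q) \<in> borel_measurable M" using um by measurable
      show "AE x in M. norm (norm (u x) powr q) \<le> B powr q"
        using uB by eventually_elim (use q in \<open>auto intro: powr_mono2\<close>)
    qed
    then have "u \<in> Lp_space q (ball 0 1)" using um by (simp add: Lp_space_def)
    with H show ?thesis by (simp add: V_space_def Let_def q_def)
  qed
  have sol: "weak_solution f (p k) (ball 0 1) l u"
    unfolding weak_solution_def
  proof (intro conjI uV ballI)
    fix v :: "'a \<Rightarrow> real" assume "v \<in> H10 (ball 0 1)"
    then obtain \<psi> where \<psi>: "H10_approx \<psi> v (weak_grad (ball 0 1) v)" by (rule H10_obtain_approx)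
    let ?Dv = "weak_grad (ball 0 1) v"
    note D = H10_approxD[OF \<psi>]
    have i1: "integrable M (\<lambda>x. ?Du x \<bullet> ?Dv x)" by (rule L2_inner_integrable[OF DuL D(5)])
    have i2: "integrable M (\<lambda>x. f (u x) * v x)" using L2_inner_integrable[OF fL D(4)] by simp
    have i3: "integrable M (\<lambda>x. g (u x) * v x)" using L2_inner_integrable[OF gL D(4)] by simp
    show i4: "integrable M (\<lambda>x. u x * v x)" using L2_inner_integrable[OF uL D(4)] by simp
    show "integrable M (\<lambda>x. ?Du x \<bullet> ?Dv x + f (u x) * v x)" using i1 i2 by simp
    have "(\<lambda>j. (LINT x|M. grad (\<psi> j) x \<bullet> \<gamma> x) + (LINT x|M. \<psi> j x \<bullet> g (u x))) \<longlonglongrightarrow>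
        (LINT x|M. ?Dv x \<bullet> \<gamma> x) + (LINT x|M. v x \<bullet> g (u x))"
      by (intro tendsto_add L2lim_inner D \<gamma>L gL)
    moreover have "(LINT x|M. grad (\<psi> j) x \<bullet> \<gamma> x) + (LINT x|M. \<psi> j x \<bullet> g (u x)) = 0" for j
      using E.Euler_Lagrange[OF D(1)[of j]]
      by (simp add: T.first_variation_def inner_commute[of "\<gamma> _"] mult.commute[of "g _"])
    ultimately have EL: "(LINT x|M. ?Dv x \<bullet> \<gamma> x) + (LINT x|M. v x * g (u x)) = 0"
      by (simp add: LIMSEQ_const_iff)
    have "(LINT x|M. ?Du x \<bullet> ?Dv x + f (u x) * v x) = (LINT x|M. ?Du x \<bullet> ?Dv x) + (LINT x|M. f (u x) * v x)"
      using i1 i2 by simp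
    also have "(LINT x|M. ?Du x \<bullet> ?Dv x) = (LINT x|M. ?Dv x \<bullet> \<gamma> x)"
      using i1 L2_inner_integrable[OF D(5) \<gamma>L] W(2)
      by (intro integral_cong_AE) (auto simp: inner_commute elim: eventually_mono)
    also have "(LINT x|M. f (u x) * v x) = (LINT x|M. g (u x) * v x + l * (u x * v x))"
      using i2 i3 i4 gfae
      by (intro integral_cong_AE) (auto simp: algebra_simps elim: eventually_mono)
    also have "\<dots> = (LINT x|M. v x * g (u x)) + l * (LINT x|M. u x * v x)"
      using i3 i4 by (simp add: mult.commute)
    finally show "(LINT x|M. ?Du x \<bullet> ?Dv x + f (u x) * v x) = l * (LINT x|M. u x * v x)"
      using EL by simp
  qed
  have energy_eq: "energy F \<tau> u = (LINT x|M. indicator (ball 0 \<tau>) x * (norm (\<gamma> x))\<^sup>2) / 2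
      + (LINT x|M. indicator (ball 0 \<tau>) x * F (u x))" if "\<tau> \<le> 1" for \<tau>
  proof -
    have S: "ball 0 \<tau> \<in> sets M" using that by (simp add: sets_restrict_space_iff subset_ball)
    have I: "integrable M (\<lambda>x. indicator (ball 0 \<tau>) x * (norm (\<gamma> x))\<^sup>2)"
      "integrable M (\<lambda>x. indicator (ball 0 \<tau>) x * F (u x))"
      using integrable_mult_indicator[OF S \<gamma>2i] integrable_mult_indicator[OF S Fi] by simp_all
    have mD: "(\<lambda>x. indicator (ball 0 \<tau>) x * ((norm (?Du x))\<^sup>2 / 2 + F (u x))) \<in> borel_measurable M"
      using S Dum Fm(1) by (intro borel_measurable_times borel_measurable_indicator borel_measurable_add
          borel_measurable_divide borel_measurable_power borel_measurable_norm borel_measurable_const) auto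
    have "energy F \<tau> u = (LINT x|M. indicator (ball 0 \<tau>) x * ((norm (?Du x))\<^sup>2 / 2 + F (u x)))"
      unfolding energy_def by (rule integral_lebesgue_on_ball[OF that])
    also have "\<dots> = (LINT x|M. indicator (ball 0 \<tau>) x * (norm (\<gamma> x))\<^sup>2 / 2 + indicator (ball 0 \<tau>) x * F (u x))"
      using W(2) mD I by (intro integral_cong_AE) (auto simp: algebra_simps elim: eventually_mono)
    also have "\<dots> = (LINT x|M. indicator (ball 0 \<tau>) x * (norm (\<gamma> x))\<^sup>2) / 2 + (LINT x|M. indicator (ball 0 \<tau>) x * F (u x))"
      using I by simp
    finally show ?thesis .
  qed
  have split: "(LINT x|M. h x) = (LINT x|M. indicator (ball 0 \<tau>) x * h x) + (LINT x|M. indicator (- ball 0 \<tau>) x * h x)"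
    if "integrable M h" "\<tau> \<le> 1" for h :: "'a \<Rightarrow> real" and \<tau>
  proof -
    have S: "ball 0 \<tau> \<in> sets M" using that by (simp add: sets_restrict_space_iff subset_ball)
    have I: "integrable M (\<lambda>x. indicator (ball 0 \<tau>) x * h x)"
      using integrable_mult_indicator[OF S that(1)] by simp
    have "(\<lambda>x. indicator (- ball 0 \<tau>) x * h x) = (\<lambda>x. h x - indicator (ball 0 \<tau>) x * h x)"
      by (auto simp: fun_eq_iff indicator_def)
    then show ?thesis using I that(1) by simp
  qed
  have one: "(LINT x|M. indicator (ball 0 1) x * h x) = (LINT x|M. h x)" for h :: "'a \<Rightarrow> real"
    by (intro Bochner_Integration.integral_cong) (auto simp: space_restrict_space)
  have main: "energy F 1 u > 0 \<and> 0 \<le> energy F \<tau> u \<and> energy F \<tau> u / energy F 1 u \<le> \<epsilon> / (1 - \<tau>\<^sup>2)"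
    if \<tau>: "0 < \<tau>" "\<tau> < 1" for \<tau>
  proof -
    define Xi where "Xi = (LINT x|M. indicator (ball 0 \<tau>) x * (u x)\<^sup>2)"
    define X where "X = (LINT x|M. (u x)\<^sup>2)"
    define Di where "Di = (LINT x|M. indicator (ball 0 \<tau>) x * (norm (\<gamma> x))\<^sup>2)"
    define Do where "Do = (LINT x|M. indicator (- ball 0 \<tau>) x * (norm (\<gamma> x))\<^sup>2)"
    define Ei where "Ei = (LINT x|M. indicator (ball 0 \<tau>) x * F (u x))"
    define Eo where "Eo = (LINT x|M. indicator (- ball 0 \<tau>) x * F (u x))"
    have sp: "(LINT x|M. indicator (- ball 0 \<tau>) x * (u x)\<^sup>2) = X - Xi"
      "(LINT x|M. (norm (\<gamma> x))\<^sup>2) = Di + Do" "(LINT x|M. F (u x)) = Ei + Eo"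
      using split[OF u2i, of \<tau>] split[OF \<gamma>2i, of \<tau>] split[OF Fi, of \<tau>] \<tau>
      by (simp_all add: Xi_def X_def Di_def Do_def Ei_def Eo_def)
    have nonneg: "0 \<le> Ei" "0 \<le> Eo" "0 \<le> Di" "0 \<le> Do" "0 \<le> Xi" "0 \<le> X"
      unfolding Ei_def Eo_def Di_def Do_def Xi_def X_def
      by (auto intro!: Bochner_Integration.integral_nonneg mult_nonneg_nonneg F_nonneg)
    have inn: "n\<^sup>2 * Xi \<le> \<tau>\<^sup>2 * Di"
      unfolding n_def Xi_def Di_def
      by (rule H10_approx_Poincare[OF ap odd m(2)]) (use \<tau> in auto)
    have out: "n\<^sup>2 * (X - Xi) \<le> Do"
      using H10_approx_Poincare[OF ap odd m(2), of "- ball 0 \<tau>" 1] unfolding sp(1)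
      by (simp add: n_def Do_def)
    have whole: "n\<^sup>2 * X \<le> Di + Do"
      using H10_approx_Poincare[OF ap odd m(2), of UNIV 1] sp(2) by (simp add: n_def X_def)
    have neg: "(Di + Do) / 2 + (Ei + Eo) < (1 + \<epsilon>) * n\<^sup>2 / 2 * X"
      using tot unfolding sp(2,3) X_def[symmetric] l_def by simp
    have e1: "energy F 1 u = Di / 2 + Ei + (Do / 2 + Eo)"
      using energy_eq[of 1] unfolding one sp(2,3) by (simp add: field_simps)
    have et: "energy F \<tau> u = Di / 2 + Ei" using energy_eq[of \<tau>] \<tau> by (simp add: Di_def Ei_def)
    show ?thesis
      unfolding e1 et
      using energy_ratio_le[OF neg inn out nonneg whole \<tau> \<epsilon> n(2)] nonneg by simp
  qed
  have "energy F 1 u > 0" using main[of "1/2"] by simp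
  then show ?thesis using uV sol lN main by (intro exI[of _ u] exI[of _ l]) auto
qed

end

theorem theorem1p1:
  fixes F f :: "real \<Rightarrow> real" and b p :: "nat \<Rightarrow> real" and k :: nat and b0 :: real
  assumes dim: "CARD('n::finite) \<ge> 2"
    and k: "k \<ge> 1"
    and p_gt: "2 < p 1"
    and p_mono: "strict_mono_on {1..k} p"
    and F_eq: "\<And>s. F s = (\<Sum>i=1..k. b i * \<bar>s\<bar> powr p i)"
    and F_nonneg: "\<And>s. 0 \<le> F s"
    and b0: "0 < b0"
    and F_ge: "\<And>s. F s \<ge> b0 * \<bar>s\<bar> powr p 1"
    and f_deriv: "\<And>s. (F has_real_derivative f s) (at s)"
  shows "\<exists>(u :: nat \<Rightarrow> real ^ 'n \<Rightarrow> real) (lam :: nat \<Rightarrow> real).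
    (\<forall>n. u n \<in> V_space (p k) (ball 0 1) \<and> weak_solution f (p k) (ball 0 1) (lam n) (u n)) \<and>
    filterlim lam at_top sequentially \<and>
    (\<forall>n. energy F 1 (u n) \<noteq> 0) \<and>
    (\<forall>\<tau>\<in>{0<..<1}. (\<lambda>n. energy F \<tau> (u n) / energy F 1 (u n)) \<longlonglongrightarrow> 0)"
proof -
  obtain S :: "'n set" where "card S = 2" using obtain_subset_with_card_n[OF dim] by blast
  then obtain i j :: 'n where ij: "i \<noteq> j" by (auto simp: card_2_iff)
  interpret plane_potential "axis i 1 :: real ^ 'n" "axis j 1" F f b p k b0
    by unfold_locales (use ij k p_gt p_mono F_eq F_nonneg b0 F_ge f_deriv in \<open>auto simp: inner_axis_axis\<close>)
  have "\<exists>u l. u \<in> V_space (p k) (ball (0 :: real ^ 'n) 1) \<and> weak_solution f (p k) (ball 0 1) l u \<and> real n \<le> l \<and>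
    energy F 1 u > 0 \<and>
    (\<forall>\<tau>\<in>{0<..<1}. 0 \<le> energy F \<tau> u \<and> energy F \<tau> u / energy F 1 u \<le> (1 / real (Suc n)) / (1 - \<tau>\<^sup>2))" for n
    by (rule concentrated_solution) simp
  then obtain u :: "nat \<Rightarrow> real ^ 'n \<Rightarrow> real" and lam where
    sol: "\<And>n. u n \<in> V_space (p k) (ball 0 1)" "\<And>n. weak_solution f (p k) (ball 0 1) (lam n) (u n)"
    and lam: "\<And>n. real n \<le> lam n" and E: "\<And>n. energy F 1 (u n) > 0"
    and ratio: "\<And>n \<tau>. \<tau> \<in> {0<..<1} \<Longrightarrow> 0 \<le> energy F \<tau> (u n)"
      "\<And>n \<tau>. \<tau> \<in> {0<..<1} \<Longrightarrow> energy F \<tau> (u n) / energy F 1 (u n) \<le> (1 / real (Suc n)) / (1 - \<tau>\<^sup>2)"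
    by metis
  have "filterlim lam at_top sequentially"
    by (rule filterlim_at_top_mono[OF filterlim_real_sequentially]) (simp add: lam)
  moreover have "(\<lambda>n. energy F \<tau> (u n) / energy F 1 (u n)) \<longlonglongrightarrow> 0" if \<tau>: "\<tau> \<in> {0<..<1}" for \<tau>
  proof (rule Lim_null_comparison)
    have "(\<lambda>n. 1 / real (Suc n)) \<longlonglongrightarrow> 0" using LIMSEQ_inverse_real_of_nat by (simp add: inverse_eq_divide)
    from tendsto_mult_left_zero[OF this, of "1 / (1 - \<tau>\<^sup>2)"]
    show "(\<lambda>n. (1 / real (Suc n)) / (1 - \<tau>\<^sup>2)) \<longlonglongrightarrow> 0" by simp
    have "norm (energy F \<tau> (u n) / energy F 1 (u n)) \<le> (1 / real (Suc n)) / (1 - \<tau>\<^sup>2)" for n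
      using ratio[OF \<tau>, of n] E[of n] by simp
    then show "\<forall>\<^sub>F n in sequentially. norm (energy F \<tau> (u n) / energy F 1 (u n)) \<le> (1 / real (Suc n)) / (1 - \<tau>\<^sup>2)"
      by simp
  qed
  ultimately show ?thesis
    using sol E by (intro exI[of _ u] exI[of _ lam]) (auto simp: less_imp_neq[symmetric])
qed

end
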